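(* Let $0<\alpha_0<\alpha_1=\alpha_2<\alpha_3$ and consider the geodesic flow on the three-dimensional ellipsoid $\{x\in\mathbb{R}^4:\sum_{i=0}^3 x_i^2/\alpha_i=1\}$ with energy momentum map $\mathcal{EM}=(H,J,G):M\to\mathbb{R}^3$ (see context). Fix an energy $h>0$. Then the image of $\mathcal{EM}$ for constant energy $H=h$, i.e. the set of values $(j,g)$ of $(J,G)$ on $\{H=h\}\subset M$, is the (compact) region in $\mathbb{R}^2$ bounded by the quadratic curves $$g=\frac{2\alpha_1}{\alpha_1-\alpha_3}h-\frac{\alpha_3}{\alpha_1(\alpha_1-\alpha_3)}j^2,\qquad g=\frac{2\alpha_1}{\alpha_1-\alpha_0}h-\frac{\alpha_0}{\alpha_1(\alpha_1-\alpha_0)}j^2 .$$ The singular values of the energy momentum map at energy $h$ are exactly: the points of these boundary curves (of elliptic type, away from the intersections of the two curves), the intersection points of the two boundary curves (of elliptic-elliptic type), and an isolated singular value at the origin $(j,g)=(0,0)$, of focus-focus type.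
   Context: Coordinates on $\mathbb{R}^8$ are $(x,y)=(x_0,\dots,x_3,y_0,\dots,y_3)$. Put $C_1=\sum_{i=0}^3 x_i^2/\alpha_i-1$, $C_2=\sum_{i=0}^3 x_iy_i/\alpha_i$, $D=\sum_{i=0}^3 x_i^2/\alpha_i^2$. The Dirac bracket, with Casimirs $C_1,C_2$, is $$\{x_i,x_j\}=0,\qquad \{x_i,y_j\}=\delta_{ij}-\frac{x_ix_j}{D\alpha_i\alpha_j},\qquad \{y_i,y_j\}=-\frac{x_iy_j-x_jy_i}{D\alpha_i\alpha_j}.$$ The phase space is the 6-dimensional symplectic leaf $M=\{C_1=C_2=0\}$. The geodesic flow is generated by $H=\frac12(y_0^2+y_1^2+y_2^2+y_3^2)$; the other (commuting) integrals are $J=x_1y_2-x_2y_1$ and $$G = y_1^2 + y_2^2 + \frac{(x_0y_1 - x_1y_0)^2+(x_0y_2 - x_2y_0)^2}{\alpha_1 - \alpha_0} + \frac{(x_1y_3 - x_3y_1)^2+(x_2y_3 - x_3y_2)^2}{\alpha_1 - \alpha_3}.$$ A point of $M$ is critical if $dH,dJ,dG$ (restricted to $M$) are linearly dependent there; its corank is $3$ minus the rank of $d\mathcal{EM}$. A singular value is the image of a critical point. Types are in the usual sense for non-degenerate singularities of integrable Hamiltonian systems (Williamson/Eliasson): at a critical point of corank $r$, the linearizations of those Hamiltonian vector fields of combinations of the integrals that vanish at the point act on the $2r$-dimensional symplectic space (symplectic orthogonal of the orbit directions modulo the orbit directions) and span a Cartan subalgebra of $\mathfrak{sp}(2r,\mathbb{R})$.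 The type is elliptic if $r=1$ with a non-zero purely imaginary eigenvalue pair, elliptic-elliptic if $r=2$ with two independent purely imaginary pairs, and focus-focus if $r=2$ and a generic element has a complex quadruple $\pm a\pm \mathrm{i}b$ of eigenvalues ($a,b\ne0$). A singular value is said to have a given type if the critical points in its fibre (at energy $h$) are non-degenerate of that type. *)

theory Defs
  imports "HOL-Analysis.Analysis" "Jordan_Normal_Form.Spectral_Radius"
begin

no_notation Matrix.vec_index (infixl "$" 100)

text \<open>
  Coordinates on \<open>\<real>\<^sup>8\<close> are pairs \<open>(x, y)\<close>. The index type \<open>4\<close> is \<open>\<int>/4\<close>, so its elements are
  exactly \<open>0, 1, 2, 3\<close>, as in the indexing of the coordinates and of the parameters \<open>\<alpha>\<^sub>i\<close>.
\<close>

type_synonym phase = "(real^4) \<times> (real^4)"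

definition C1 :: "real^4 \<Rightarrow> phase \<Rightarrow> real" where
  "C1 \<alpha> = (\<lambda>(x, y). (\<Sum>i\<in>UNIV. (x $ i)\<^sup>2 / \<alpha> $ i) - 1)"

definition C2 :: "real^4 \<Rightarrow> phase \<Rightarrow> real" where
  "C2 \<alpha> = (\<lambda>(x, y). \<Sum>i\<in>UNIV. x $ i * y $ i / \<alpha> $ i)"

definition Dfun :: "real^4 \<Rightarrow> phase \<Rightarrow> real" where
  "Dfun \<alpha> = (\<lambda>(x, y). \<Sum>i\<in>UNIV. (x $ i)\<^sup>2 / (\<alpha> $ i)\<^sup>2)"

definition M :: "real^4 \<Rightarrow> phase set" where
  "M \<alpha> = {p. C1 \<alpha> p = 0 \<and> C2 \<alpha> p = 0}"

section \<open>The Dirac bracket\<close>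

definition bracket_xy :: "real^4 \<Rightarrow> phase \<Rightarrow> 4 \<Rightarrow> 4 \<Rightarrow> real" where
  "bracket_xy \<alpha> p i j =
     (if i = j then 1 else 0) - fst p $ i * fst p $ j / (Dfun \<alpha> p * \<alpha> $ i * \<alpha> $ j)"

definition bracket_yy :: "real^4 \<Rightarrow> phase \<Rightarrow> 4 \<Rightarrow> 4 \<Rightarrow> real" where
  "bracket_yy \<alpha> p i j =
     - (fst p $ i * snd p $ j - fst p $ j * snd p $ i) / (Dfun \<alpha> p * \<alpha> $ i * \<alpha> $ j)"

definition dx :: "(phase \<Rightarrow> real) \<Rightarrow> phase \<Rightarrow> 4 \<Rightarrow> real" where
  "dx f p i = frechet_derivative f (at p) (axis i 1, 0)"

definition dy :: "(phase \<Rightarrow> real) \<Rightarrow> phase \<Rightarrow> 4 \<Rightarrow> real" where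
  "dy f p i = frechet_derivative f (at p) (0, axis i 1)"

text \<open>Extension of the coordinate brackets (with \<open>{x\<^sub>i, x\<^sub>j} = 0\<close>) as a biderivation.\<close>

definition dirac_bracket :: "real^4 \<Rightarrow> (phase \<Rightarrow> real) \<Rightarrow> (phase \<Rightarrow> real) \<Rightarrow> phase \<Rightarrow> real" where
  "dirac_bracket \<alpha> f g p = (\<Sum>i\<in>UNIV. \<Sum>j\<in>UNIV.
       dx f p i * dy g p j * bracket_xy \<alpha> p i j
     - dy f p i * dx g p j * bracket_xy \<alpha> p j i
     + dy f p i * dy g p j * bracket_yy \<alpha> p i j)"

text \<open>The Hamiltonian vector field \<open>X\<^sub>f = {\<cdot>, f}\<close>; its components are the brackets with the coordinates.\<close>

definition ham_vf :: "real^4 \<Rightarrow> (phase \<Rightarrow> real) \<Rightarrow> phase \<Rightarrow> phase" where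
  "ham_vf \<alpha> f p = (\<chi> i. dirac_bracket \<alpha> (\<lambda>q. fst q $ i) f p,
                  \<chi> i. dirac_bracket \<alpha> (\<lambda>q. snd q $ i) f p)"

definition tangent_M :: "real^4 \<Rightarrow> phase \<Rightarrow> phase set" where
  "tangent_M \<alpha> p = {v. frechet_derivative (C1 \<alpha>) (at p) v = 0 \<and>
                       frechet_derivative (C2 \<alpha>) (at p) v = 0}"

text \<open>
  The symplectic form of the leaf through \<open>p\<close>, determined by \<open>\<omega>(X\<^sub>f, X\<^sub>g) = {f, g}\<close>. Linear \<open>f\<close>, \<open>g\<close>
  suffice, since every covector at \<open>p\<close> is the differential of a linear function. Meaningful for
  \<open>u\<close>, \<open>v\<close> tangent to the leaf.
\<close>

definition symp_form :: "real^4 \<Rightarrow> phase \<Rightarrow> phase \<Rightarrow> phase \<Rightarrow> real" where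
  "symp_form \<alpha> p u v = (THE c. \<exists>f g. linear f \<and> linear g \<and>
     u = ham_vf \<alpha> f p \<and> v = ham_vf \<alpha> g p \<and> c = dirac_bracket \<alpha> f g p)"

section \<open>The integrals and the energy momentum map\<close>

definition Hfun :: "phase \<Rightarrow> real" where
  "Hfun = (\<lambda>(x, y). ((y $ 0)\<^sup>2 + (y $ 1)\<^sup>2 + (y $ 2)\<^sup>2 + (y $ 3)\<^sup>2) / 2)"

definition Jfun :: "phase \<Rightarrow> real" where
  "Jfun = (\<lambda>(x, y). x $ 1 * y $ 2 - x $ 2 * y $ 1)"

definition Gfun :: "real^4 \<Rightarrow> phase \<Rightarrow> real" where
  "Gfun \<alpha> = (\<lambda>(x, y). (y $ 1)\<^sup>2 + (y $ 2)\<^sup>2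
     + ((x $ 0 * y $ 1 - x $ 1 * y $ 0)\<^sup>2 + (x $ 0 * y $ 2 - x $ 2 * y $ 0)\<^sup>2) / (\<alpha> $ 1 - \<alpha> $ 0)
     + ((x $ 1 * y $ 3 - x $ 3 * y $ 1)\<^sup>2 + (x $ 2 * y $ 3 - x $ 3 * y $ 2)\<^sup>2) / (\<alpha> $ 1 - \<alpha> $ 3))"

definition EM :: "real^4 \<Rightarrow> phase \<Rightarrow> real \<times> real \<times> real" where
  "EM \<alpha> p = (Hfun p, Jfun p, Gfun \<alpha> p)"

text \<open>For \<open>c = (a, b, d)\<close> this is the combination \<open>a H + b J + d G\<close> of the integrals.\<close>

definition comb :: "real^4 \<Rightarrow> real \<times> real \<times> real \<Rightarrow> phase \<Rightarrow> real" where
  "comb \<alpha> c p = c \<bullet> EM \<alpha> p"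

text \<open>\<open>dH\<close>, \<open>dJ\<close>, \<open>dG\<close>, restricted to the tangent space of \<open>M\<close>, are linearly dependent.\<close>

definition critical :: "real^4 \<Rightarrow> phase \<Rightarrow> bool" where
  "critical \<alpha> p \<longleftrightarrow> p \<in> M \<alpha> \<and>
     (\<exists>a b d. (a, b, d) \<noteq> (0, 0, 0) \<and> (\<forall>v\<in>tangent_M \<alpha> p.
        a * frechet_derivative Hfun (at p) v + b * frechet_derivative Jfun (at p) v
        + d * frechet_derivative (Gfun \<alpha>) (at p) v = 0))"

definition corank :: "real^4 \<Rightarrow> phase \<Rightarrow> nat" where
  "corank \<alpha> p = 3 - dim (frechet_derivative (EM \<alpha>) (at p) ` tangent_M \<alpha> p)"

section \<open>Cartan subalgebras of the real symplectic Lie algebra\<close>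

definition Omega_mat :: "nat \<Rightarrow> real mat" where
  "Omega_mat r = mat (2 * r) (2 * r)
     (\<lambda>(i, j). if j = i + r then 1 else if i = j + r then - 1 else 0)"

definition sp_algebra :: "nat \<Rightarrow> real mat set" where
  "sp_algebra r = {B \<in> carrier_mat (2 * r) (2 * r).
     transpose_mat B * Omega_mat r + Omega_mat r * B = 0\<^sub>m (2 * r) (2 * r)}"

definition commutator :: "real mat \<Rightarrow> real mat \<Rightarrow> real mat" where
  "commutator A B = A * B - B * A"

definition lie_subalgebra :: "nat \<Rightarrow> real mat set \<Rightarrow> bool" where
  "lie_subalgebra r \<h> \<longleftrightarrow> \<h> \<subseteq> sp_algebra r \<and> 0\<^sub>m (2 * r) (2 * r) \<in> \<h> \<and>
     (\<forall>A\<in>\<h>. \<forall>B\<in>\<h>. A + B \<in> \<h>) \<and> (\<forall>A\<in>\<h>. \<forall>t. t \<cdot>\<^sub>m A \<in> \<h>) \<and>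
     (\<forall>A\<in>\<h>. \<forall>B\<in>\<h>. commutator A B \<in> \<h>)"

text \<open>
  The lower central series is spanned by the iterated brackets
  \<open>[A\<^sub>1, [A\<^sub>2, \<dots> [A\<^sub>k, B] \<dots>]]\<close>, so it reaches \<open>0\<close> iff these vanish for some \<open>k\<close>.
\<close>

definition nilpotent_lie :: "nat \<Rightarrow> real mat set \<Rightarrow> bool" where
  "nilpotent_lie r \<h> \<longleftrightarrow> (\<exists>k. \<forall>As B. length As = k \<and> set As \<subseteq> \<h> \<and> B \<in> \<h> \<longrightarrow>
     foldr commutator As B = 0\<^sub>m (2 * r) (2 * r))"

definition cartan_subalgebra :: "nat \<Rightarrow> real mat set \<Rightarrow> bool" where
  "cartan_subalgebra r \<h> \<longleftrightarrow> lie_subalgebra r \<h> \<and> nilpotent_lie r \<h> \<and>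
     {X \<in> sp_algebra r. \<forall>A\<in>\<h>. commutator X A \<in> \<h>} = \<h>"

section \<open>Linearization at a critical point\<close>

definition orbit_dirs :: "real^4 \<Rightarrow> phase \<Rightarrow> phase set" where
  "orbit_dirs \<alpha> p = span {ham_vf \<alpha> Hfun p, ham_vf \<alpha> Jfun p, ham_vf \<alpha> (Gfun \<alpha>) p}"

definition orbit_dirs_perp :: "real^4 \<Rightarrow> phase \<Rightarrow> phase set" where
  "orbit_dirs_perp \<alpha> p = {v \<in> tangent_M \<alpha> p. \<forall>u\<in>orbit_dirs \<alpha> p. symp_form \<alpha> p v u = 0}"

text \<open>
  \<open>e 0, \<dots>, e (2 r - 1)\<close> represent a symplectic basis of the quotient of \<open>orbit_dirs_perp\<close> by
  \<open>orbit_dirs\<close>. Independence modulo \<open>orbit_dirs\<close> is automatic: the orbit directions are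
  \<open>\<omega>\<close>-orthogonal to every \<open>e i\<close>, and the Gram matrix is invertible.
\<close>

definition reduced_basis :: "real^4 \<Rightarrow> phase \<Rightarrow> nat \<Rightarrow> (nat \<Rightarrow> phase) \<Rightarrow> bool" where
  "reduced_basis \<alpha> p r e \<longleftrightarrow> (\<forall>i<2 * r. e i \<in> orbit_dirs_perp \<alpha> p) \<and>
     span (orbit_dirs \<alpha> p \<union> e ` {..<2 * r}) = orbit_dirs_perp \<alpha> p \<and>
     (\<forall>i<2 * r. \<forall>j<2 * r. symp_form \<alpha> p (e i) (e j) = Omega_mat r $$ (i, j))"

definition vanishing_combs :: "real^4 \<Rightarrow> phase \<Rightarrow> (real \<times> real \<times> real) set" where
  "vanishing_combs \<alpha> p = {c. ham_vf \<alpha> (comb \<alpha> c) p = 0}"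

text \<open>
  \<open>B\<close> is the matrix, in the basis represented by \<open>e\<close>, of the map that the linearization at \<open>p\<close> of
  the vector field of \<open>comb \<alpha> c\<close> induces on the quotient by \<open>orbit_dirs\<close>.
\<close>

definition linearization :: "real^4 \<Rightarrow> phase \<Rightarrow> nat \<Rightarrow> (nat \<Rightarrow> phase) \<Rightarrow>
    real \<times> real \<times> real \<Rightarrow> real mat \<Rightarrow> bool" where
  "linearization \<alpha> p r e c B \<longleftrightarrow> B \<in> carrier_mat (2 * r) (2 * r) \<and>
     (\<forall>j<2 * r. frechet_derivative (ham_vf \<alpha> (comb \<alpha> c)) (at p) (e j)
        - (\<Sum>i<2 * r. (B $$ (i, j)) *\<^sub>R e i) \<in> orbit_dirs \<alpha> p)"

text \<open>
  Non-degeneracy, witnessed by \<open>e\<close>. The set of linearizations is the linear image of a subspace,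
  hence equal to its span. A different choice of \<open>e\<close> conjugates it by a symplectic matrix.
\<close>

definition nondegenerate :: "real^4 \<Rightarrow> phase \<Rightarrow> (nat \<Rightarrow> phase) \<Rightarrow> bool" where
  "nondegenerate \<alpha> p e \<longleftrightarrow> critical \<alpha> p \<and> reduced_basis \<alpha> p (corank \<alpha> p) e \<and>
     cartan_subalgebra (corank \<alpha> p)
       {B. \<exists>c\<in>vanishing_combs \<alpha> p. linearization \<alpha> p (corank \<alpha> p) e c B}"

definition has_spectrum :: "real^4 \<Rightarrow> phase \<Rightarrow> (nat \<Rightarrow> phase) \<Rightarrow>
    real \<times> real \<times> real \<Rightarrow> complex set \<Rightarrow> bool" where
  "has_spectrum \<alpha> p e c S \<longleftrightarrow>
     (\<exists>B. linearization \<alpha> p (corank \<alpha> p) e c B \<and> spectrum (map_mat complex_of_real B) = S)"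

definition elliptic :: "real^4 \<Rightarrow> phase \<Rightarrow> bool" where
  "elliptic \<alpha> p \<longleftrightarrow> corank \<alpha> p = 1 \<and> (\<exists>e. nondegenerate \<alpha> p e \<and>
     (\<exists>c\<in>vanishing_combs \<alpha> p. \<exists>w::real. w \<noteq> 0 \<and>
        has_spectrum \<alpha> p e c {\<i> * of_real w, - \<i> * of_real w}))"

text \<open>
  The two pairs \<open>\<plusminus>\<i> w\<^sub>1\<close>, \<open>\<plusminus>\<i> w\<^sub>2\<close> are independent if the frequencies are linearly independent as
  linear functionals of the combination \<open>c\<close>.
\<close>

definition elliptic_elliptic :: "real^4 \<Rightarrow> phase \<Rightarrow> bool" where
  "elliptic_elliptic \<alpha> p \<longleftrightarrow> corank \<alpha> p = 2 \<and> (\<exists>e. nondegenerate \<alpha> p e \<and>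
     (\<exists>w1 w2 :: real \<times> real \<times> real \<Rightarrow> real. linear w1 \<and> linear w2 \<and>
        (\<forall>s t. (\<forall>c\<in>vanishing_combs \<alpha> p. s * w1 c + t * w2 c = 0) \<longrightarrow> s = 0 \<and> t = 0) \<and>
        (\<forall>c\<in>vanishing_combs \<alpha> p. has_spectrum \<alpha> p e c
           {\<i> * of_real (w1 c), - \<i> * of_real (w1 c), \<i> * of_real (w2 c), - \<i> * of_real (w2 c)})))"

text \<open>Generic means: for all \<open>c\<close> in an open dense subset of the space of vanishing combinations.\<close>

definition focus_focus :: "real^4 \<Rightarrow> phase \<Rightarrow> bool" where
  "focus_focus \<alpha> p \<longleftrightarrow> corank \<alpha> p = 2 \<and> (\<exists>e. nondegenerate \<alpha> p e \<and>
     (\<exists>U. openin (top_of_set (vanishing_combs \<alpha> p)) U \<and> vanishing_combs \<alpha> p \<subseteq> closure U \<and>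
        (\<forall>c\<in>U. \<exists>a b. a \<noteq> 0 \<and> b \<noteq> 0 \<and>
           has_spectrum \<alpha> p e c {Complex a b, Complex a (- b), Complex (- a) b, Complex (- a) (- b)})))"

section \<open>Values at constant energy\<close>

definition EM_image :: "real^4 \<Rightarrow> real \<Rightarrow> (real \<times> real) set" where
  "EM_image \<alpha> h = {(Jfun p, Gfun \<alpha> p) | p. p \<in> M \<alpha> \<and> Hfun p = h}"

definition singular_values :: "real^4 \<Rightarrow> real \<Rightarrow> (real \<times> real) set" where
  "singular_values \<alpha> h = {(j, g). \<exists>p. critical \<alpha> p \<and> EM \<alpha> p = (h, j, g)}"

definition singular_value_of_type ::
    "real^4 \<Rightarrow> real \<Rightarrow> (real^4 \<Rightarrow> phase \<Rightarrow> bool) \<Rightarrow> real \<times> real \<Rightarrow> bool" where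
  "singular_value_of_type \<alpha> h typ v \<longleftrightarrow> v \<in> singular_values \<alpha> h \<and>
     (\<forall>p. critical \<alpha> p \<and> EM \<alpha> p = (h, v) \<longrightarrow> typ \<alpha> p)"

text \<open>
  Since \<open>\<alpha>\<^sub>0 < \<alpha>\<^sub>1 < \<alpha>\<^sub>3\<close>, the graph of \<open>lower_curve\<close> is a parabola opening upwards and that of
  \<open>upper_curve\<close> a parabola opening downwards; the region they bound lies between them.
\<close>

definition lower_curve :: "real^4 \<Rightarrow> real \<Rightarrow> real \<Rightarrow> real" where
  "lower_curve \<alpha> h j = 2 * \<alpha> $ 1 / (\<alpha> $ 1 - \<alpha> $ 3) * h
     - \<alpha> $ 3 / (\<alpha> $ 1 * (\<alpha> $ 1 - \<alpha> $ 3)) * j\<^sup>2"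

definition upper_curve :: "real^4 \<Rightarrow> real \<Rightarrow> real \<Rightarrow> real" where
  "upper_curve \<alpha> h j = 2 * \<alpha> $ 1 / (\<alpha> $ 1 - \<alpha> $ 0) * h
     - \<alpha> $ 0 / (\<alpha> $ 1 * (\<alpha> $ 1 - \<alpha> $ 0)) * j\<^sup>2"

definition region :: "real^4 \<Rightarrow> real \<Rightarrow> (real \<times> real) set" where
  "region \<alpha> h = {(j, g). lower_curve \<alpha> h j \<le> g \<and> g \<le> upper_curve \<alpha> h j}"

text \<open>The arcs of the two curves that bound the region.\<close>

definition boundary_curves :: "real^4 \<Rightarrow> real \<Rightarrow> (real \<times> real) set" where
  "boundary_curves \<alpha> h =
     {(j, g) \<in> region \<alpha> h. g = lower_curve \<alpha> h j \<or> g = upper_curve \<alpha> h j}"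

definition intersections :: "real^4 \<Rightarrow> real \<Rightarrow> (real \<times> real) set" where
  "intersections \<alpha> h = {(j, g). g = lower_curve \<alpha> h j \<and> g = upper_curve \<alpha> h j}"

end

theory Submission
  imports Defs
begin

text \<open>
  A covector restricts to zero on the leaf iff its Hamiltonian vector field vanishes, and on tangent
  vectors of the leaf the symplectic form is the canonical one. Hence the critical points are the zeros
  of the fields of combinations \<open>a H + b J + d G\<close>, and the corank is the dimension of the space of such
  combinations.

  The Lagrange multiplier equations for a critical point have a zero second multiplier, and split into
  \<open>2 \<times> 2\<close> systems for \<open>(x\<^sub>0, y\<^sub>0)\<close> and for \<open>(x\<^sub>3, y\<^sub>3)\<close> whose determinants involve only the invariants of
  \<open>(x\<^sub>1, x\<^sub>2)\<close>, \<open>(y\<^sub>1, y\<^sub>2)\<close> under rotation. Comparing signs, one of these two pairs vanishes, or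
  \<open>x\<^sub>1 = x\<^sub>2 = y\<^sub>1 = y\<^sub>2 = 0\<close>. On the leaf the distances of \<open>G\<close> from the two curves are positive combinations of squares
  that vanish exactly for \<open>x\<^sub>0 = y\<^sub>0 = 0\<close> and \<open>x\<^sub>3 = y\<^sub>3 = 0\<close>, which identifies the fibres.

  All critical points are fixed points of reflections preserving the integrals. The linearized fields
  therefore preserve the span of the reflected coordinate directions, which represents the reduced
  space, and the blocks can be read off from the equations of motion.
\<close>

text \<open>Two devices keep the computations short. The orbit directions are shown to be isotropic
  through {H, J} = 0: every critical point of positive energy has a vanishing combination whose
  \<open>G\<close> coefficient is -1, and it expresses the field of \<open>G\<close> by those of
  \<open>H\<close> and \<open>J\<close>. And no derivative of a Lagrange multiplier is computed: in
  a coordinate pair that vanishes at the point, the multipliers enter only multiplied by the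
  displacement, so their values at the point suffice. The obstacle in locating the critical points
  is that the two determinant equations hold together and neither is contradictory by itself; what
  decides is whether the \<open>H\<close> coefficient and the multiplier of \<open>C1\<close> have
  equal or opposite signs. The bases at corank two are chosen so that the blocks become Williamson
  normal forms. On the equator each vanishing pair is rescaled until its block is a rotation. On the
  ellipse in the (0, 3) plane the block of \<open>G\<close> has real eigenvalues, and using one
  eigenbasis in both equal-axis directions makes \<open>J\<close> act as a rotation that commutes
  with it.\<close>

hide_const (open) VectorSpace.subspace Matrix.orthogonal
no_notation Matrix.scalar_prod (infix "\<bullet>" 70)

section \<open>The Hamiltonian vector fields and the symplectic form of the leaf\<close>

lemma four_eq_zero [simp]: "(4::4) = 0"
  by simp

lemmas cart_eq_iff = Finite_Cartesian_Product.vec_eq_iff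

lemma sum_UNIV_4: "sum f (UNIV::4 set) = f 0 + f 1 + f 2 + f 3"
  by (simp add: sum_4 ac_simps)

lemma all_index_4: "(\<forall>i::4. P i) \<longleftrightarrow> P 0 \<and> P 1 \<and> P 2 \<and> P 3"
  by (auto simp: forall_4)

text \<open>On the orthogonal complement of the kernel inside \<open>S\<close> the map is injective
  and has the same image as on \<open>S\<close>. It serves both for \<open>dEM\<close> on the
  tangent space and for the map from combinations to their fields.\<close>

lemma rank_nullity:
  fixes f :: "'a::euclidean_space \<Rightarrow> 'b::euclidean_space"
  assumes f: "linear f" and S: "subspace S"
  shows "dim (f ` S) + dim {x \<in> S. f x = 0} = dim S"
proof -
  define K where "K = {x \<in> S. f x = 0}"
  define K' where "K' = {y \<in> S. \<forall>x\<in>K. orthogonal x y}"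
  have K: "subspace K"
    unfolding K_def using f S
    by (auto simp: Real_Vector_Spaces.subspace_def linear_add linear_scale linear_0)
  have K': "subspace K'"
    unfolding K'_def using S
    by (auto simp: Real_Vector_Spaces.subspace_def orthogonal_clauses Linear_Algebra.orthogonal_def inner_right_distrib)
  have "K \<subseteq> S" by (auto simp: K_def)
  then have dims: "dim K' + dim K = dim S"
    unfolding K'_def by (rule dim_subspace_orthogonal_to_vectors[OF K S])
  have inj: "inj_on f (span K')"
  proof (subst linear_injective_on_subspace_0[OF f])
    show "subspace (span K')" by simp
    show "\<forall>x\<in>span K'. f x = 0 \<longrightarrow> x = 0"
    proof (intro ballI impI)
      fix x assume "x \<in> span K'" "f x = 0"
      then have "x \<in> K'" using K' by (simp add: span_eq_iff[THEN iffD2])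
      moreover from this have "x \<in> K" using \<open>f x = 0\<close> by (auto simp: K_def K'_def)
      ultimately have "orthogonal x x" unfolding K'_def by auto
      then show "x = 0" by (simp add: orthogonal_self)
    qed
  qed
  have "f ` K' = f ` S"
  proof
    show "f ` K' \<subseteq> f ` S" by (auto simp: K'_def)
    show "f ` S \<subseteq> f ` K'"
    proof
      fix z assume "z \<in> f ` S"
      then obtain x where x: "x \<in> S" "z = f x" by auto
      obtain y z' where y: "y \<in> span K" "\<And>w. w \<in> span K \<Longrightarrow> orthogonal z' w" "x = y + z'"
        using orthogonal_subspace_decomp_exists[of K x] by blast
      have yK: "y \<in> K" using y(1) K by (simp add: span_eq_iff[THEN iffD2])
      have "z' = x - y" using y(3) by simp
      then have "z' \<in> S" using x(1) yK S by (auto simp: K_def intro: subspace_diff)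
      then have "z' \<in> K'" using y(2) by (auto simp: K'_def orthogonal_commute span_base)
      moreover have "z = f z'" using x y(3) yK f by (simp add: K_def linear_add)
      ultimately show "z \<in> f ` K'" by auto
    qed
  qed
  moreover have "dim (f ` K') = dim K'"
    using dim_image_eq[OF f inj] .
  ultimately show ?thesis using dims K_def by simp
qed

text \<open>\<open>wt \<alpha> x\<close> is half the gradient of \<open>\<Sum> x\<^sub>i\<^sup>2 / \<alpha>\<^sub>i\<close>, a normal of the ellipsoid at \<open>x\<close>.\<close>

definition wt :: "real^4 \<Rightarrow> real^4 \<Rightarrow> real^4" where
  "wt \<alpha> x = (\<chi> i. x $ i / \<alpha> $ i)"

lemma wt_nth [simp]: "wt \<alpha> x $ i = x $ i / \<alpha> $ i"
  by (simp add: wt_def)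

lemma inner_wt_commute: "x \<bullet> wt \<alpha> y = y \<bullet> wt \<alpha> x"
  by (simp add: inner_vec_def mult.commute)

lemma linear_wt: "linear (wt \<alpha>)"
  by (rule linearI) (simp_all add: cart_eq_iff add_divide_distrib)

lemma C1_wt: "C1 \<alpha> p = fst p \<bullet> wt \<alpha> (fst p) - 1"
  by (simp add: C1_def inner_vec_def power2_eq_square split: prod.split)

lemma C2_wt: "C2 \<alpha> p = snd p \<bullet> wt \<alpha> (fst p)"
  by (simp add: C2_def inner_vec_def mult.commute split: prod.split)

lemma Dfun_wt: "Dfun \<alpha> p = wt \<alpha> (fst p) \<bullet> wt \<alpha> (fst p)"
  by (simp add: Dfun_def inner_vec_def power2_eq_square split: prod.split)

lemma bounded_linear_wt: "bounded_linear (wt \<alpha>)"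
  using linear_wt by (rule linear_conv_bounded_linear[THEN iffD1])

lemmas has_derivative_wt [derivative_intros] =
  bounded_linear.has_derivative[OF bounded_linear_wt]

lemma tangent_M_iff:
  "v \<in> tangent_M \<alpha> p \<longleftrightarrow> fst v \<bullet> wt \<alpha> (fst p) = 0 \<and> fst v \<bullet> wt \<alpha> (snd p) + snd v \<bullet> wt \<alpha> (fst p) = 0"
proof -
  have "(C1 \<alpha> has_derivative (\<lambda>v. fst p \<bullet> wt \<alpha> (fst v) + fst v \<bullet> wt \<alpha> (fst p))) (at p)"
    unfolding C1_wt[abs_def] by (auto intro!: derivative_eq_intros)
  then have 1: "frechet_derivative (C1 \<alpha>) (at p) = (\<lambda>v. fst p \<bullet> wt \<alpha> (fst v) + fst v \<bullet> wt \<alpha> (fst p))"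
    by (rule frechet_derivative_at[symmetric])
  have "(C2 \<alpha> has_derivative (\<lambda>v. snd p \<bullet> wt \<alpha> (fst v) + snd v \<bullet> wt \<alpha> (fst p))) (at p)"
    unfolding C2_wt[abs_def] by (auto intro!: derivative_eq_intros)
  then have 2: "frechet_derivative (C2 \<alpha>) (at p) = (\<lambda>v. snd p \<bullet> wt \<alpha> (fst v) + snd v \<bullet> wt \<alpha> (fst p))"
    by (rule frechet_derivative_at[symmetric])
  show ?thesis
    unfolding tangent_M_def 1 2 mem_Collect_eq
    by (simp add: inner_wt_commute[of "fst p"] inner_wt_commute[of "snd p"])
qed

lemma M_iff: "p \<in> M \<alpha> \<longleftrightarrow> fst p \<bullet> wt \<alpha> (fst p) = 1 \<and> snd p \<bullet> wt \<alpha> (fst p) = 0"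
  by (simp add: M_def C1_wt C2_wt)

lemma Dfun_pos: "p \<in> M \<alpha> \<Longrightarrow> 0 < Dfun \<alpha> p"
  by (auto simp: M_iff Dfun_wt)

text \<open>The Hamiltonian vector field at \<open>p\<close> of any function with partial gradients \<open>g\<close> (in \<open>x\<close>) and
  \<open>k\<close> (in \<open>y\<close>) at \<open>p\<close>.\<close>

definition mult_T :: "real^4 \<Rightarrow> phase \<Rightarrow> real^4 \<Rightarrow> real" where
  "mult_T \<alpha> p k = k \<bullet> wt \<alpha> (fst p) / Dfun \<alpha> p"

definition mult_L :: "real^4 \<Rightarrow> phase \<Rightarrow> real^4 \<Rightarrow> real^4 \<Rightarrow> real" where
  "mult_L \<alpha> p g k = (g \<bullet> wt \<alpha> (fst p) - k \<bullet> wt \<alpha> (snd p)) / Dfun \<alpha> p"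

text \<open>This is the canonical field of \<open>f - T * C2 - L * C1 / 2\<close> with
  \<open>T\<close>, \<open>L\<close> frozen at \<open>p\<close>; the values \<open>mult_T\<close>
  and \<open>mult_L\<close> are those that make it tangent to both constraints.\<close>

definition ham_vec :: "real^4 \<Rightarrow> phase \<Rightarrow> real^4 \<Rightarrow> real^4 \<Rightarrow> phase" where
  "ham_vec \<alpha> p g k = (k - mult_T \<alpha> p k *\<^sub>R wt \<alpha> (fst p),
     mult_L \<alpha> p g k *\<^sub>R wt \<alpha> (fst p) + mult_T \<alpha> p k *\<^sub>R wt \<alpha> (snd p) - g)"

definition has_grad :: "(phase \<Rightarrow> real) \<Rightarrow> phase \<Rightarrow> real^4 \<Rightarrow> real^4 \<Rightarrow> bool" where
  "has_grad f p g k \<longleftrightarrow> (f has_derivative (\<lambda>v. g \<bullet> fst v + k \<bullet> snd v)) (at p)"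

lemma has_grad_frechet:
  "has_grad f p g k \<Longrightarrow> frechet_derivative f (at p) = (\<lambda>v. g \<bullet> fst v + k \<bullet> snd v)"
  unfolding has_grad_def by (rule frechet_derivative_at[symmetric])

lemma has_grad_dx: "has_grad f p g k \<Longrightarrow> dx f p i = g $ i"
  and has_grad_dy: "has_grad f p g k \<Longrightarrow> dy f p i = k $ i"
  by (simp_all add: dx_def dy_def has_grad_frechet inner_axis)

lemma has_grad_fst: "has_grad (\<lambda>q. fst q $ i) p (axis i 1) 0"
  unfolding has_grad_def
  by (rule has_derivative_eq_rhs, rule bounded_linear.has_derivative[OF bounded_linear_vec_nth])
    (auto intro!: derivative_eq_intros simp: inner_axis')

lemma has_grad_snd: "has_grad (\<lambda>q. snd q $ i) p 0 (axis i 1)"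
  unfolding has_grad_def
  by (rule has_derivative_eq_rhs, rule bounded_linear.has_derivative[OF bounded_linear_vec_nth])
    (auto intro!: derivative_eq_intros simp: inner_axis')

lemma has_grad_linear:
  assumes "linear f"
  shows "has_grad f p (\<chi> i. f (axis i 1, 0)) (\<chi> i. f (0, axis i 1))"
    and "f v = (\<chi> i. f (axis i 1, 0)) \<bullet> fst v + (\<chi> i. f (0, axis i 1)) \<bullet> snd v"
proof -
  have *: "f v = (\<chi> i. f (axis i 1, 0)) \<bullet> fst v + (\<chi> i. f (0, axis i 1)) \<bullet> snd v" for v
  proof -
    have "v = (\<Sum>i\<in>UNIV. fst v $ i *\<^sub>R axis i 1, 0) + (0, \<Sum>i\<in>UNIV. snd v $ i *\<^sub>R axis i 1)"
      using basis_expansion[of "fst v"] basis_expansion[of "snd v"]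
      by (simp add: scalar_mult_eq_scaleR)
    also have "\<dots> = (\<Sum>i\<in>UNIV. fst v $ i *\<^sub>R (axis i 1, 0)) + (\<Sum>i\<in>UNIV. snd v $ i *\<^sub>R (0, axis i 1))"
      by (auto simp: prod_eq_iff fst_sum snd_sum)
    finally have "f v = f (\<dots>)" by (rule arg_cong)
    also have "\<dots> = (\<Sum>i\<in>UNIV. fst v $ i *\<^sub>R f (axis i 1, 0)) + (\<Sum>i\<in>UNIV. snd v $ i *\<^sub>R f (0, axis i 1))"
      by (simp only: linear_add[OF assms] linear_sum[OF assms] linear_scale[OF assms])
    finally show ?thesis by (simp add: inner_vec_def mult.commute)
  qed
  then show "f v = (\<chi> i. f (axis i 1, 0)) \<bullet> fst v + (\<chi> i. f (0, axis i 1)) \<bullet> snd v" .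
  have "(f has_derivative f) (at p)"
    using assms by (simp add: linear_imp_has_derivative)
  then show "has_grad f p (\<chi> i. f (axis i 1, 0)) (\<chi> i. f (0, axis i 1))"
    unfolding has_grad_def by (rule has_derivative_eq_rhs) (rule ext, rule *)
qed

text \<open>The factors \<open>1 / \<alpha> $ i\<close> are absorbed into \<open>wt\<close>. Then
  the Kronecker deltas give inner products, the other terms of the double sum factor into products
  of two inner products, and regrouping produces the multipliers.\<close>

lemma dirac_bracket_grad:
  assumes f: "has_grad f p g k" and f': "has_grad f' p g' k'"
  shows "dirac_bracket \<alpha> f f' p = g \<bullet> fst (ham_vec \<alpha> p g' k') + k \<bullet> snd (ham_vec \<alpha> p g' k')"
proof -
  let ?n = "wt \<alpha> (fst p)" and ?m = "wt \<alpha> (snd p)" and ?D = "Dfun \<alpha> p"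
  have "dirac_bracket \<alpha> f f' p = (\<Sum>i\<in>UNIV. \<Sum>j\<in>UNIV.
       g $ i * k' $ j * ((if i = j then 1 else 0) - ?n $ i * ?n $ j / ?D)
     - k $ i * g' $ j * ((if i = j then 1 else 0) - ?n $ i * ?n $ j / ?D)
     + k $ i * k' $ j * ((?m $ i * ?n $ j - ?n $ i * ?m $ j) / ?D))"
    unfolding dirac_bracket_def has_grad_dx[OF f] has_grad_dy[OF f] has_grad_dx[OF f'] has_grad_dy[OF f']
      bracket_xy_def bracket_yy_def
  proof (intro sum.cong refl, goal_cases)
    case (1 i j)
    have "- (a * d - c * b) / (D * p * q) = (b / p * (c / q) - a / p * (d / q)) / D" for a b c d p q D :: real
      by (simp add: diff_divide_distrib mult_ac)
    then show ?case by (simp add: mult.commute mult.left_commute)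
  qed
  also have "\<dots> = (\<Sum>i\<in>UNIV. \<Sum>j\<in>UNIV. (if i = j then g $ i * k' $ j else 0))
      - (\<Sum>i\<in>UNIV. \<Sum>j\<in>UNIV. (g $ i * ?n $ i) * (k' $ j * ?n $ j)) / ?D
      - (\<Sum>i\<in>UNIV. \<Sum>j\<in>UNIV. (if i = j then k $ i * g' $ j else 0))
      + (\<Sum>i\<in>UNIV. \<Sum>j\<in>UNIV. (k $ i * ?n $ i) * (g' $ j * ?n $ j)) / ?D
      + (\<Sum>i\<in>UNIV. \<Sum>j\<in>UNIV. (k $ i * ?m $ i) * (k' $ j * ?n $ j)) / ?D
      - (\<Sum>i\<in>UNIV. \<Sum>j\<in>UNIV. (k $ i * ?n $ i) * (k' $ j * ?m $ j)) / ?D"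
    unfolding sum_divide_distrib sum_subtractf[symmetric] sum.distrib[symmetric]
    by (intro sum.cong refl) (simp add: algebra_simps diff_divide_distrib)
  also have "\<dots> = g \<bullet> k' - (g \<bullet> ?n) * (k' \<bullet> ?n) / ?D - k \<bullet> g' + (k \<bullet> ?n) * (g' \<bullet> ?n) / ?D
      + (k \<bullet> ?m) * (k' \<bullet> ?n) / ?D - (k \<bullet> ?n) * (k' \<bullet> ?m) / ?D"
    unfolding sum_product[symmetric] inner_vec_def by simp
  also have "\<dots> = g \<bullet> fst (ham_vec \<alpha> p g' k') + k \<bullet> snd (ham_vec \<alpha> p g' k')"
    by (simp add: ham_vec_def mult_T_def mult_L_def inner_diff_right inner_add_right
        diff_divide_distrib add_divide_distrib left_diff_distrib right_diff_distrib mult.commute)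
  finally show ?thesis .
qed

lemma ham_vf_grad: "has_grad f p g k \<Longrightarrow> ham_vf \<alpha> f p = ham_vec \<alpha> p g k"
  by (simp add: ham_vf_def dirac_bracket_grad[OF has_grad_fst] dirac_bracket_grad[OF has_grad_snd]
      inner_axis' prod_eq_iff cart_eq_iff)

section \<open>The canonical form on tangent vectors of the leaf\<close>

definition omega :: "phase \<Rightarrow> phase \<Rightarrow> real" where
  "omega u v = fst u \<bullet> snd v - snd u \<bullet> fst v"

text \<open>The multiplier terms of \<open>ham_vec\<close> pair with \<open>v\<close> to multiples
  of dC1(v) and dC2(v), which vanish on tangent vectors. What remains is the canonical field
  \<open>(k, - g)\<close>, and the sign of \<open>omega\<close> is chosen so that it gives the
  differential itself.\<close>

lemma omega_ham_vec:
  assumes "v \<in> tangent_M \<alpha> p"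
  shows "omega (ham_vec \<alpha> p g k) v = g \<bullet> fst v + k \<bullet> snd v"
proof -
  have 1: "wt \<alpha> (fst p) \<bullet> fst v = 0" "wt \<alpha> (snd p) \<bullet> fst v = - (wt \<alpha> (fst p) \<bullet> snd v)"
    using assms by (simp_all add: tangent_M_iff inner_commute algebra_simps)
  show ?thesis
    by (simp add: omega_def ham_vec_def inner_diff_left inner_add_left 1)
qed

lemma ham_vec_tangent:
  assumes "p \<in> M \<alpha>"
  shows "ham_vec \<alpha> p g k \<in> tangent_M \<alpha> p"
proof -
  have D: "Dfun \<alpha> p \<noteq> 0" using Dfun_pos[OF assms] by simp
  let ?n = "wt \<alpha> (fst p)" and ?m = "wt \<alpha> (snd p)"
  have 1: "mult_T \<alpha> p k * (?n \<bullet> ?n) = k \<bullet> ?n"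
    using D by (simp add: mult_T_def Dfun_wt)
  have 2: "mult_L \<alpha> p g k * (?n \<bullet> ?n) = g \<bullet> ?n - k \<bullet> ?m"
    using D by (simp add: mult_L_def Dfun_wt)
  show ?thesis
    unfolding tangent_M_iff ham_vec_def fst_conv snd_conv inner_diff_left inner_add_left inner_scaleR_left 1 2
    by (simp add: inner_commute[of ?m])
qed

text \<open>For tangent \<open>u\<close> both multipliers are zero. So every tangent vector is the
  Hamiltonian vector of an explicit linear function, as the description in \<open>symp_form\<close>
  requires.\<close>

lemma tangent_eq_ham_vec:
  assumes "u \<in> tangent_M \<alpha> p"
  shows "ham_vec \<alpha> p (- snd u) (fst u) = u"
  using assms by (simp add: tangent_M_iff ham_vec_def mult_T_def mult_L_def prod_eq_iff)

text \<open>Existence uses the linear functions of \<open>tangent_eq_ham_vec\<close>; uniqueness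
  holds because any admissible pair gives the bracket df(v) = \<open>omega u v\<close>.\<close>

lemma symp_form_eq_omega:
  assumes "p \<in> M \<alpha>" and u: "u \<in> tangent_M \<alpha> p" and v: "v \<in> tangent_M \<alpha> p"
  shows "symp_form \<alpha> p u v = omega u v"
  unfolding symp_form_def
proof (rule the_equality)
  define f where "f = (\<lambda>w::phase. (- snd u) \<bullet> fst w + fst u \<bullet> snd w)"
  define g where "g = (\<lambda>w::phase. (- snd v) \<bullet> fst w + fst v \<bullet> snd w)"
  have lin: "linear f" "linear g"
    unfolding f_def g_def by (auto intro!: linearI simp: inner_add_right algebra_simps)
  have f: "has_grad f p (- snd u) (fst u)"
    unfolding has_grad_def f_def[symmetric] using lin by (simp add: linear_imp_has_derivative)
  have g: "has_grad g p (- snd v) (fst v)"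
    unfolding has_grad_def g_def[symmetric] using lin by (simp add: linear_imp_has_derivative)
  show "\<exists>f g. linear f \<and> linear g \<and> u = ham_vf \<alpha> f p \<and> v = ham_vf \<alpha> g p \<and> omega u v = dirac_bracket \<alpha> f g p"
    by (rule exI[of _ f], rule exI[of _ g])
      (simp add: lin ham_vf_grad[OF f] ham_vf_grad[OF g] dirac_bracket_grad[OF f g] tangent_eq_ham_vec u v omega_def)
next
  fix c assume "\<exists>f g. linear f \<and> linear g \<and> u = ham_vf \<alpha> f p \<and> v = ham_vf \<alpha> g p \<and> c = dirac_bracket \<alpha> f g p"
  then obtain f g where fg: "linear f" "linear g" "u = ham_vf \<alpha> f p" "v = ham_vf \<alpha> g p" "c = dirac_bracket \<alpha> f g p"
    by blast
  note grads = has_grad_linear(1)[OF fg(1), of p] has_grad_linear(1)[OF fg(2), of p]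
  show "c = omega u v"
    unfolding fg(5) dirac_bracket_grad[OF grads]
    using omega_ham_vec[OF v] ham_vf_grad[OF grads(1)] ham_vf_grad[OF grads(2)] fg(3,4) by metis
qed

text \<open>Pairing with the tangent vectors \<open>ham_vec \<alpha> p g k\<close> evaluates every
  linear functional on \<open>u\<close>; choosing the components of \<open>u\<close> as
  \<open>g\<close> and \<open>k\<close> gives their squared norms.\<close>

lemma omega_nondegenerate:
  assumes p: "p \<in> M \<alpha>" and u: "u \<in> tangent_M \<alpha> p" and z: "\<And>v. v \<in> tangent_M \<alpha> p \<Longrightarrow> omega u v = 0"
  shows "u = 0"
proof -
  let ?n = "wt \<alpha> (fst p)" and ?m = "wt \<alpha> (snd p)"
  have *: "g \<bullet> fst u + k \<bullet> snd u = 0" for g k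
    using z[OF ham_vec_tangent[OF p, of g k]] omega_ham_vec[OF u, of g k]
    by (simp add: omega_def inner_commute)
  have "fst u \<bullet> fst u = 0" using *[of "fst u" 0] by simp
  moreover have "snd u \<bullet> snd u = 0" using *[of 0 "snd u"] by simp
  ultimately show ?thesis by (simp add: prod_eq_iff)
qed

lemma omega_add_left: "omega (u + u') v = omega u v + omega u' v"
  and omega_add_right: "omega u (v + v') = omega u v + omega u v'"
  and omega_scaleR_left: "omega (t *\<^sub>R u) v = t * omega u v"
  and omega_scaleR_right: "omega u (t *\<^sub>R v) = t * omega u v"
  and omega_zero_left [simp]: "omega 0 v = 0"
  and omega_zero_right [simp]: "omega u 0 = 0"
  by (simp_all add: omega_def algebra_simps)

lemma omega_commute: "omega u v = - omega v u"
  by (simp add: omega_def inner_commute)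

lemma omega_sum_left: "omega (sum f I) v = (\<Sum>i\<in>I. omega (f i) v)"
  by (induction I rule: infinite_finite_induct) (simp_all add: omega_add_left)

lemma subspace_tangent_M: "subspace (tangent_M \<alpha> p)"
proof -
  have "linear (\<lambda>v::phase. (fst v \<bullet> wt \<alpha> (fst p), fst v \<bullet> wt \<alpha> (snd p) + snd v \<bullet> wt \<alpha> (fst p)))"
    by (rule linearI) (simp_all add: inner_add_left distrib_left)
  then have "subspace ((\<lambda>v::phase. (fst v \<bullet> wt \<alpha> (fst p), fst v \<bullet> wt \<alpha> (snd p) + snd v \<bullet> wt \<alpha> (fst p))) -` {0})"
    by (rule linear_subspace_vimage) simp
  moreover have "\<dots> = tangent_M \<alpha> p"
    by (auto simp: tangent_M_iff zero_prod_def)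
  ultimately show ?thesis by simp
qed

text \<open>In the 8-dimensional phase space this is the orthogonal complement of the two
  independent normals \<open>(n, 0)\<close> and \<open>(m, n)\<close>, where \<open>n\<close> is
  nonzero on the leaf.\<close>

lemma dim_tangent_M:
  assumes p: "p \<in> M \<alpha>"
  shows "dim (tangent_M \<alpha> p) = 6"
proof -
  let ?n = "wt \<alpha> (fst p)" and ?m = "wt \<alpha> (snd p)"
  have n: "?n \<noteq> 0" using Dfun_pos[OF p] by (auto simp: Dfun_wt)
  have ne: "(?n, 0) \<noteq> (?m, ?n)" using n by simp
  have ind: "independent {(?n, 0::real^4), (?m, ?n)}"
    using n by (auto simp: independent_insert span_singleton zero_prod_def)
  have "{y. \<forall>x\<in>span {(?n, 0), (?m, ?n)}. orthogonal x y} = tangent_M \<alpha> p"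
    (is "?L = ?R")
  proof (intro Set.set_eqI iffI)
    fix v assume "v \<in> ?L"
    then have "orthogonal (?n, 0) v" "orthogonal (?m, ?n) v" by (simp_all add: span_base)
    then show "v \<in> tangent_M \<alpha> p"
      by (cases v) (simp add: tangent_M_iff Linear_Algebra.orthogonal_def inner_commute)
  next
    fix v assume v: "v \<in> tangent_M \<alpha> p"
    have "orthogonal x v" if "x \<in> span {(?n, 0), (?m, ?n)}" for x
      using that
    proof (induction rule: span_induct)
      case base
      show ?case using subspace_orthogonal_to_vector[of v] by (simp only: orthogonal_commute)
    next
      case (step x)
      with v show ?case by (cases v) (auto simp: tangent_M_iff Linear_Algebra.orthogonal_def inner_commute)
    qed
    then show "v \<in> ?L" by simp
  qed
  moreover have "dim {y \<in> UNIV. \<forall>x\<in>span {(?n, 0::real^4), (?m, ?n)}. orthogonal x y}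
      + dim (span {(?n, 0::real^4), (?m, ?n)}) = dim (UNIV :: phase set)"
    by (rule dim_subspace_orthogonal_to_vectors) auto
  moreover have "dim (span {(?n, 0::real^4), (?m, ?n)}) = 2"
    using ind ne by (simp add: dim_eq_card_independent)
  ultimately show ?thesis by simp
qed

section \<open>Combinations of the integrals and their differentials\<close>

text \<open>Closed forms of the two partial gradients of \<open>comb\<close>, so that single
  components can be simplified at points with vanishing coordinates; \<open>has_grad_comb\<close>
  justifies them.\<close>

definition grad_x :: "real^4 \<Rightarrow> real \<times> real \<times> real \<Rightarrow> phase \<Rightarrow> real^4" where
  "grad_x \<alpha> = (\<lambda>(a, b, d) (x, y). \<chi> i.
     if i = 0 then 2 * d * (y $ 1 * (x $ 0 * y $ 1 - x $ 1 * y $ 0) + y $ 2 * (x $ 0 * y $ 2 - x $ 2 * y $ 0)) / (\<alpha> $ 1 - \<alpha> $ 0)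
     else if i = 1 then b * y $ 2 - 2 * d * y $ 0 * (x $ 0 * y $ 1 - x $ 1 * y $ 0) / (\<alpha> $ 1 - \<alpha> $ 0)
         + 2 * d * y $ 3 * (x $ 1 * y $ 3 - x $ 3 * y $ 1) / (\<alpha> $ 1 - \<alpha> $ 3)
     else if i = 2 then - b * y $ 1 - 2 * d * y $ 0 * (x $ 0 * y $ 2 - x $ 2 * y $ 0) / (\<alpha> $ 1 - \<alpha> $ 0)
         + 2 * d * y $ 3 * (x $ 2 * y $ 3 - x $ 3 * y $ 2) / (\<alpha> $ 1 - \<alpha> $ 3)
     else - 2 * d * (y $ 1 * (x $ 1 * y $ 3 - x $ 3 * y $ 1) + y $ 2 * (x $ 2 * y $ 3 - x $ 3 * y $ 2)) / (\<alpha> $ 1 - \<alpha> $ 3))"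

definition grad_y :: "real^4 \<Rightarrow> real \<times> real \<times> real \<Rightarrow> phase \<Rightarrow> real^4" where
  "grad_y \<alpha> = (\<lambda>(a, b, d) (x, y). \<chi> i.
     if i = 0 then a * y $ 0 - 2 * d * (x $ 1 * (x $ 0 * y $ 1 - x $ 1 * y $ 0) + x $ 2 * (x $ 0 * y $ 2 - x $ 2 * y $ 0)) / (\<alpha> $ 1 - \<alpha> $ 0)
     else if i = 1 then a * y $ 1 - b * x $ 2 + 2 * d * y $ 1 + 2 * d * x $ 0 * (x $ 0 * y $ 1 - x $ 1 * y $ 0) / (\<alpha> $ 1 - \<alpha> $ 0)
         - 2 * d * x $ 3 * (x $ 1 * y $ 3 - x $ 3 * y $ 1) / (\<alpha> $ 1 - \<alpha> $ 3)
     else if i = 2 then a * y $ 2 + b * x $ 1 + 2 * d * y $ 2 + 2 * d * x $ 0 * (x $ 0 * y $ 2 - x $ 2 * y $ 0) / (\<alpha> $ 1 - \<alpha> $ 0)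
         - 2 * d * x $ 3 * (x $ 2 * y $ 3 - x $ 3 * y $ 2) / (\<alpha> $ 1 - \<alpha> $ 3)
     else a * y $ 3 + 2 * d * (x $ 1 * (x $ 1 * y $ 3 - x $ 3 * y $ 1) + x $ 2 * (x $ 2 * y $ 3 - x $ 3 * y $ 2)) / (\<alpha> $ 1 - \<alpha> $ 3))"

lemma has_derivative_fst_nth [derivative_intros]:
  "((\<lambda>q. fst q $ i) has_derivative (\<lambda>v. fst v $ i)) F"
  by (rule bounded_linear.has_derivative[OF bounded_linear_vec_nth]) (rule has_derivative_fst, rule has_derivative_ident)

lemma has_derivative_snd_nth [derivative_intros]:
  "((\<lambda>q. snd q $ i) has_derivative (\<lambda>v. snd v $ i)) F"
  by (rule bounded_linear.has_derivative[OF bounded_linear_vec_nth]) (rule has_derivative_snd, rule has_derivative_ident)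

lemma grad_x_linear: "linear (\<lambda>c. grad_x \<alpha> c p)"
proof (rule linearI)
  show "grad_x \<alpha> (b + c) p = grad_x \<alpha> b p + grad_x \<alpha> c p" for b c
    by (cases b; cases c; cases p)
      (simp add: grad_x_def cart_eq_iff diff_divide_distrib add_divide_distrib distrib_right distrib_left right_diff_distrib left_diff_distrib)
  show "grad_x \<alpha> (r *\<^sub>R b) p = r *\<^sub>R grad_x \<alpha> b p" for r b
    by (cases b; cases p)
      (simp add: grad_x_def cart_eq_iff diff_divide_distrib add_divide_distrib algebra_simps)
qed

lemma grad_y_linear: "linear (\<lambda>c. grad_y \<alpha> c p)"
proof (rule linearI)
  show "grad_y \<alpha> (b + c) p = grad_y \<alpha> b p + grad_y \<alpha> c p" for b c
    by (cases b; cases c; cases p)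
      (simp add: grad_y_def cart_eq_iff diff_divide_distrib add_divide_distrib distrib_right distrib_left right_diff_distrib left_diff_distrib)
  show "grad_y \<alpha> (r *\<^sub>R b) p = r *\<^sub>R grad_y \<alpha> b p" for r b
    by (cases b; cases p)
      (simp add: grad_y_def cart_eq_iff diff_divide_distrib add_divide_distrib algebra_simps)
qed

text \<open>Euler's identity for the scaling \<open>x \<mapsto> x + s y\<close>, under which the \<open>x\<^sub>i y\<^sub>j - x\<^sub>j y\<^sub>i\<close> are
  invariant.\<close>

lemma inner_snd_grad_x: "snd p \<bullet> grad_x \<alpha> c p = 0"
  by (cases c; cases p)
    (simp add: grad_x_def inner_vec_def sum_UNIV_4 algebra_simps diff_divide_distrib add_divide_distrib)

text \<open>Euler's identity for scaling \<open>x\<close>: \<open>J\<close> has degree one and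
  \<open>G\<close> without the squares of \<open>y\<close> has degree two. At a critical point this
  is the value of the multiplier of \<open>C1\<close>.\<close>

lemma inner_fst_grad_x:
  "fst p \<bullet> grad_x \<alpha> (a, b, d) p = b * Jfun p + 2 * d * (Gfun \<alpha> p - (snd p $ 1)\<^sup>2 - (snd p $ 2)\<^sup>2)"
  by (cases p)
    (simp add: grad_x_def Gfun_def Jfun_def inner_vec_def sum_UNIV_4 power2_eq_square algebra_simps diff_divide_distrib add_divide_distrib)

text \<open>Euler's identity for scaling \<open>y\<close>, where \<open>H\<close> and
  \<open>G\<close> have degree two and \<open>J\<close> degree one.\<close>

lemma inner_snd_grad_y:
  "snd p \<bullet> grad_y \<alpha> (a, b, d) p = 2 * a * Hfun p + b * Jfun p + 2 * d * Gfun \<alpha> p"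
  by (cases p)
    (simp add: grad_y_def Hfun_def Gfun_def Jfun_def inner_vec_def sum_UNIV_4 power2_eq_square algebra_simps diff_divide_distrib add_divide_distrib)

lemma nonzero_of_Hfun_pos: "Hfun p > 0 \<Longrightarrow> snd p \<noteq> 0"
  by (auto simp: Hfun_def split: prod.splits)

locale ellipsoid =
  fixes \<alpha> :: "real^4"
  assumes \<alpha>0: "0 < \<alpha> $ 0" and \<alpha>01: "\<alpha> $ 0 < \<alpha> $ 1" and \<alpha>12: "\<alpha> $ 1 = \<alpha> $ 2" and \<alpha>23: "\<alpha> $ 2 < \<alpha> $ 3"
begin

lemma \<alpha>_pos: "0 < \<alpha> $ i"
  using \<alpha>0 \<alpha>01 \<alpha>12 \<alpha>23 exhaust_4[of i] by auto

lemma inner_wt_pos: "y \<noteq> 0 \<Longrightarrow> 0 < y \<bullet> wt \<alpha> y"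
proof -
  assume "y \<noteq> 0"
  then obtain i where i: "y $ i \<noteq> 0" by (auto simp: cart_eq_iff)
  have "0 < y $ i * (y $ i / \<alpha> $ i)"
    using i \<alpha>_pos[of i] by (simp add: zero_less_mult_iff zero_less_divide_iff) linarith
  then show ?thesis
    unfolding inner_vec_def inner_real_def wt_nth
    by (intro sum_pos2[of UNIV i]) (auto simp: \<alpha>_pos less_imp_le zero_le_mult_iff zero_le_divide_iff linorder_linear)
qed

lemma has_grad_comb: "has_grad (comb \<alpha> c) p (grad_x \<alpha> c p) (grad_y \<alpha> c p)"
proof -
  obtain a b d where c: "c = (a, b, d)" by (metis surj_pair)
  have ne: "\<alpha> $ 1 - \<alpha> $ 0 \<noteq> 0" "\<alpha> $ 1 - \<alpha> $ 3 \<noteq> 0" using \<alpha>01 \<alpha>12 \<alpha>23 by auto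
  obtain x y where p: "p = (x, y)" by (cases p)
  have e: "comb \<alpha> c = (\<lambda>q. a * (((snd q $ 0)\<^sup>2 + (snd q $ 1)\<^sup>2 + (snd q $ 2)\<^sup>2 + (snd q $ 3)\<^sup>2) / 2)
     + b * (fst q $ 1 * snd q $ 2 - fst q $ 2 * snd q $ 1)
     + d * ((snd q $ 1)\<^sup>2 + (snd q $ 2)\<^sup>2
       + ((fst q $ 0 * snd q $ 1 - fst q $ 1 * snd q $ 0)\<^sup>2 + (fst q $ 0 * snd q $ 2 - fst q $ 2 * snd q $ 0)\<^sup>2) / (\<alpha> $ 1 - \<alpha> $ 0)
       + ((fst q $ 1 * snd q $ 3 - fst q $ 3 * snd q $ 1)\<^sup>2 + (fst q $ 2 * snd q $ 3 - fst q $ 3 * snd q $ 2)\<^sup>2) / (\<alpha> $ 1 - \<alpha> $ 3)))"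
    by (simp add: c fun_eq_iff comb_def EM_def Hfun_def Jfun_def Gfun_def split: prod.split)
  show ?thesis
    unfolding has_grad_def e
    by (rule has_derivative_eq_rhs, (rule derivative_intros ne numeral_neq_zero)+, rule ext)
      (simp add: p c grad_x_def grad_y_def inner_vec_def sum_UNIV_4 ne
        diff_divide_distrib add_divide_distrib power2_eq_square algebra_simps)
qed

lemma ham_vf_comb: "ham_vf \<alpha> (comb \<alpha> c) p = ham_vec \<alpha> p (grad_x \<alpha> c p) (grad_y \<alpha> c p)"
  by (rule ham_vf_grad[OF has_grad_comb])

lemma comb_unit: "comb \<alpha> (1, 0, 0) = Hfun" "comb \<alpha> (0, 1, 0) = Jfun" "comb \<alpha> (0, 0, 1) = Gfun \<alpha>"
  by (simp_all add: fun_eq_iff comb_def EM_def)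

lemma linear_ham_vf_comb: "linear (\<lambda>c. ham_vf \<alpha> (comb \<alpha> c) p)"
proof -
  note l = linear_add[OF grad_x_linear] linear_add[OF grad_y_linear] linear_scale[OF grad_x_linear] linear_scale[OF grad_y_linear]
  show ?thesis
    unfolding ham_vf_comb
  by (rule linearI) (simp_all add: l ham_vec_def mult_T_def mult_L_def inner_add_left add_divide_distrib diff_divide_distrib
      scaleR_add_left scaleR_diff_left scaleR_add_right scaleR_diff_right right_diff_distrib)
qed

lemma omega_ham_vf_comb:
  assumes "v \<in> tangent_M \<alpha> p"
  shows "omega (ham_vf \<alpha> (comb \<alpha> c) p) v = frechet_derivative (comb \<alpha> c) (at p) v"
  by (simp add: ham_vf_comb omega_ham_vec[OF assms] has_grad_frechet[OF has_grad_comb])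

section \<open>Vanishing combinations, corank and orbit directions\<close>

definition dEM :: "phase \<Rightarrow> phase \<Rightarrow> real \<times> real \<times> real" where
  "dEM p v = (frechet_derivative Hfun (at p) v, frechet_derivative Jfun (at p) v, frechet_derivative (Gfun \<alpha>) (at p) v)"

lemma has_derivative_EM: "(EM \<alpha> has_derivative dEM p) (at p)"
proof -
  have "(comb \<alpha> c has_derivative frechet_derivative (comb \<alpha> c) (at p)) (at p)" for c
    using has_grad_comb[of c p] by (simp add: has_grad_frechet[OF has_grad_comb] has_grad_def)
  from this[of "(1,0,0)"] this[of "(0,1,0)"] this[of "(0,0,1)"] show ?thesis
    unfolding EM_def[abs_def] dEM_def[abs_def] comb_unit by (intro has_derivative_Pair)
qed

lemma frechet_EM: "frechet_derivative (EM \<alpha>) (at p) = dEM p"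
  using has_derivative_EM by (rule frechet_derivative_at[symmetric])

lemma linear_dEM: "linear (dEM p)"
  using has_derivative_EM[of p] by (rule has_derivative_linear)

lemma inner_dEM: "c \<bullet> dEM p v = frechet_derivative (comb \<alpha> c) (at p) v"
proof -
  have "(comb \<alpha> c has_derivative (\<lambda>v. c \<bullet> dEM p v)) (at p)"
    unfolding comb_def[abs_def] by (rule has_derivative_inner_right[OF has_derivative_EM])
  then show ?thesis using frechet_derivative_at by metis
qed

lemma vanishing_combs_iff_dEM:
  assumes p: "p \<in> M \<alpha>"
  shows "c \<in> vanishing_combs \<alpha> p \<longleftrightarrow> (\<forall>v\<in>tangent_M \<alpha> p. c \<bullet> dEM p v = 0)"
proof
  assume "c \<in> vanishing_combs \<alpha> p"
  then show "\<forall>v\<in>tangent_M \<alpha> p. c \<bullet> dEM p v = 0"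
    by (simp add: inner_dEM vanishing_combs_def flip: omega_ham_vf_comb)
next
  assume "\<forall>v\<in>tangent_M \<alpha> p. c \<bullet> dEM p v = 0"
  then show "c \<in> vanishing_combs \<alpha> p"
    unfolding vanishing_combs_def mem_Collect_eq
    by (intro omega_nondegenerate[OF p])
      (simp_all add: omega_ham_vf_comb inner_dEM, simp add: ham_vf_comb ham_vec_tangent p)
qed

lemma critical_iff: "critical \<alpha> p \<longleftrightarrow> p \<in> M \<alpha> \<and> (\<exists>c\<in>vanishing_combs \<alpha> p. c \<noteq> 0)"
proof (cases "p \<in> M \<alpha>")
  case True
  have "(\<exists>c\<in>vanishing_combs \<alpha> p. c \<noteq> 0) \<longleftrightarrow> (\<exists>a b d. (a, b, d) \<in> vanishing_combs \<alpha> p \<and> (a, b, d) \<noteq> (0, 0, 0))"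
    by (metis (no_types) surj_pair zero_prod_def)
  also have "\<dots> \<longleftrightarrow> critical \<alpha> p"
    using True unfolding critical_def vanishing_combs_iff_dEM[OF True]
    by (simp add: dEM_def add.assoc conj_commute)
  finally show ?thesis using True by simp
qed (simp add: critical_def)

lemma subspace_vanishing_combs: "subspace (vanishing_combs \<alpha> p)"
  using linear_subspace_kernel[OF linear_ham_vf_comb[of p]] by (simp add: vanishing_combs_def)

text \<open>The vanishing combinations are exactly the orthogonal complement in
  \<open>real \<times> real \<times> real\<close> of the image of the tangent space under
  \<open>dEM\<close>.\<close>

lemma dim_dEM_tangent:
  assumes p: "p \<in> M \<alpha>"
  shows "dim (dEM p ` tangent_M \<alpha> p) + dim (vanishing_combs \<alpha> p) = 3"
proof -
  have sub: "subspace (dEM p ` tangent_M \<alpha> p)"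
    by (rule linear_subspace_image[OF linear_dEM subspace_tangent_M])
  have "{y \<in> UNIV. \<forall>x\<in>dEM p ` tangent_M \<alpha> p. orthogonal x y} = vanishing_combs \<alpha> p"
    by (auto simp: vanishing_combs_iff_dEM[OF p] Linear_Algebra.orthogonal_def inner_commute[of "dEM p _"] simp del: inner_Pair)
  then show ?thesis
    using dim_subspace_orthogonal_to_vectors[OF sub subspace_UNIV] by simp
qed

lemma corank_eq_dim: "p \<in> M \<alpha> \<Longrightarrow> corank \<alpha> p = dim (vanishing_combs \<alpha> p)"
  using dim_dEM_tangent[of p] by (simp add: corank_def frechet_EM)

text \<open>The field depends linearly on the combination, so the span of the three fields is the
  range of a linear map whose kernel is \<open>vanishing_combs\<close>; rank and nullity then give
  its dimension.\<close>

lemma orbit_dirs_eq: "orbit_dirs \<alpha> p = range (\<lambda>c. ham_vf \<alpha> (comb \<alpha> c) p)"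
proof -
  let ?X = "\<lambda>c. ham_vf \<alpha> (comb \<alpha> c) p"
  have "UNIV = span {(1, 0, 0), (0, 1, 0), (0, 0, 1 :: real) :: real \<times> real \<times> real}"
  proof -
    have "(a, b, d) = a *\<^sub>R (1, 0, 0) + b *\<^sub>R (0, 1, 0) + d *\<^sub>R (0, 0, 1)" for a b d :: real
      by simp
    then have "(a, b, d) \<in> span {(1, 0, 0), (0, 1, 0), (0, 0, 1 :: real)}" for a b d :: real
      by (metis (no_types, lifting) insertCI span_add span_base span_scale)
    then show ?thesis by auto
  qed
  then have "range ?X = span (?X ` {(1, 0, 0), (0, 1, 0), (0, 0, 1)})"
    using span_linear_image[OF linear_ham_vf_comb] by metis
  then show ?thesis by (simp add: orbit_dirs_def comb_unit)
qed

lemma dim_orbit_dirs: "dim (orbit_dirs \<alpha> p) + dim (vanishing_combs \<alpha> p) = 3"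
  using rank_nullity[OF linear_ham_vf_comb[of p] subspace_UNIV]
  by (simp add: orbit_dirs_eq vanishing_combs_def)

lemma orbit_dirs_tangent: "p \<in> M \<alpha> \<Longrightarrow> orbit_dirs \<alpha> p \<subseteq> tangent_M \<alpha> p"
  by (auto simp: orbit_dirs_eq ham_vf_comb ham_vec_tangent)

text \<open>Being \<open>omega\<close>-orthogonal to the field of a function means being annihilated
  by its differential, so the symplectic orthogonal is the joint kernel of the three
  differentials.\<close>

lemma orbit_dirs_perp_eq:
  assumes p: "p \<in> M \<alpha>"
  shows "orbit_dirs_perp \<alpha> p = {v \<in> tangent_M \<alpha> p. dEM p v = 0}"
proof -
  have "(\<forall>u\<in>orbit_dirs \<alpha> p. symp_form \<alpha> p v u = 0) \<longleftrightarrow> dEM p v = 0" if v: "v \<in> tangent_M \<alpha> p" for v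
  proof -
    have "(\<forall>u\<in>orbit_dirs \<alpha> p. symp_form \<alpha> p v u = 0) \<longleftrightarrow> (\<forall>u\<in>orbit_dirs \<alpha> p. omega u v = 0)"
      using orbit_dirs_tangent[OF p] v
      by (intro ball_cong refl) (subst symp_form_eq_omega[OF p v], auto simp: omega_commute[of v])
    also have "\<dots> \<longleftrightarrow> (\<forall>c. c \<bullet> dEM p v = 0)"
      by (simp add: orbit_dirs_eq omega_ham_vf_comb[OF v] inner_dEM)
    also have "\<dots> \<longleftrightarrow> dEM p v = 0" by (metis inner_eq_zero_iff inner_zero_right)
    finally show ?thesis .
  qed
  then show ?thesis by (auto simp: orbit_dirs_perp_def)
qed

lemma dim_orbit_dirs_perp:
  assumes p: "p \<in> M \<alpha>"
  shows "dim (orbit_dirs_perp \<alpha> p) = 3 + dim (vanishing_combs \<alpha> p)"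
  using rank_nullity[OF linear_dEM subspace_tangent_M, of p \<alpha> p] dim_dEM_tangent[OF p] dim_tangent_M[OF p]
  by (simp add: orbit_dirs_perp_eq[OF p])

text \<open>The multiplier \<open>T\<close> of a vanishing Hamiltonian vector field is zero since \<open>y \<bullet> grad\<^sub>x = 0\<close>.\<close>

lemma vanishing_combs_iff:
  assumes p: "p \<in> M \<alpha>" and y: "snd p \<noteq> 0"
  shows "c \<in> vanishing_combs \<alpha> p \<longleftrightarrow>
    grad_y \<alpha> c p = 0 \<and> grad_x \<alpha> c p = (fst p \<bullet> grad_x \<alpha> c p) *\<^sub>R wt \<alpha> (fst p)"
proof
  let ?n = "wt \<alpha> (fst p)" and ?m = "wt \<alpha> (snd p)" and ?g = "grad_x \<alpha> c p" and ?k = "grad_y \<alpha> c p"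
  assume "c \<in> vanishing_combs \<alpha> p"
  then have 0: "?k = mult_T \<alpha> p ?k *\<^sub>R ?n" "?g = mult_L \<alpha> p ?g ?k *\<^sub>R ?n + mult_T \<alpha> p ?k *\<^sub>R ?m"
    by (simp_all add: vanishing_combs_def ham_vf_comb ham_vec_def zero_prod_def)
  have "0 = snd p \<bullet> (mult_L \<alpha> p ?g ?k *\<^sub>R ?n + mult_T \<alpha> p ?k *\<^sub>R ?m)"
    using inner_snd_grad_x[of p \<alpha> c] 0(2) by simp
  \<comment> \<open>\<open>C2\<close> removes the term with \<open>wt \<alpha> (fst p)\<close>; what
    is left is \<open>mult_T\<close> times a positive definite form in the nonzero
    \<open>snd p\<close>.\<close>
  also have "\<dots> = mult_T \<alpha> p ?k * (snd p \<bullet> ?m)"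
    using p by (simp add: M_iff inner_add_right)
  finally have T: "mult_T \<alpha> p ?k = 0" using inner_wt_pos[OF y] by simp
  then have g: "?g = mult_L \<alpha> p ?g ?k *\<^sub>R ?n" using 0(2) by simp
  have "fst p \<bullet> ?g = mult_L \<alpha> p ?g ?k"
    by (subst g) (use p in \<open>simp add: M_iff\<close>)
  then show "?k = 0 \<and> ?g = (fst p \<bullet> ?g) *\<^sub>R ?n" using T 0(1) g by simp
next
  let ?n = "wt \<alpha> (fst p)" and ?g = "grad_x \<alpha> c p" and ?k = "grad_y \<alpha> c p"
  assume *: "?k = 0 \<and> ?g = (fst p \<bullet> ?g) *\<^sub>R ?n"
  have "?g \<bullet> ?n = (fst p \<bullet> ?g) * (?n \<bullet> ?n)" by (subst *[THEN conjunct2]) simp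
  then have "mult_L \<alpha> p ?g 0 = fst p \<bullet> ?g" "mult_T \<alpha> p 0 = 0"
    using Dfun_pos[OF p] by (simp_all add: mult_L_def mult_T_def Dfun_wt)
  then show "c \<in> vanishing_combs \<alpha> p"
    using * by (simp add: vanishing_combs_def ham_vf_comb ham_vec_def zero_prod_def)
qed

end

section \<open>Critical points\<close>

text \<open>A homogeneous 2 by 2 system with a nonzero solution has determinant zero.\<close>

lemma singular_system_det:
  fixes u v q x y :: real
  assumes "u * y = q * x" "v * x = q * y" "x \<noteq> 0 \<or> y \<noteq> 0"
  shows "u * v = q\<^sup>2"
proof -
  have "u * v * x = q * (u * y)" using assms(2) by (simp add: mult.assoc mult.left_commute)
  moreover have "u * v * y = q * (v * x)" using assms(1) by (simp add: mult.assoc mult.left_commute)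
  ultimately have "u * v * x = q\<^sup>2 * x" "u * v * y = q\<^sup>2 * y"
    unfolding assms(1,2) by (simp_all add: power2_eq_square)
  then show ?thesis using assms(3) by auto
qed

lemma double_cancel: "2 * a = 2 * b \<Longrightarrow> a = (b::real)"
  by simp

text \<open>Multiplying \<open>q * (x * y)\<close> by \<open>u\<close> gives a square.\<close>

lemma proportional_sign:
  fixes u q x y :: real
  assumes "0 < u" "u * y = q * x"
  shows "0 \<le> q * (x * y)"
proof -
  have "u * (q * (x * y)) = (u * y) * (q * x)" by simp
  also have "\<dots> = (q * x)\<^sup>2" unfolding assms(2) by (simp add: power2_eq_square)
  finally have "0 \<le> u * (q * (x * y))" by simp
  then show ?thesis using assms(1) by (simp only: zero_le_mult_iff) linarith
qed

text \<open>The equations \<open>\<nabla>f = \<lambda> \<nabla>C\<^sub>1 / 2\<close> for \<open>f = 2 A H + 2 B J + G\<close> and \<open>\<lambda> = 2 l\<close>, written with the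
  rotation invariants \<open>p, q, r\<close> of the plane of the equal axes.\<close>

lemma critical_equations:
  fixes a b c A B l x0 x1 x2 x3 y0 y1 y2 y3 :: real
  defines "p \<equiv> x1\<^sup>2 + x2\<^sup>2" and "q \<equiv> x1 * y1 + x2 * y2" and "r \<equiv> y1\<^sup>2 + y2\<^sup>2"
  defines "Nxx \<equiv> y0\<^sup>2 / (b - a) - y3\<^sup>2 / (c - b) - l / b"
    and "Nxy \<equiv> x3 * y3 / (c - b) - x0 * y0 / (b - a)"
    and "Nyy \<equiv> 1 + A + x0\<^sup>2 / (b - a) - x3\<^sup>2 / (c - b)"
  assumes ab: "0 < a" "a < b" "b < c"
    and e0y: "(p + A * (b - a)) * y0 = q * x0" and e0x: "(r - l * (b - a) / a) * x0 = q * y0"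
    and e3y: "(p - A * (c - b)) * y3 = q * x3" and e3x: "(r + l * (c - b) / c) * x3 = q * y3"
    and n1x: "Nxx * x1 + Nxy * y1 = - B * y2" and n1y: "Nxy * x1 + Nyy * y1 = B * x2"
    and n2x: "Nxx * x2 + Nxy * y2 = B * y1" and n2y: "Nxy * x2 + Nyy * y2 = - B * x1"
    and m1: "x0\<^sup>2 / a + p / b + x3\<^sup>2 / c = 1" and m2: "x0 * y0 / a + q / b + x3 * y3 / c = 0"
    and y: "0 < y0\<^sup>2 + r + y3\<^sup>2"
    and euler: "x1 * y2 - x2 * y1 = 0 \<Longrightarrow> A * (y0\<^sup>2 + r + y3\<^sup>2) + l + r = 0"
  shows "x0 = 0 \<and> y0 = 0 \<or> x3 = 0 \<and> y3 = 0 \<or> p = 0 \<and> r = 0"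
proof (rule ccontr)
  assume neg: "\<not> ?thesis"
  have pos: "0 \<le> p" "0 \<le> r" by (auto simp: p_def r_def)
  have lagrange: "p * r = q\<^sup>2 + (x1 * y2 - x2 * y1)\<^sup>2"
    by (simp add: p_def q_def r_def power2_eq_square algebra_simps)
  \<comment> \<open>\<open>l0\<close> and \<open>l3\<close> have the sign of \<open>l\<close>, and
    \<open>A0\<close> and \<open>A3\<close> that of \<open>A\<close>, since
    \<open>a < b < c\<close>.\<close>
  define l0 where "l0 = l * (b - a) / a"
  define l3 where "l3 = l * (c - b) / c"
  define A0 where "A0 = A * (b - a)"
  define A3 where "A3 = A * (c - b)"
  note e = e0y[folded A0_def] e0x[folded l0_def] e3y[folded A3_def] e3x[folded l3_def]
  have det0: "(p + A0) * (r - l0) = q\<^sup>2"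
    by (rule singular_system_det[OF e(1,2)]) (use neg in auto)
  have det3: "(p - A3) * (r + l3) = q\<^sup>2"
    by (rule singular_system_det[OF e(3,4)]) (use neg in auto)
  have sgn: "0 < A \<Longrightarrow> 0 < A0" "0 < A \<Longrightarrow> 0 < A3" "A < 0 \<Longrightarrow> A0 < 0" "A < 0 \<Longrightarrow> A3 < 0"
    "0 < l \<Longrightarrow> 0 < l0" "0 < l \<Longrightarrow> 0 < l3" "l < 0 \<Longrightarrow> l0 < 0" "l < 0 \<Longrightarrow> l3 < 0"
    "A = 0 \<Longrightarrow> A0 = 0" "A = 0 \<Longrightarrow> A3 = 0" "l = 0 \<Longrightarrow> l0 = 0" "l = 0 \<Longrightarrow> l3 = 0"
    using ab by (auto simp: A0_def A3_def l0_def l3_def mult_neg_pos divide_neg_pos)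
  \<comment> \<open>The equality case of the comparison with the Lagrange identity. Either
    \<open>A\<close> or \<open>r\<close> is zero; the Euler relation then fixes \<open>l\<close>,
    and the four linear equations make all of \<open>y\<close> or all of \<open>x\<close> vanish,
    unless the Euler relation itself already fails.\<close>
  have mixed: False if J: "x1 * y2 - x2 * y1 = 0" and Ar: "A * r = 0" and pl: "p * l = 0"
  proof -
    have q: "q\<^sup>2 = p * r" using lagrange J by simp
    show False
    proof (cases "A = 0")
      case True
      then have l: "l = - r" using euler[OF J] by simp
      then have "p = 0 \<or> r = 0" using pl by auto
      then have q0: "q = 0" using q by auto
      show False
      proof (cases "r = 0")
        case True
        with neg have "p \<noteq> 0" by auto
        then have "y0 = 0" "y3 = 0" using e q0 \<open>A = 0\<close> by (auto simp: A0_def A3_def)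
        with y True show False by simp
      next
        case r: False
        with \<open>p = 0 \<or> r = 0\<close> have "p = 0" by auto
        have "r - l0 = r * (b / a)" "r + l3 = r * (b / c)"
          using ab by (auto simp: l0_def l3_def l field_simps)
        then have "x0 = 0" "x3 = 0" using e q0 r ab by auto
        with m1 \<open>p = 0\<close> show False by simp
      qed
    next
      case False
      then have r: "r = 0" using Ar by simp
      with neg have "p \<noteq> 0" by auto
      with pl have "l = 0" by simp
      with euler[OF J] False r y show False by simp
    qed
  qed
  \<comment> \<open>With nonnegative shifts the determinant is at least \<open>p * r\<close>, hence
    at least the square of \<open>q\<close>. Equality leaves no room for the cross terms or for the
    angular momentum.\<close>
  have squeeze: "x1 * y2 - x2 * y1 = 0 \<and> s * r = 0 \<and> p * t = 0"
    if "(p + s) * (r + t) = q\<^sup>2" "0 \<le> s" "0 \<le> t" for s t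
  proof -
    have "p * t + s * r + s * t + (x1 * y2 - x2 * y1)\<^sup>2 = 0"
      using that(1) lagrange by (simp add: algebra_simps)
    moreover have "0 \<le> p * t" "0 \<le> s * r" "0 \<le> s * t" "0 \<le> (x1 * y2 - x2 * y1)\<^sup>2"
      using pos that by simp_all
    ultimately have "p * t = 0" "s * r = 0" "(x1 * y2 - x2 * y1)\<^sup>2 = 0" by linarith+
    then show ?thesis by simp
  qed
  \<comment> \<open>\<open>q\<close> times the second constraint is a sum of three nonnegative
    terms, one of which is a positive multiple of the square of \<open>q\<close>.\<close>
  have q0: "q = 0" if "0 \<le> q * (x0 * y0)" "0 \<le> q * (x3 * y3)"
  proof -
    have "q * (x0 * y0 / a + q / b + x3 * y3 / c) = q * (x0 * y0) / a + q * q / b + q * (x3 * y3) / c"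
      by (simp add: algebra_simps)
    then have "q * (x0 * y0) / a + q * q / b + q * (x3 * y3) / c = 0" using m2 by simp
    moreover have "0 \<le> q * (x0 * y0) / a" "0 \<le> q * (x3 * y3) / c" "0 \<le> q * q / b"
      using that ab by simp_all
    ultimately have "q * q / b = 0" by linarith
    then show ?thesis using ab by simp
  qed
  \<comment> \<open>Without the mixed entry the equations in the plane of the equal axes combine to
    \<open>Nxx * Nyy\<close> and the square of \<open>B\<close> acting alike on the nonzero vector
    (\<open>y1\<close>, \<open>y2\<close>).\<close>
  have NN: "0 \<le> Nxx * Nyy" if "Nxy = 0" "r \<noteq> 0"
  proof -
    have n: "Nxx * x1 = - B * y2" "Nyy * y1 = B * x2" "Nxx * x2 = B * y1" "Nyy * y2 = - B * x1"
      using n1x n1y n2x n2y that(1) by simp_all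
    have "Nxx * Nyy * y1 = B * (Nxx * x2)" using n(2) by (simp add: mult.assoc mult.left_commute)
    moreover have "Nxx * Nyy * y2 = - B * (Nxx * x1)" using n(4) by (simp add: mult.assoc mult.left_commute)
    ultimately have "Nxx * Nyy * y1 = B\<^sup>2 * y1" "Nxx * Nyy * y2 = B\<^sup>2 * y2"
      unfolding n by (simp_all add: power2_eq_square)
    moreover have "y1 \<noteq> 0 \<or> y2 \<noteq> 0" using that(2) by (auto simp: r_def)
    ultimately have "Nxx * Nyy = B\<^sup>2" by auto
    then show ?thesis by simp
  qed
  \<comment> \<open>Opposite signs of \<open>A\<close> and \<open>l\<close> put one of the two
    determinants into the form needed by \<open>squeeze\<close>. Equal signs force
    \<open>q = 0\<close>, hence \<open>Nxy = 0\<close>, and then \<open>Nxx\<close> and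
    \<open>Nyy\<close> have opposite strict signs, against \<open>NN\<close>.\<close>
  consider "0 \<le> A" "l \<le> 0" | "A \<le> 0" "0 \<le> l" | "0 < A" "0 < l" | "A < 0" "l < 0" by linarith
  then show False
  proof cases
    case 1
    then have s: "0 \<le> A0" "0 \<le> - l0" using sgn by (force simp: le_less)+
    have "x1 * y2 - x2 * y1 = 0 \<and> A0 * r = 0 \<and> p * (- l0) = 0"
      using squeeze[of A0 "- l0"] det0 s by simp
    then show False using mixed ab by (auto simp: A0_def l0_def)
  next
    case 2
    then have s: "0 \<le> - A3" "0 \<le> l3" using sgn by (force simp: le_less)+
    have "x1 * y2 - x2 * y1 = 0 \<and> (- A3) * r = 0 \<and> p * l3 = 0"
      using squeeze[of "- A3" l3] det3 s by simp
    then show False using mixed ab by (auto simp: A3_def l3_def)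
  next
    case 3
    then have s: "0 < p + A0" "0 < r + l3" using sgn pos by (smt (verit))+
    have 1: "0 \<le> q * (x0 * y0)" "0 \<le> q * (x3 * y3)"
      using proportional_sign[OF s(1) e(1)] proportional_sign[OF s(2) e(4)] by (simp_all add: mult.commute)
    then have q: "q = 0" by (rule q0)
    then have z: "y0 = 0" "x3 = 0" using e s by auto
    with neg have nz: "x0 \<noteq> 0" "y3 \<noteq> 0" by auto
    then have r: "r = l0" using e(2) q by simp
    have "Nxx = - (y3\<^sup>2 / (c - b) + l / b)" "Nyy = 1 + A + x0\<^sup>2 / (b - a)"
      by (simp_all add: Nxx_def Nyy_def z)
    moreover have "0 < y3\<^sup>2 / (c - b) + l / b" "0 < 1 + A + x0\<^sup>2 / (b - a)"
      using 3 ab by (simp_all add: add_nonneg_pos add_pos_nonneg)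
    ultimately have "Nxx * Nyy < 0" by (simp add: mult_neg_pos)
    moreover have "0 \<le> Nxx * Nyy"
      by (rule NN) (use sgn(5) 3 r z in \<open>auto simp: Nxy_def\<close>)
    ultimately show False by simp
  next
    case 4
    then have s: "0 < r - l0" "0 < p - A3" using sgn pos by (smt (verit))+
    have 1: "0 \<le> q * (x0 * y0)" "0 \<le> q * (x3 * y3)"
      using proportional_sign[OF s(1) e(2)] proportional_sign[OF s(2) e(3)] by (simp_all add: mult.commute)
    then have q: "q = 0" by (rule q0)
    then have z: "x0 = 0" "y3 = 0" using e s by auto
    with neg have nz: "y0 \<noteq> 0" "x3 \<noteq> 0" by auto
    then have r: "r = - l3" and p: "p = - A0" using e(1,4) q by simp_all
    have p0: "0 < p" using p sgn(3) 4 by simp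
    \<comment> \<open>The first constraint determines the square of \<open>x3\<close> by
      \<open>p\<close>, and \<open>p = - A0\<close> determines \<open>A\<close> by \<open>p\<close>.
      Thus \<open>Nyy\<close> becomes an expression in \<open>p\<close> alone, negative since
      \<open>p / b < p / (b - a)\<close> and \<open>p \<le> b\<close>.\<close>
    have x3: "x3\<^sup>2 = c * (1 - p / b)" using m1 z ab by (simp add: field_simps)
    have pb: "p / b \<le> 1" using m1 z ab by (smt (verit) divide_nonneg_pos zero_le_power2 zero_power2 div_0)
    have A: "A = - (p / (b - a))" using p ab by (simp add: A0_def)
    have "1 - x3\<^sup>2 / (c - b) = p / b - (b / (c - b)) * (1 - p / b)"
      unfolding x3 using ab by (simp add: field_simps)
    then have "Nyy = p / b - p / (b - a) - (b / (c - b)) * (1 - p / b)"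
      by (simp add: Nyy_def z A)
    moreover have "p / b < p / (b - a)" using p0 ab by (intro divide_strict_left_mono) auto
    moreover have "0 \<le> (b / (c - b)) * (1 - p / b)" using pb ab by simp
    ultimately have "Nyy < 0" by linarith
    moreover have "0 < Nxx"
      using 4 ab z by (simp add: Nxx_def divide_neg_pos add_nonneg_pos less_le_trans[of _ 0])
    ultimately have "Nxx * Nyy < 0" by (simp add: mult_pos_neg)
    moreover have "0 \<le> Nxx * Nyy"
      by (rule NN) (use sgn(8) 4 r z in \<open>auto simp: Nxy_def\<close>)
    ultimately show False by simp
  qed
qed

text \<open>The equations for the multiple of \<open>upper_curve \<alpha> H J - G\<close> or \<open>lower_curve \<alpha> H J - G\<close> that vanishes
  to second order on \<open>x\<^sub>3 = y\<^sub>3 = 0\<close> or \<open>x\<^sub>0 = y\<^sub>0 = 0\<close>; here \<open>(a, x, y)\<close> belongs to the other index.\<close>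

lemma boundary_equations:
  fixes a b x y x1 x2 y1 y2 :: real
  defines "J \<equiv> x1 * y2 - x2 * y1"
  defines "A \<equiv> 2 * b / (b - a)" and "B \<equiv> - 2 * a * J / (b * (b - a))"
  defines "l \<equiv> B * J - 2 * ((x * y1 - x1 * y)\<^sup>2 + (x * y2 - x2 * y)\<^sup>2) / (b - a)"
  assumes ab: "a \<noteq> 0" "b \<noteq> 0" "a \<noteq> b"
    and m1: "x * x / a + (x1 * x1 + x2 * x2) / b = 1" and m2: "x * y / a + (x1 * y1 + x2 * y2) / b = 0"
  shows "A * y + 2 * (x1 * (x * y1 - x1 * y) + x2 * (x * y2 - x2 * y)) / (b - a) = 0"
    and "A * y1 - B * x2 - 2 * y1 - 2 * x * (x * y1 - x1 * y) / (b - a) = 0"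
    and "A * y2 + B * x1 - 2 * y2 - 2 * x * (x * y2 - x2 * y) / (b - a) = 0"
    and "- 2 * (y1 * (x * y1 - x1 * y) + y2 * (x * y2 - x2 * y)) / (b - a) = l * x / a"
    and "B * y2 + 2 * y * (x * y1 - x1 * y) / (b - a) = l * x1 / b"
    and "- B * y1 + 2 * y * (x * y2 - x2 * y) / (b - a) = l * x2 / b"
proof -
  define d p q r where "d = b - a" and "p = x1 * x1 + x2 * x2" and "q = x1 * y1 + x2 * y2"
    and "r = y1 * y1 + y2 * y2"
  define N where "N = x * x * r - 2 * x * y * q + y * y * p"
  note pqr = p_def q_def r_def
  have d: "d \<noteq> 0" using ab by (simp add: d_def)
  have clear: "(z / a + w / b) * (a * b) = b * z + a * w" for z w
    using ab by (simp add: field_simps)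
  have m: "b * x * x = a * b - a * p" "b * x * y = - a * q"
    using clear[of "x * x" p] clear[of "x * y" q] m1 m2 by (simp_all add: p_def[symmetric] q_def[symmetric])
  \<comment> \<open>Multiplying the two constraints so that \<open>x\<close> cancels as a square
    yields a relation between \<open>y\<close> and \<open>q\<close> without dividing by
    \<open>x\<close>, so it also holds at \<open>x = 0\<close>.\<close>
  have "a * (b * y * y * (b - p)) = (a * b - a * p) * b * y * y" by (simp add: algebra_simps)
  also have "\<dots> = (b * x * y) * (b * x * y)" unfolding m(1)[symmetric] by simp
  also have "\<dots> = a * (a * q * q)" unfolding m(2) by simp
  finally have "a * (b * y * y * (b - p)) = a * (a * q * q)" .
  then have K: "b * y * y * (b - p) = a * q * q" using ab(1) by simp
  have N: "(x * y1 - x1 * y)\<^sup>2 + (x * y2 - x2 * y)\<^sup>2 = N"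
    by (simp add: N_def pqr power2_eq_square algebra_simps)
  have JJ: "J * J = p * r - q * q" and Jx: "J * x2 = x1 * q - y1 * p" "J * x1 = y2 * p - x2 * q"
    and Jy: "J * y2 = x1 * r - y1 * q" "J * y1 = y2 * q - x2 * r"
    by (simp_all add: J_def pqr algebra_simps)
  have W: "x1 * (x * y1 - x1 * y) + x2 * (x * y2 - x2 * y) = x * q - y * p"
    "y1 * (x * y1 - x1 * y) + y2 * (x * y2 - x2 * y) = x * r - y * q"
    by (simp_all add: pqr algebra_simps)
  have bN: "b * N = (a * b - a * p) * r + 2 * a * q * q + b * y * y * p"
  proof -
    have "b * N = b * x * x * r - 2 * (b * x * y) * q + b * y * y * p" by (simp add: N_def algebra_simps)
    then show ?thesis unfolding m by simp
  qed
  have A: "A * d = 2 * b" and B: "B * (b * d) = - 2 * a * J"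
    using d ab by (simp_all add: A_def B_def d_def)
  have L: "l * (b * d) = - 2 * (a * (J * J) + b * N)"
  proof -
    have "l = B * J - 2 * N / d" unfolding l_def N d_def ..
    then have "l * (b * d) = B * (b * d) * J - 2 * b * N"
      using d by (simp add: left_diff_distrib)
    then show ?thesis unfolding B by (simp add: algebra_simps)
  qed
  \<comment> \<open>Each equation is verified after clearing its denominator; the last two need one
    more factor \<open>b\<close> because of \<open>l * x1 / b\<close> and
    \<open>l * x2 / b\<close>.\<close>
  have cancel: "z = 0" if "z * (b * d) = 0" for z using that d ab by simp
  have cancel': "z = w" if "z * (b * b * d) = w * (b * b * d)" for z w using that d ab by simp
  note dd = d_def[symmetric]
  have "(A * y + 2 * (x * q - y * p) / d) * (b * d) = b * (A * d * y + 2 * (x * q - y * p))"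
    using d by (simp add: field_simps)
  also have "\<dots> = 2 * (b * y * (b - p) + b * x * q)" unfolding A by (simp add: algebra_simps)
  also have "\<dots> = 0"
  proof -
    \<comment> \<open>The factor \<open>a\<close> makes the first constraint applicable; it is
      cancelled at the end.\<close>
    have "a * (b * y * (b - p) + b * x * q) = (b * x * x) * (b * y) + a * b * x * q"
      unfolding m by (simp add: algebra_simps)
    also have "\<dots> = b * x * (b * x * y) + a * b * x * q" by simp
    also have "\<dots> = 0" unfolding m by simp
    finally show ?thesis using ab by simp
  qed
  finally show "A * y + 2 * (x1 * (x * y1 - x1 * y) + x2 * (x * y2 - x2 * y)) / (b - a) = 0"
    unfolding W dd by (rule cancel)
  have "(A * y1 - B * x2 - 2 * y1 - 2 * x * (x * y1 - x1 * y) / d) * (b * d)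
      = b * (A * d) * y1 - B * (b * d) * x2 - 2 * b * d * y1 - 2 * (b * x * x) * y1 + 2 * (b * x * y) * x1"
    using d by (simp add: field_simps)
  also have "\<dots> = 2 * a * (J * x2 + p * y1 - q * x1)"
    unfolding A B m by (simp add: d_def algebra_simps)
  also have "\<dots> = 0" unfolding Jx by simp
  finally show "A * y1 - B * x2 - 2 * y1 - 2 * x * (x * y1 - x1 * y) / (b - a) = 0"
    unfolding dd by (rule cancel)
  have "(A * y2 + B * x1 - 2 * y2 - 2 * x * (x * y2 - x2 * y) / d) * (b * d)
      = b * (A * d) * y2 + B * (b * d) * x1 - 2 * b * d * y2 - 2 * (b * x * x) * y2 + 2 * (b * x * y) * x2"
    using d by (simp add: field_simps)
  also have "\<dots> = 2 * a * (p * y2 - q * x2 - J * x1)"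
    unfolding A B m by (simp add: d_def algebra_simps)
  also have "\<dots> = 0" unfolding Jx by simp
  finally show "A * y2 + B * x1 - 2 * y2 - 2 * x * (x * y2 - x2 * y) / (b - a) = 0"
    unfolding dd by (rule cancel)
  have S: "a * (J * J) + b * N = a * b * r + a * q * q + b * y * y * p"
    unfolding JJ bN by (simp add: algebra_simps)
  have "x * (a * (J * J) + b * N) = a * b * (x * r - y * q)"
  proof -
    have "x * (a * (J * J) + b * N) = a * b * x * r + q * a * q * x + (b * x * y) * y * p"
      unfolding S by (simp add: algebra_simps)
    also have "\<dots> = a * b * x * r + q * (a * q * x - a * p * y)" unfolding m by (simp add: algebra_simps)
    also have "a * q * x - a * p * y = - (b * x * y) * x - a * p * y" unfolding m by simp
    also have "\<dots> = - (b * x * x) * y - a * p * y" by simp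
    also have "\<dots> = - a * b * y" unfolding m by (simp add: algebra_simps)
    finally show ?thesis by (simp add: algebra_simps)
  qed
  then have "l * (b * d) * x = - 2 * a * b * (x * r - y * q)"
    unfolding L by (simp add: algebra_simps)
  then have "b * (l * x * d) = b * (- 2 * a * (x * r - y * q))" by (simp add: algebra_simps)
  then have "l * x * d = - 2 * a * (x * r - y * q)" using ab(2) by (metis mult_left_cancel)
  then show "- 2 * (y1 * (x * y1 - x1 * y) + y2 * (x * y2 - x2 * y)) / (b - a) = l * x / a"
    unfolding W dd using d ab by (simp add: field_simps)
  have S1: "b * (b * y * y) + a * b * r = a * (J * J) + b * N"
    unfolding S using K by (simp add: algebra_simps)
  have "(B * y2 + 2 * y * (x * y1 - x1 * y) / d) * (b * b * d)
      = b * (B * (b * d)) * y2 + 2 * b * (b * x * y) * y1 - 2 * (b * (b * y * y)) * x1"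
    using d by (simp add: field_simps)
  also have "\<dots> = - 2 * (b * a * (J * y2) + a * b * q * y1 + b * (b * y * y) * x1)"
    unfolding B m by (simp add: algebra_simps)
  also have "\<dots> = - 2 * (b * (b * y * y) + a * b * r) * x1"
    unfolding Jy by (simp add: algebra_simps)
  also have "\<dots> = l * (b * d) * x1" unfolding S1 L ..
  also have "\<dots> = l * x1 / b * (b * b * d)" using ab by simp
  finally show "B * y2 + 2 * y * (x * y1 - x1 * y) / (b - a) = l * x1 / b"
    unfolding dd by (rule cancel')
  have "(- B * y1 + 2 * y * (x * y2 - x2 * y) / d) * (b * b * d)
      = - b * (B * (b * d)) * y1 + 2 * b * (b * x * y) * y2 - 2 * (b * (b * y * y)) * x2"
    using d by (simp add: field_simps)
  also have "\<dots> = 2 * (b * a * (J * y1) - a * b * q * y2 - b * (b * y * y) * x2)"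
    unfolding B m by (simp add: algebra_simps)
  also have "\<dots> = - 2 * (b * (b * y * y) + a * b * r) * x2"
    unfolding Jy by (simp add: algebra_simps)
  also have "\<dots> = l * (b * d) * x2" unfolding S1 L ..
  also have "\<dots> = l * x2 / b * (b * b * d)" using ab by simp
  finally show "- B * y1 + 2 * y * (x * y2 - x2 * y) / (b - a) = l * x2 / b"
    unfolding dd by (rule cancel')
qed


section \<open>The strata of the critical set and their vanishing combinations\<close>

definition off_axis :: "phase \<Rightarrow> 4 \<Rightarrow> bool" where
  "off_axis p i \<longleftrightarrow> fst p $ i = 0 \<and> snd p $ i = 0"

text \<open>Coefficients of the differential at \<open>p\<close> of
  \<open>upper_curve \<alpha> H J - G\<close> for \<open>m = 0\<close> and of
  \<open>lower_curve \<alpha> H J - G\<close> for \<open>m = 3\<close>; differentiating the square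
  of \<open>J\<close> gives the factor \<open>2 * Jfun p\<close>.\<close>

definition boundary_comb :: "real^4 \<Rightarrow> 4 \<Rightarrow> phase \<Rightarrow> real \<times> real \<times> real" where
  "boundary_comb \<alpha> m p =
     (2 * \<alpha> $ 1 / (\<alpha> $ 1 - \<alpha> $ m), - 2 * \<alpha> $ m * Jfun p / (\<alpha> $ 1 * (\<alpha> $ 1 - \<alpha> $ m)), - 1)"

context ellipsoid
begin

lemma M_eqs:
  assumes "p \<in> M \<alpha>"
  shows "(fst p $ 0)\<^sup>2 / \<alpha> $ 0 + ((fst p $ 1)\<^sup>2 + (fst p $ 2)\<^sup>2) / \<alpha> $ 1 + (fst p $ 3)\<^sup>2 / \<alpha> $ 3 = 1"
    and "fst p $ 0 * snd p $ 0 / \<alpha> $ 0 + (fst p $ 1 * snd p $ 1 + fst p $ 2 * snd p $ 2) / \<alpha> $ 1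
      + fst p $ 3 * snd p $ 3 / \<alpha> $ 3 = 0"
  using assms \<alpha>12 by (simp_all add: M_def C1_def C2_def sum_UNIV_4 add_divide_distrib add.assoc split: prod.splits)

lemma vanishing_combsI:
  assumes p: "p \<in> M \<alpha>" and y: "snd p \<noteq> 0" and "grad_y \<alpha> c p = 0" and g: "grad_x \<alpha> c p = l *\<^sub>R wt \<alpha> (fst p)"
  shows "c \<in> vanishing_combs \<alpha> p" and "fst p \<bullet> grad_x \<alpha> c p = l"
proof -
  show l: "fst p \<bullet> grad_x \<alpha> c p = l" using p unfolding g by (simp add: M_iff)
  show "c \<in> vanishing_combs \<alpha> p" using vanishing_combs_iff[OF p y] assms(3) g l by simp
qed

lemma vanishing_combs_nth:
  assumes p: "p \<in> M \<alpha>" and y: "snd p \<noteq> 0" and c: "c \<in> vanishing_combs \<alpha> p"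
  shows "grad_y \<alpha> c p $ i = 0"
    and "grad_x \<alpha> c p $ i = (fst p \<bullet> grad_x \<alpha> c p) * fst p $ i / \<alpha> $ i"
proof -
  have *: "grad_y \<alpha> c p = 0" "grad_x \<alpha> c p = (fst p \<bullet> grad_x \<alpha> c p) *\<^sub>R wt \<alpha> (fst p)"
    using vanishing_combs_iff[OF p y] c by auto
  show "grad_y \<alpha> c p $ i = 0" by (simp add: *(1))
  show "grad_x \<alpha> c p $ i = (fst p \<bullet> grad_x \<alpha> c p) * fst p $ i / \<alpha> $ i"
    by (subst *(2)) simp
qed

text \<open>If \<open>a = 0\<close>, the point is fixed by the rotation that \<open>J\<close>
  generates. If \<open>a\<close> is nonzero, the geodesic is an orbit of that rotation with nonzero
  velocity, so it runs along the equator.\<close>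

lemma vanishing_comb_H_J:
  assumes p: "p \<in> M \<alpha>" and h: "0 < Hfun p" and c: "(a, b, 0) \<in> vanishing_combs \<alpha> p" "a \<noteq> 0 \<or> b \<noteq> 0"
  shows "off_axis p 1 \<and> off_axis p 2 \<or> off_axis p 0 \<and> off_axis p 3"
proof -
  note y = nonzero_of_Hfun_pos[OF h]
  obtain x z where pe: "p = (x, z)" by (cases p)
  define l where "l = x \<bullet> grad_x \<alpha> (a, b, 0) p"
  note v = vanishing_combs_nth[OF p y c(1)]
  have ky: "a * z $ 0 = 0" "a * z $ 1 - b * x $ 2 = 0" "a * z $ 2 + b * x $ 1 = 0" "a * z $ 3 = 0"
    using v(1)[of 0] v(1)[of 1] v(1)[of 2] v(1)[of 3] by (simp_all add: pe grad_y_def)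
  have kx: "l * x $ 0 = 0" "b * z $ 2 = l * x $ 1 / \<alpha> $ 1" "- b * z $ 1 = l * x $ 2 / \<alpha> $ 2" "l * x $ 3 = 0"
    using v(2)[of 0] v(2)[of 1] v(2)[of 2] v(2)[of 3] \<alpha>_pos[of 0] \<alpha>_pos[of 3]
    by (simp_all add: pe grad_x_def l_def)
  have z: "z \<noteq> 0" using y by (simp add: pe)
  show ?thesis
  proof (cases "a = 0")
    case True
    with c(2) have b: "b \<noteq> 0" by simp
    with ky True have x12: "x $ 1 = 0" "x $ 2 = 0" by auto
    then have "z $ 1 = 0" "z $ 2 = 0" using kx b by auto
    with x12 show ?thesis by (simp add: off_axis_def pe)
  next
    case False
    with ky have z03: "z $ 0 = 0" "z $ 3 = 0" by auto
    have "l \<noteq> 0"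
    proof
      assume "l = 0"
      then have "b * z $ 1 = 0" "b * z $ 2 = 0" using kx by auto
      moreover have "b = 0 \<Longrightarrow> z $ 1 = 0 \<and> z $ 2 = 0" using ky False by auto
      ultimately have "z $ 1 = 0" "z $ 2 = 0" by auto
      with z03 z show False by (auto simp: cart_eq_iff all_index_4)
    qed
    with kx z03 show ?thesis by (simp add: off_axis_def pe)
  qed
qed

lemma critical_cases:
  assumes p: "p \<in> M \<alpha>" and h: "0 < Hfun p" and c: "c \<in> vanishing_combs \<alpha> p" "c \<noteq> 0"
  shows "off_axis p 0 \<or> off_axis p 3 \<or> off_axis p 1 \<and> off_axis p 2"
proof -
  note y = nonzero_of_Hfun_pos[OF h]
  obtain a0 b0 d where c0: "c = (a0, b0, d)" by (metis surj_pair)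
  show ?thesis
  proof (cases "d = 0")
    case True
    then show ?thesis using vanishing_comb_H_J[OF p h, of a0 b0] c c0 by (auto simp: zero_prod_def)
  next
    case False
    \<comment> \<open>Dividing by \<open>d\<close> gives \<open>G\<close> the coefficient one; the
      halves absorb the common factor 2 in the gradient of \<open>G\<close>.\<close>
    define A B where "A = a0 / d / 2" and "B = b0 / d / 2"
    have "inverse d *\<^sub>R c \<in> vanishing_combs \<alpha> p"
      using c(1) subspace_scale[OF subspace_vanishing_combs] by blast
    moreover have "inverse d *\<^sub>R c = (2 * A, 2 * B, 1)"
      using False by (simp add: c0 A_def B_def field_simps)
    ultimately have c1: "(2 * A, 2 * B, 1) \<in> vanishing_combs \<alpha> p" by simp
    obtain x z where pe: "p = (x, z)" by (cases p)
    define l where "l = (x \<bullet> grad_x \<alpha> (2 * A, 2 * B, 1) p) / 2"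
    note v = vanishing_combs_nth[OF p y c1]
    have ne: "\<alpha> $ 1 - \<alpha> $ 0 \<noteq> 0" "\<alpha> $ 1 - \<alpha> $ 3 \<noteq> 0" "\<alpha> $ 3 - \<alpha> $ 1 \<noteq> 0" "\<alpha> $ 0 \<noteq> 0" "\<alpha> $ 3 \<noteq> 0" "\<alpha> $ 1 \<noteq> 0"
      using \<alpha>01 \<alpha>12 \<alpha>23 \<alpha>0 by auto
    have flip: "u / (\<alpha> $ 1 - \<alpha> $ 3) = - u / (\<alpha> $ 3 - \<alpha> $ 1)" for u
      by (metis minus_diff_eq minus_divide_divide minus_minus)
    have H2: "2 * Hfun p = (z $ 0)\<^sup>2 + ((z $ 1)\<^sup>2 + (z $ 2)\<^sup>2) + (z $ 3)\<^sup>2"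
      by (simp add: Hfun_def pe)
    have l2: "fst p \<bullet> grad_x \<alpha> (2 * A, 2 * B, 1) p = 2 * l" by (simp add: l_def pe)
    note v2 = v(2)[unfolded l2]
    from l2 have euler1: "l = B * Jfun p + Gfun \<alpha> p - (z $ 1)\<^sup>2 - (z $ 2)\<^sup>2"
      using inner_fst_grad_x[of p \<alpha> "2 * A" "2 * B" 1] by (simp add: pe)
    have "grad_y \<alpha> (2 * A, 2 * B, 1) p = 0" using v(1) by (simp add: cart_eq_iff)
    then have euler2: "2 * A * Hfun p + B * Jfun p + Gfun \<alpha> p = 0"
      using inner_snd_grad_y[of p \<alpha> "2 * A" "2 * B" 1] by simp
    have "x $ 0 = 0 \<and> z $ 0 = 0 \<or> x $ 3 = 0 \<and> z $ 3 = 0 \<or> (x $ 1)\<^sup>2 + (x $ 2)\<^sup>2 = 0 \<and> (z $ 1)\<^sup>2 + (z $ 2)\<^sup>2 = 0"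
    proof (rule critical_equations[where a = "\<alpha> $ 0" and b = "\<alpha> $ 1" and c = "\<alpha> $ 3" and A = A and B = B and l = l])
      show "0 < \<alpha> $ 0" "\<alpha> $ 0 < \<alpha> $ 1" "\<alpha> $ 1 < \<alpha> $ 3" using \<alpha>0 \<alpha>01 \<alpha>12 \<alpha>23 by auto
      show "((x $ 1)\<^sup>2 + (x $ 2)\<^sup>2 + A * (\<alpha> $ 1 - \<alpha> $ 0)) * z $ 0 = (x $ 1 * z $ 1 + x $ 2 * z $ 2) * x $ 0"
        using v(1)[of 0] ne by (simp add: pe grad_y_def power2_eq_square field_simps)
      show "((z $ 1)\<^sup>2 + (z $ 2)\<^sup>2 - l * (\<alpha> $ 1 - \<alpha> $ 0) / \<alpha> $ 0) * x $ 0 = (x $ 1 * z $ 1 + x $ 2 * z $ 2) * z $ 0"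
        using v2[of 0] ne by (simp add: pe grad_x_def power2_eq_square field_simps)
      show "((x $ 1)\<^sup>2 + (x $ 2)\<^sup>2 - A * (\<alpha> $ 3 - \<alpha> $ 1)) * z $ 3 = (x $ 1 * z $ 1 + x $ 2 * z $ 2) * x $ 3"
        using v(1)[of 3] ne by (simp add: pe grad_y_def power2_eq_square field_simps)
      show "((z $ 1)\<^sup>2 + (z $ 2)\<^sup>2 + l * (\<alpha> $ 3 - \<alpha> $ 1) / \<alpha> $ 3) * x $ 3 = (x $ 1 * z $ 1 + x $ 2 * z $ 2) * z $ 3"
        using v2[of 3] ne by (simp add: pe grad_x_def power2_eq_square field_simps)
      show "((z $ 0)\<^sup>2 / (\<alpha> $ 1 - \<alpha> $ 0) - (z $ 3)\<^sup>2 / (\<alpha> $ 3 - \<alpha> $ 1) - l / \<alpha> $ 1) * x $ 1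
          + (x $ 3 * z $ 3 / (\<alpha> $ 3 - \<alpha> $ 1) - x $ 0 * z $ 0 / (\<alpha> $ 1 - \<alpha> $ 0)) * z $ 1 = - B * z $ 2"
        by (rule double_cancel) (use v2[of 1] in \<open>simp add: pe grad_x_def flip power2_eq_square algebra_simps add_divide_distrib diff_divide_distrib\<close>)
      show "((z $ 0)\<^sup>2 / (\<alpha> $ 1 - \<alpha> $ 0) - (z $ 3)\<^sup>2 / (\<alpha> $ 3 - \<alpha> $ 1) - l / \<alpha> $ 1) * x $ 2
          + (x $ 3 * z $ 3 / (\<alpha> $ 3 - \<alpha> $ 1) - x $ 0 * z $ 0 / (\<alpha> $ 1 - \<alpha> $ 0)) * z $ 2 = B * z $ 1"
        by (rule double_cancel) (use v2[of 2] in \<open>simp add: pe \<alpha>12[symmetric] grad_x_def flip power2_eq_square algebra_simps add_divide_distrib diff_divide_distrib\<close>)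
      show "(x $ 3 * z $ 3 / (\<alpha> $ 3 - \<alpha> $ 1) - x $ 0 * z $ 0 / (\<alpha> $ 1 - \<alpha> $ 0)) * x $ 1
          + (1 + A + (x $ 0)\<^sup>2 / (\<alpha> $ 1 - \<alpha> $ 0) - (x $ 3)\<^sup>2 / (\<alpha> $ 3 - \<alpha> $ 1)) * z $ 1 = B * x $ 2"
        by (rule double_cancel) (use v(1)[of 1] in \<open>simp add: pe grad_y_def flip power2_eq_square algebra_simps add_divide_distrib diff_divide_distrib\<close>)
      show "(x $ 3 * z $ 3 / (\<alpha> $ 3 - \<alpha> $ 1) - x $ 0 * z $ 0 / (\<alpha> $ 1 - \<alpha> $ 0)) * x $ 2
          + (1 + A + (x $ 0)\<^sup>2 / (\<alpha> $ 1 - \<alpha> $ 0) - (x $ 3)\<^sup>2 / (\<alpha> $ 3 - \<alpha> $ 1)) * z $ 2 = - B * x $ 1"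
        by (rule double_cancel) (use v(1)[of 2] in \<open>simp add: pe grad_y_def flip power2_eq_square algebra_simps add_divide_distrib diff_divide_distrib\<close>)
      show "(x $ 0)\<^sup>2 / \<alpha> $ 0 + ((x $ 1)\<^sup>2 + (x $ 2)\<^sup>2) / \<alpha> $ 1 + (x $ 3)\<^sup>2 / \<alpha> $ 3 = 1"
        "x $ 0 * z $ 0 / \<alpha> $ 0 + (x $ 1 * z $ 1 + x $ 2 * z $ 2) / \<alpha> $ 1 + x $ 3 * z $ 3 / \<alpha> $ 3 = 0"
        using M_eqs[OF p] by (simp_all add: pe)
      show "0 < (z $ 0)\<^sup>2 + ((z $ 1)\<^sup>2 + (z $ 2)\<^sup>2) + (z $ 3)\<^sup>2" using h H2 by simp
      show "A * ((z $ 0)\<^sup>2 + ((z $ 1)\<^sup>2 + (z $ 2)\<^sup>2) + (z $ 3)\<^sup>2) + l + ((z $ 1)\<^sup>2 + (z $ 2)\<^sup>2) = 0"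
        if "x $ 1 * z $ 2 - x $ 2 * z $ 1 = 0"
        using euler1 euler2 unfolding H2[symmetric] by simp
    qed
    then show ?thesis by (auto simp: off_axis_def pe)
  qed
qed

text \<open>The indices cross over: on the stratum where coordinate pair 3 vanishes, the
  coefficients involve only the remaining axes 0 and 1, and conversely.\<close>

lemma boundary_comb_vanishing:
  assumes p: "p \<in> M \<alpha>" and y: "snd p \<noteq> 0"
  shows "off_axis p 3 \<Longrightarrow> boundary_comb \<alpha> 0 p \<in> vanishing_combs \<alpha> p"
    and "off_axis p 0 \<Longrightarrow> boundary_comb \<alpha> 3 p \<in> vanishing_combs \<alpha> p"
proof -
  obtain x z where pe: "p = (x, z)" by (cases p)
  have ne: "\<alpha> $ 0 \<noteq> 0" "\<alpha> $ 3 \<noteq> 0" "\<alpha> $ 1 \<noteq> 0" "\<alpha> $ 0 \<noteq> \<alpha> $ 1" "\<alpha> $ 3 \<noteq> \<alpha> $ 1"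
    using \<alpha>01 \<alpha>12 \<alpha>23 \<alpha>0 by auto
  note m = M_eqs[OF p, unfolded pe fst_conv snd_conv power2_eq_square]
  show "boundary_comb \<alpha> 0 p \<in> vanishing_combs \<alpha> p" if "off_axis p 3"
  proof -
    have o: "x $ 3 = 0" "z $ 3 = 0" using that by (simp_all add: off_axis_def pe)
    note b = boundary_equations[of "\<alpha> $ 0" "\<alpha> $ 1" "x $ 0" "x $ 1" "x $ 2" "z $ 0" "z $ 1" "z $ 2"]
    have m': "x $ 0 * x $ 0 / \<alpha> $ 0 + (x $ 1 * x $ 1 + x $ 2 * x $ 2) / \<alpha> $ 1 = 1"
      "x $ 0 * z $ 0 / \<alpha> $ 0 + (x $ 1 * z $ 1 + x $ 2 * z $ 2) / \<alpha> $ 1 = 0"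
      using m o by simp_all
    note b = b[OF ne(1,3,4) m']
    have gy: "grad_y \<alpha> (boundary_comb \<alpha> 0 p) p = 0"
    proof -
      have "grad_y \<alpha> (boundary_comb \<alpha> 0 p) p $ 0 = 0"
        by (rule trans[OF _ b(1)]) (simp add: boundary_comb_def grad_y_def pe o Jfun_def,
            simp add: algebra_simps add_divide_distrib diff_divide_distrib)
      moreover
      have "grad_y \<alpha> (boundary_comb \<alpha> 0 p) p $ 1 = 0"
        by (rule trans[OF _ b(2)]) (simp add: boundary_comb_def grad_y_def pe o Jfun_def)
      moreover
      have "grad_y \<alpha> (boundary_comb \<alpha> 0 p) p $ 2 = 0"
        by (rule trans[OF _ b(3)]) (simp add: boundary_comb_def grad_y_def pe o Jfun_def)
      moreover have "grad_y \<alpha> (boundary_comb \<alpha> 0 p) p $ 3 = 0"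
        by (simp add: boundary_comb_def grad_y_def pe o)
      ultimately show ?thesis by (simp add: cart_eq_iff all_index_4)
    qed
    have gx: "grad_x \<alpha> (boundary_comb \<alpha> 0 p) p = l *\<^sub>R wt \<alpha> (fst p)"
      if "l = - 2 * \<alpha> $ 0 * (x $ 1 * z $ 2 - x $ 2 * z $ 1) / (\<alpha> $ 1 * (\<alpha> $ 1 - \<alpha> $ 0)) * (x $ 1 * z $ 2 - x $ 2 * z $ 1)
        - 2 * ((x $ 0 * z $ 1 - x $ 1 * z $ 0)\<^sup>2 + (x $ 0 * z $ 2 - x $ 2 * z $ 0)\<^sup>2) / (\<alpha> $ 1 - \<alpha> $ 0)" for l
      using b(4-6)[folded that]
      by (simp add: cart_eq_iff all_index_4 boundary_comb_def grad_x_def pe o Jfun_def \<alpha>12)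
    show ?thesis by (rule vanishing_combsI(1)[OF p y gy gx[OF refl]])
  qed
  show "boundary_comb \<alpha> 3 p \<in> vanishing_combs \<alpha> p" if "off_axis p 0"
  proof -
    have o: "x $ 0 = 0" "z $ 0 = 0" using that by (simp_all add: off_axis_def pe)
    note b = boundary_equations[of "\<alpha> $ 3" "\<alpha> $ 1" "x $ 3" "x $ 1" "x $ 2" "z $ 3" "z $ 1" "z $ 2"]
    have m': "x $ 3 * x $ 3 / \<alpha> $ 3 + (x $ 1 * x $ 1 + x $ 2 * x $ 2) / \<alpha> $ 1 = 1"
      "x $ 3 * z $ 3 / \<alpha> $ 3 + (x $ 1 * z $ 1 + x $ 2 * z $ 2) / \<alpha> $ 1 = 0"
      using m o by (simp_all add: add.commute)
    note b = b[OF ne(2,3,5) m']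
    have gy: "grad_y \<alpha> (boundary_comb \<alpha> 3 p) p = 0"
    proof -
      have "grad_y \<alpha> (boundary_comb \<alpha> 3 p) p $ 3 = 0"
        by (rule trans[OF _ b(1)]) (simp add: boundary_comb_def grad_y_def pe o Jfun_def,
            simp add: algebra_simps add_divide_distrib diff_divide_distrib)
      moreover
      have "grad_y \<alpha> (boundary_comb \<alpha> 3 p) p $ 1 = 0"
        by (rule trans[OF _ b(2)]) (simp add: boundary_comb_def grad_y_def pe o Jfun_def,
            simp add: algebra_simps add_divide_distrib diff_divide_distrib)
      moreover
      have "grad_y \<alpha> (boundary_comb \<alpha> 3 p) p $ 2 = 0"
        by (rule trans[OF _ b(3)]) (simp add: boundary_comb_def grad_y_def pe o Jfun_def,
            simp add: algebra_simps add_divide_distrib diff_divide_distrib)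
      moreover have "grad_y \<alpha> (boundary_comb \<alpha> 3 p) p $ 0 = 0"
        by (simp add: boundary_comb_def grad_y_def pe o)
      ultimately show ?thesis by (simp add: cart_eq_iff all_index_4)
    qed
    have gx: "grad_x \<alpha> (boundary_comb \<alpha> 3 p) p = l *\<^sub>R wt \<alpha> (fst p)"
      if "l = - 2 * \<alpha> $ 3 * (x $ 1 * z $ 2 - x $ 2 * z $ 1) / (\<alpha> $ 1 * (\<alpha> $ 1 - \<alpha> $ 3)) * (x $ 1 * z $ 2 - x $ 2 * z $ 1)
        - 2 * ((x $ 3 * z $ 1 - x $ 1 * z $ 3)\<^sup>2 + (x $ 3 * z $ 2 - x $ 2 * z $ 3)\<^sup>2) / (\<alpha> $ 1 - \<alpha> $ 3)" for l
      using b(4-6)[folded that]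
      by (simp add: cart_eq_iff all_index_4 boundary_comb_def grad_x_def pe o Jfun_def \<alpha>12)
        (simp add: algebra_simps add_divide_distrib diff_divide_distrib)
    show ?thesis by (rule vanishing_combsI(1)[OF p y gy gx[OF refl]])
  qed
qed

text \<open>Otherwise \<open>x\<close> lies on a single coordinate axis with nonzero coordinate, and
  \<open>C2\<close> forces the remaining component of \<open>y\<close> to vanish, contradicting
  positive energy.\<close>

lemma not_all_off_axis:
  assumes p: "p \<in> M \<alpha>" and h: "0 < Hfun p" and "off_axis p 1" "off_axis p 2"
  shows "\<not> off_axis p 0" "\<not> off_axis p 3"
  using M_eqs[OF p] h assms(3,4) \<alpha>_pos[of 0] \<alpha>_pos[of 3]
  by (auto simp: off_axis_def Hfun_def split: prod.splits)

lemma vanishing_combs_boundary: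
  assumes p: "p \<in> M \<alpha>" and h: "0 < Hfun p"
  shows "off_axis p 3 \<Longrightarrow> \<not> off_axis p 0 \<Longrightarrow> vanishing_combs \<alpha> p = span {boundary_comb \<alpha> 0 p}"
    and "off_axis p 0 \<Longrightarrow> \<not> off_axis p 3 \<Longrightarrow> vanishing_combs \<alpha> p = span {boundary_comb \<alpha> 3 p}"
proof -
  note y = nonzero_of_Hfun_pos[OF h]
  have *: "vanishing_combs \<alpha> p = span {v}"
    if v: "v \<in> vanishing_combs \<alpha> p" "snd (snd v) = - 1" and n: "\<not> (off_axis p 0 \<and> off_axis p 3)"
      "off_axis p 0 \<or> off_axis p 3" for v
  proof
    show "span {v} \<subseteq> vanishing_combs \<alpha> p"
      using v(1) subspace_vanishing_combs by (intro span_minimal) auto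
    show "vanishing_combs \<alpha> p \<subseteq> span {v}"
    proof
      fix c assume c: "c \<in> vanishing_combs \<alpha> p"
      \<comment> \<open>The \<open>G\<close> coefficient of \<open>v\<close> is -1, so
        \<open>w\<close> combines \<open>H\<close> and \<open>J\<close> only. Such a combination
        vanishes nontrivially only on the equator or where pairs 1 and 2 vanish, and both are
        excluded here.\<close>
      define w where "w = c + snd (snd c) *\<^sub>R v"
      have w: "w \<in> vanishing_combs \<alpha> p"
        unfolding w_def using c v(1) subspace_vanishing_combs by (simp add: subspace_add subspace_scale)
      have we: "w = (fst w, fst (snd w), 0)" using v(2) by (simp add: w_def prod_eq_iff)
      then have "fst w = 0 \<and> fst (snd w) = 0"
        using vanishing_comb_H_J[OF p h, of "fst w" "fst (snd w)"] w we n not_all_off_axis[OF p h] by auto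
      then have "w = 0" using we by (simp add: prod_eq_iff)
      then have "c = (- snd (snd c)) *\<^sub>R v" by (simp add: w_def add_eq_0_iff2)
      then show "c \<in> span {v}" by (metis span_base span_scale singletonI)
    qed
  qed
  show "off_axis p 3 \<Longrightarrow> \<not> off_axis p 0 \<Longrightarrow> vanishing_combs \<alpha> p = span {boundary_comb \<alpha> 0 p}"
    by (rule *) (auto simp: boundary_comb_vanishing[OF p y], simp add: boundary_comb_def)
  show "off_axis p 0 \<Longrightarrow> \<not> off_axis p 3 \<Longrightarrow> vanishing_combs \<alpha> p = span {boundary_comb \<alpha> 3 p}"
    by (rule *) (auto simp: boundary_comb_vanishing[OF p y], simp add: boundary_comb_def)
qed

text \<open>\<open>J\<close> and \<open>G\<close> are quadratic in the coordinates with indices 1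
  and 2, all zero here, so their differentials vanish, while that of \<open>H\<close> does
  not.\<close>

lemma vanishing_combs_meridian:
  assumes p: "p \<in> M \<alpha>" and h: "0 < Hfun p" and o: "off_axis p 1" "off_axis p 2"
  shows "vanishing_combs \<alpha> p = {c. (1, 0, 0) \<bullet> c = 0}"
proof -
  note y = nonzero_of_Hfun_pos[OF h]
  obtain x z where pe: "p = (x, z)" by (cases p)
  have o': "x $ 1 = 0" "x $ 2 = 0" "z $ 1 = 0" "z $ 2 = 0" using o by (simp_all add: off_axis_def pe)
  have "(a, b, d) \<in> vanishing_combs \<alpha> p \<longleftrightarrow> a = 0" for a b d
  proof
    assume "(a, b, d) \<in> vanishing_combs \<alpha> p"
    from vanishing_combs_nth(1)[OF p y this, of 0] vanishing_combs_nth(1)[OF p y this, of 3]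
    have "a * z $ 0 = 0" "a * z $ 3 = 0" by (simp_all add: grad_y_def pe o')
    then show "a = 0" using y o' by (auto simp: pe cart_eq_iff all_index_4)
  next
    assume "a = 0"
    then show "(a, b, d) \<in> vanishing_combs \<alpha> p"
      by (intro vanishing_combsI(1)[OF p y, where l = 0])
        (simp_all add: cart_eq_iff all_index_4 grad_x_def grad_y_def pe o')
  qed
  then show ?thesis by auto
qed

lemma equator_eqs:
  assumes p: "p \<in> M \<alpha>" and o: "off_axis p 0" "off_axis p 3"
  shows "(fst p $ 1)\<^sup>2 + (fst p $ 2)\<^sup>2 = \<alpha> $ 1" "fst p $ 1 * snd p $ 1 + fst p $ 2 * snd p $ 2 = 0"
    "Jfun p * fst p $ 1 = \<alpha> $ 1 * snd p $ 2" "Jfun p * fst p $ 2 = - \<alpha> $ 1 * snd p $ 1"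
proof -
  have b: "\<alpha> $ 1 \<noteq> 0" using \<alpha>_pos[of 1] by simp
  show 1: "(fst p $ 1)\<^sup>2 + (fst p $ 2)\<^sup>2 = \<alpha> $ 1"
    using M_eqs(1)[OF p] o b by (simp add: off_axis_def)
  show 2: "fst p $ 1 * snd p $ 1 + fst p $ 2 * snd p $ 2 = 0"
    using M_eqs(2)[OF p] o b by (simp add: off_axis_def)
  have "Jfun p * fst p $ 1 = ((fst p $ 1)\<^sup>2 + (fst p $ 2)\<^sup>2) * snd p $ 2
      - (fst p $ 1 * snd p $ 1 + fst p $ 2 * snd p $ 2) * fst p $ 2"
    by (cases p) (simp add: Jfun_def power2_eq_square algebra_simps)
  then show "Jfun p * fst p $ 1 = \<alpha> $ 1 * snd p $ 2" unfolding 1 2 by simp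
  have "Jfun p * fst p $ 2 = - ((fst p $ 1)\<^sup>2 + (fst p $ 2)\<^sup>2) * snd p $ 1
      + (fst p $ 1 * snd p $ 1 + fst p $ 2 * snd p $ 2) * fst p $ 1"
    by (cases p) (simp add: Jfun_def power2_eq_square algebra_simps)
  then show "Jfun p * fst p $ 2 = - \<alpha> $ 1 * snd p $ 1" unfolding 1 2 by simp
qed

text \<open>On the circle all three fields are multiples of the rotation field: with angular
  velocity \<open>k\<close> the factors are \<open>k\<close> for \<open>H\<close>, 1 for
  \<open>J\<close> and \<open>2 * k\<close> for \<open>G\<close>. The normal vector is
  (\<open>k\<close>, 1, \<open>2 * k\<close>) scaled by \<open>\<alpha> $ 1\<close>.\<close>

lemma vanishing_combs_equator:
  assumes p: "p \<in> M \<alpha>" and h: "0 < Hfun p" and o: "off_axis p 0" "off_axis p 3"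
  shows "vanishing_combs \<alpha> p = {c. (Jfun p, \<alpha> $ 1, 2 * Jfun p) \<bullet> c = 0}"
proof -
  note y = nonzero_of_Hfun_pos[OF h]
  have b: "\<alpha> $ 1 \<noteq> 0" using \<alpha>_pos[of 1] by simp
  note e = equator_eqs[OF p o]
  obtain x z where pe: "p = (x, z)" by (cases p)
  have o': "x $ 0 = 0" "x $ 3 = 0" "z $ 0 = 0" "z $ 3 = 0" using o by (simp_all add: off_axis_def pe)
  define k where "k = Jfun p / \<alpha> $ 1"
  have J: "Jfun p = k * \<alpha> $ 1" using b by (simp add: k_def)
  have z: "z $ 1 = - k * x $ 2" "z $ 2 = k * x $ 1"
  proof -
    have "\<alpha> $ 1 * (- k * x $ 2) = - (k * \<alpha> $ 1 * x $ 2)" "\<alpha> $ 1 * (k * x $ 1) = k * \<alpha> $ 1 * x $ 1"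
      by simp_all
    then have "\<alpha> $ 1 * z $ 1 = \<alpha> $ 1 * (- k * x $ 2)" "\<alpha> $ 1 * z $ 2 = \<alpha> $ 1 * (k * x $ 1)"
      using e(3,4)[unfolded J, unfolded pe fst_conv snd_conv] by linarith+
    then show "z $ 1 = - k * x $ 2" "z $ 2 = k * x $ 1" using b mult_left_cancel by blast+
  qed
  have "(a, d, g) \<in> vanishing_combs \<alpha> p \<longleftrightarrow> k * a + d + 2 * k * g = 0" for a d g
  proof
    assume "(a, d, g) \<in> vanishing_combs \<alpha> p"
    note v = vanishing_combs_nth(1)[OF p y this]
    have "a * z $ 1 - d * x $ 2 + 2 * g * z $ 1 = 0" "a * z $ 2 + d * x $ 1 + 2 * g * z $ 2 = 0"
      using v[of 1] v[of 2] by (simp_all add: grad_y_def pe o')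
    moreover have "(k * a + d + 2 * k * g) * x $ 2 = - (a * z $ 1 - d * x $ 2 + 2 * g * z $ 1)"
      "(k * a + d + 2 * k * g) * x $ 1 = a * z $ 2 + d * x $ 1 + 2 * g * z $ 2"
      unfolding z by (simp_all add: algebra_simps)
    ultimately have "(k * a + d + 2 * k * g) * x $ 2 = 0" "(k * a + d + 2 * k * g) * x $ 1 = 0"
      by simp_all
    moreover have "x $ 1 \<noteq> 0 \<or> x $ 2 \<noteq> 0" using e(1) b by (auto simp: pe)
    ultimately show "k * a + d + 2 * k * g = 0" by auto
  next
    assume "k * a + d + 2 * k * g = 0"
    then have d: "d = - (k * a + 2 * k * g)" by simp
    have gy: "grad_y \<alpha> (a, d, g) p = 0"
      by (simp add: cart_eq_iff all_index_4 grad_y_def pe o' z d algebra_simps)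
    have gx: "grad_x \<alpha> (a, d, g) p = (d * Jfun p) *\<^sub>R wt \<alpha> (fst p)"
      unfolding J using b
      by (simp add: cart_eq_iff all_index_4 grad_x_def pe o' z \<alpha>12[symmetric])
    show "(a, d, g) \<in> vanishing_combs \<alpha> p"
      by (rule vanishing_combsI(1)[OF p y gy gx])
  qed
  moreover have "k * a + d + 2 * k * g = 0 \<longleftrightarrow> Jfun p * a + \<alpha> $ 1 * d + 2 * Jfun p * g = 0" for a d g
  proof -
    have "Jfun p * a + \<alpha> $ 1 * d + 2 * Jfun p * g = \<alpha> $ 1 * (k * a + d + 2 * k * g)"
      unfolding J by (simp add: algebra_simps)
    then show ?thesis using b by simp
  qed
  ultimately have "(a, d, g) \<in> vanishing_combs \<alpha> p \<longleftrightarrow> Jfun p * a + \<alpha> $ 1 * d + 2 * Jfun p * g = 0" for a d g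
    by simp
  then show ?thesis by auto
qed

lemma corank_boundary:
  assumes p: "p \<in> M \<alpha>" and h: "0 < Hfun p" and "off_axis p 0 \<or> off_axis p 3" "\<not> (off_axis p 0 \<and> off_axis p 3)"
  shows "corank \<alpha> p = 1"
proof -
  have "boundary_comb \<alpha> m p \<noteq> 0" for m by (simp add: boundary_comb_def zero_prod_def)
  then show ?thesis
    using assms vanishing_combs_boundary[OF p h] by (auto simp: corank_eq_dim[OF p] dim_singleton)
qed

lemma corank_meridian:
  assumes p: "p \<in> M \<alpha>" and h: "0 < Hfun p" and o: "off_axis p 1" "off_axis p 2"
  shows "corank \<alpha> p = 2"
  unfolding corank_eq_dim[OF p] vanishing_combs_meridian[OF assms]
  by (subst dim_hyperplane) (simp_all add: zero_prod_def)

lemma corank_equator: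
  assumes p: "p \<in> M \<alpha>" and h: "0 < Hfun p" and o: "off_axis p 0" "off_axis p 3"
  shows "corank \<alpha> p = 2"
  unfolding corank_eq_dim[OF p] vanishing_combs_equator[OF assms]
  using \<alpha>_pos[of 1] by (subst dim_hyperplane) (auto simp: zero_prod_def)

end

section \<open>Reduced bases and linearized vector fields\<close>

lemma span_image_finite:
  fixes e :: "'b \<Rightarrow> 'a::real_vector"
  assumes "finite I" and "x \<in> span (e ` I)"
  shows "\<exists>c. x = (\<Sum>i\<in>I. c i *\<^sub>R e i)"
  using assms(2)
proof (induction rule: span_induct_alt)
  case base
  then show ?case by (intro exI[of _ "\<lambda>_. 0"]) simp
next
  case (step a y z)
  then obtain j c where "j \<in> I" "y = e j" "z = (\<Sum>i\<in>I. c i *\<^sub>R e i)" by auto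
  then have "a *\<^sub>R y + z = (\<Sum>i\<in>I. ((if i = j then a else 0) + c i) *\<^sub>R e i)"
    using assms(1) by (simp add: scaleR_add_left sum.distrib if_distrib[of "\<lambda>t. t *\<^sub>R _"] sum.delta cong: if_cong)
  then show ?case by (intro exI[of _ "\<lambda>i. (if i = j then a else 0) + c i"])
qed

text \<open>The Gram matrix \<open>Omega_mat\<close> written for \<open>omega\<close>, with
  \<open>e i\<close> conjugate to \<open>e (i + r)\<close>.\<close>

definition symplectic_frame :: "nat \<Rightarrow> (nat \<Rightarrow> phase) \<Rightarrow> bool" where
  "symplectic_frame r e \<longleftrightarrow> (\<forall>i<2 * r. \<forall>j<2 * r.
     omega (e i) (e j) = (if j = i + r then 1 else if i = j + r then - 1 else 0))"

lemma omega_symplectic_frame: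
  assumes e: "symplectic_frame r e" and j: "j < 2 * r"
  shows "omega (\<Sum>i<2 * r. c i *\<^sub>R e i) (e j) = (if j < r then - c (j + r) else c (j - r))"
proof -
  have "omega (\<Sum>i<2 * r. c i *\<^sub>R e i) (e j) = (\<Sum>i<2 * r. if i = (if j < r then j + r else j - r)
      then (if j < r then - c (j + r) else c (j - r)) else 0)"
    unfolding omega_sum_left
    using e j by (intro sum.cong refl) (auto simp: symplectic_frame_def omega_scaleR_left)
  also have "\<dots> = (if j < r then - c (j + r) else c (j - r))"
    using j by (subst sum.delta) auto
  finally show ?thesis .
qed

lemma symplectic_frame_coeff_0:
  assumes e: "symplectic_frame r e" and i: "i < 2 * r"
    and z: "\<And>j. j < 2 * r \<Longrightarrow> omega (\<Sum>i<2 * r. c i *\<^sub>R e i) (e j) = 0"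
  shows "c i = 0"
proof (cases "i < r")
  case True
  then show ?thesis using z[of "i + r"] omega_symplectic_frame[OF e, of "i + r" c] by simp
next
  case False
  then have "i - r < r" using i by linarith
  then show ?thesis using False z[of "i - r"] omega_symplectic_frame[OF e, of "i - r" c] by simp
qed

context ellipsoid
begin

lemma omega_orbit_dirs:
  assumes "u \<in> orbit_dirs \<alpha> p" "v \<in> tangent_M \<alpha> p" "dEM p v = 0"
  shows "omega u v = 0"
  using assms by (auto simp: orbit_dirs_eq omega_ham_vf_comb simp flip: inner_dEM)

text \<open>Orbit directions pair to zero with vectors killed by \<open>dEM\<close>, so pairing with
  the conjugate frame vector isolates each coefficient.\<close>

lemma frame_independent_mod_orbit_dirs:
  assumes e: "symplectic_frame r e" "\<And>i. i < 2 * r \<Longrightarrow> e i \<in> tangent_M \<alpha> p \<and> dEM p (e i) = 0"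
    and s: "(\<Sum>i<2 * r. c i *\<^sub>R e i) \<in> orbit_dirs \<alpha> p" and i: "i < 2 * r"
  shows "c i = 0"
  by (rule symplectic_frame_coeff_0[OF e(1) i]) (use omega_orbit_dirs[OF s] e(2) in blast)

text \<open>Since the two middle axes are equal, the rotation generated by \<open>J\<close>
  preserves both constraints. Its multipliers are therefore zero, and the bracket with
  \<open>H\<close> is the canonical one, which vanishes.\<close>

lemma omega_H_J_commute:
  assumes p: "p \<in> M \<alpha>"
  shows "omega (ham_vf \<alpha> (comb \<alpha> (a, b, 0)) p) (ham_vf \<alpha> (comb \<alpha> (a', b', 0)) p) = 0"
proof -
  let ?X = "\<lambda>c. ham_vf \<alpha> (comb \<alpha> c) p"
  have t: "?X c \<in> tangent_M \<alpha> p" for c by (simp add: ham_vf_comb ham_vec_tangent p)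
  obtain x z where pe: "p = (x, z)" by (cases p)
  have "mult_T \<alpha> p (grad_y \<alpha> (0, 1, 0) p) = 0" "mult_L \<alpha> p (grad_x \<alpha> (0, 1, 0) p) (grad_y \<alpha> (0, 1, 0) p) = 0"
    using \<alpha>12 by (simp_all add: mult_T_def mult_L_def pe grad_x_def grad_y_def inner_vec_def sum_UNIV_4 algebra_simps)
  then have "?X (0, 1, 0) = (grad_y \<alpha> (0, 1, 0) p, - grad_x \<alpha> (0, 1, 0) p)"
    by (simp add: ham_vf_comb ham_vec_def)
  then have HJ: "omega (?X (1, 0, 0)) (?X (0, 1, 0)) = 0"
    unfolding ham_vf_comb[of "(1, 0, 0)"] omega_ham_vec[OF t]
    by (simp add: pe grad_x_def grad_y_def inner_vec_def sum_UNIV_4)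
  have self: "omega u u = 0" for u by (simp add: omega_def inner_commute)
  have lin: "?X (a, b, 0) = a *\<^sub>R ?X (1, 0, 0) + b *\<^sub>R ?X (0, 1, 0)" for a b
    using linear_add[OF linear_ham_vf_comb[of p], of "a *\<^sub>R (1, 0, 0)" "b *\<^sub>R (0, 1, 0)"]
      linear_scale[OF linear_ham_vf_comb[of p], of a "(1, 0, 0)"]
      linear_scale[OF linear_ham_vf_comb[of p], of b "(0, 1, 0)"] by simp
  have JH: "omega (?X (0, 1, 0)) (?X (1, 0, 0)) = 0"
    using HJ omega_commute[of "?X (0, 1, 0)" "?X (1, 0, 0)"] by simp
  show ?thesis
    unfolding lin[of a b] lin[of a' b']
    by (simp add: HJ JH omega_add_left omega_add_right omega_scaleR_left omega_scaleR_right self)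
qed

text \<open>A dimension count: the orbit directions have dimension \<open>3 - r\<close>, the frame
  adds \<open>2 * r\<close> vectors independent modulo them, and the symplectic orthogonal, which
  contains both, has dimension \<open>3 + r\<close>.\<close>

lemma reduced_basisI:
  assumes p: "p \<in> M \<alpha>" and r: "corank \<alpha> p = r"
    and v: "v \<in> vanishing_combs \<alpha> p" "snd (snd v) = - 1"
    and e: "symplectic_frame r e" "\<And>i. i < 2 * r \<Longrightarrow> e i \<in> tangent_M \<alpha> p \<and> dEM p (e i) = 0"
  shows "reduced_basis \<alpha> p r e"
proof -
  let ?X = "\<lambda>c. ham_vf \<alpha> (comb \<alpha> c) p"
  let ?P = "orbit_dirs_perp \<alpha> p" and ?O = "orbit_dirs \<alpha> p" and ?T = "span (e ` {..<2 * r})"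
  note perp = orbit_dirs_perp_eq[OF p]
  have subP: "subspace ?P"
    unfolding perp using subspace_tangent_M[of \<alpha> p] linear_dEM[of p]
    by (auto simp: Real_Vector_Spaces.subspace_def linear_add linear_scale linear_0)
  have subO: "subspace ?O" by (simp add: orbit_dirs_def)
  \<comment> \<open>Adding a multiple of \<open>v\<close> removes the \<open>G\<close> coefficient
    and leaves the field unchanged.\<close>
  have X: "?X c = ?X (fst c + snd (snd c) * fst v, fst (snd c) + snd (snd c) * fst (snd v), 0)" for c
  proof -
    have "(fst c + snd (snd c) * fst v, fst (snd c) + snd (snd c) * fst (snd v), 0) = c + snd (snd c) *\<^sub>R v"
      using v(2) by (simp add: prod_eq_iff)
    then show ?thesis
      using v(1) by (simp add: linear_add[OF linear_ham_vf_comb] linear_scale[OF linear_ham_vf_comb] vanishing_combs_def)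
  qed
  have OP: "?O \<subseteq> ?P"
  proof
    fix u assume u: "u \<in> ?O"
    have ut: "u \<in> tangent_M \<alpha> p" using orbit_dirs_tangent[OF p] u by blast
    obtain c where "u = ?X c" using u by (auto simp: orbit_dirs_eq)
    then have "omega (?X c') u = 0" for c'
      using omega_H_J_commute[OF p] by (subst X) (simp add: X[of c])
    then have "c' \<bullet> dEM p u = 0" for c'
      by (simp add: inner_dEM flip: omega_ham_vf_comb[OF ut])
    then have "dEM p u = 0" by (metis inner_eq_zero_iff)
    then show "u \<in> ?P" using ut perp by simp
  qed
  have eP: "e ` {..<2 * r} \<subseteq> ?P" using e(2) perp by auto
  have inj: "inj_on e {..<2 * r}"
  proof (rule inj_onI, rule ccontr)
    fix i j assume ij: "i \<in> {..<2 * r}" "j \<in> {..<2 * r}" "e i = e j" "i \<noteq> j"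
    \<comment> \<open>The coefficients of \<open>e i - e j\<close>, a combination that would be
      zero.\<close>
    define c where "c = (\<lambda>k. if k = i then 1 else if k = j then - 1 else 0 :: real)"
    have "c i = 0"
    proof (rule symplectic_frame_coeff_0[OF e(1)])
      show "i < 2 * r" using ij by simp
      have "(\<Sum>k<2 * r. c k *\<^sub>R e k) = (\<Sum>k<2 * r. (if k = i then e i else 0) - (if k = j then e j else 0))"
        using ij by (intro sum.cong) (auto simp: c_def)
      also have "\<dots> = 0" using ij by (simp add: sum_subtractf)
      finally show "omega (\<Sum>k<2 * r. c k *\<^sub>R e k) (e l) = 0" for l by simp
    qed
    then show False by (simp add: c_def)
  qed
  have ind: "independent (e ` {..<2 * r})"
  proof (rule independent_if_scalars_zero)
    fix f x assume 0: "(\<Sum>x\<in>e ` {..<2 * r}. f x *\<^sub>R x) = 0" and x: "x \<in> e ` {..<2 * r}"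
    then obtain i where i: "i < 2 * r" "x = e i" by auto
    have "f (e i) = 0"
      by (rule symplectic_frame_coeff_0[OF e(1) i(1), of "\<lambda>i. f (e i)"])
        (use 0 in \<open>simp add: sum.reindex[OF inj]\<close>)
    then show "f x = 0" using i by simp
  qed simp
  have dimT: "dim ?T = 2 * r"
    using ind inj by (simp add: dim_eq_card_independent card_image)
  have int: "?O \<inter> ?T = {0}"
  proof
    show "?O \<inter> ?T \<subseteq> {0}"
    proof
      fix x assume x: "x \<in> ?O \<inter> ?T"
      then obtain c where c: "x = (\<Sum>i<2 * r. c i *\<^sub>R e i)" using span_image_finite[of "{..<2 * r}" x e] by auto
      have "c i = 0" if "i < 2 * r" for i
        by (rule frame_independent_mod_orbit_dirs[OF e _ that]) (use x c in auto)
      then show "x \<in> {0}" by (simp add: c)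
    qed
  qed (simp add: subO subspace_0 span_0)
  let ?W = "span (?O \<union> e ` {..<2 * r})"
  have W: "?W = {x + y |x y. x \<in> ?O \<and> y \<in> ?T}"
    using subO by (simp add: span_Un span_eq_iff[THEN iffD2])
  have "dim ?W = dim ?O + 2 * r"
    using dim_sums_Int[OF subO subspace_span, of "e ` {..<2 * r}"] int dimT W by simp
  also have "\<dots> = dim ?P"
    using dim_orbit_dirs[of p] dim_orbit_dirs_perp[OF p] r corank_eq_dim[OF p] by simp
  finally have dim: "dim ?W = dim ?P" .
  have "?W \<subseteq> ?P" using OP eP subP by (intro span_minimal) auto
  then have "?W = ?P"
    by (rule subspace_dim_equal[OF subspace_span subP]) (simp only: dim order_refl)
  moreover have "symp_form \<alpha> p (e i) (e j) = Omega_mat r $$ (i, j)" if "i < 2 * r" "j < 2 * r" for i j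
    using e that by (simp add: symp_form_eq_omega[OF p] Omega_mat_def symplectic_frame_def)
  ultimately show ?thesis using eP by (auto simp: reduced_basis_def)
qed

text \<open>When the frame spans an invariant subspace of the linearized field, no correction by
  orbit directions occurs, and independence modulo them makes the matrix unique.\<close>

lemma linearization_eq:
  assumes e: "symplectic_frame r e" "\<And>i. i < 2 * r \<Longrightarrow> e i \<in> tangent_M \<alpha> p \<and> dEM p (e i) = 0"
    and A: "A \<in> carrier_mat (2 * r) (2 * r)"
      "\<And>j. j < 2 * r \<Longrightarrow> frechet_derivative (ham_vf \<alpha> (comb \<alpha> c)) (at p) (e j) = (\<Sum>i<2 * r. A $$ (i, j) *\<^sub>R e i)"
  shows "linearization \<alpha> p r e c B \<longleftrightarrow> B = A"
proof
  have 0: "0 \<in> orbit_dirs \<alpha> p" by (simp add: orbit_dirs_def span_0)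
  show "B = A \<Longrightarrow> linearization \<alpha> p r e c B"
    using A 0 by (simp add: linearization_def)
  assume B: "linearization \<alpha> p r e c B"
  show "B = A"
  proof (rule eq_matI)
    fix i j assume "i < dim_row A" "j < dim_col A"
    then have ij: "i < 2 * r" "j < 2 * r" using A by auto
    have "(\<Sum>i<2 * r. A $$ (i, j) *\<^sub>R e i) - (\<Sum>i<2 * r. B $$ (i, j) *\<^sub>R e i) \<in> orbit_dirs \<alpha> p"
      using B ij(2) unfolding linearization_def A(2)[OF ij(2), symmetric] by blast
    then have "(\<Sum>i<2 * r. (A $$ (i, j) - B $$ (i, j)) *\<^sub>R e i) \<in> orbit_dirs \<alpha> p"
      by (simp add: scaleR_diff_left sum_subtractf)
    from frame_independent_mod_orbit_dirs[OF e this ij(1)] show "B $$ (i, j) = A $$ (i, j)" by simp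
  qed (use B A in \<open>auto simp: linearization_def\<close>)
qed

end

section \<open>Reflection symmetry and derivatives of the Hamiltonian fields\<close>

lemma differentiable_vec_nthI:
  fixes f :: "'a::real_normed_vector \<Rightarrow> real^'n"
  assumes "\<And>i. (\<lambda>q. f q $ i) differentiable (at p)"
  shows "f differentiable (at p)"
proof -
  have "f = (\<lambda>q. \<Sum>i\<in>UNIV. f q $ i *\<^sub>R axis i 1)"
    by (rule ext) (simp add: basis_expansion flip: scalar_mult_eq_scaleR)
  moreover have "(\<lambda>q. \<Sum>i\<in>UNIV. f q $ i *\<^sub>R axis i 1) differentiable (at p)"
    using assms by (intro differentiable_sum ballI differentiable_scaleR differentiable_const finite)
  ultimately show ?thesis by (rule ssubst[where P = "\<lambda>f. f differentiable (at p)"])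
qed

lemma differentiable_fst_nth: "(\<lambda>q. fst q $ i) differentiable F"
  and differentiable_snd_nth: "(\<lambda>q. snd q $ i) differentiable F"
  using has_derivative_fst_nth has_derivative_snd_nth by (blast intro: differentiableI)+

lemma differentiable_wt:
  "(\<lambda>q. wt \<alpha> (fst q)) differentiable F" "(\<lambda>q. wt \<alpha> (snd q)) differentiable F"
  by (rule differentiableI, rule has_derivative_wt, rule derivative_intros, rule derivative_intros)+

definition flip :: "4 set \<Rightarrow> real^4 \<Rightarrow> real^4" where
  "flip S x = (\<chi> i. if i \<in> S then - x $ i else x $ i)"

definition reflection :: "4 set \<Rightarrow> phase \<Rightarrow> phase" where
  "reflection S p = (flip S (fst p), flip S (snd p))"

lemma flip_nth [simp]: "flip S x $ i = (if i \<in> S then - x $ i else x $ i)"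
  by (simp add: flip_def)

lemma flip_simps: "flip S (x + y) = flip S x + flip S y" "flip S (x - y) = flip S x - flip S y"
  "flip S (r *\<^sub>R x) = r *\<^sub>R flip S x" "wt \<alpha> (flip S x) = flip S (wt \<alpha> x)"
  by (auto simp: cart_eq_iff)

lemma inner_flip: "flip S x \<bullet> flip S y = x \<bullet> y"
  unfolding inner_vec_def by (intro sum.cong) auto

lemma linear_reflection: "linear (reflection S)"
  by (rule linearI) (simp_all add: reflection_def flip_simps)

text \<open>These reflections preserve the integrals, hence commute with their Hamiltonian vector fields; this
  makes the linearization at a fixed point map the \<open>-1\<close>-eigenspace of the reflection to itself.\<close>

lemma grad_flip:
  assumes "S = {0} \<or> S = {3} \<or> S = {1, 2}"
  shows "grad_x \<alpha> c (reflection S q) = flip S (grad_x \<alpha> c q)"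
    and "grad_y \<alpha> c (reflection S q) = flip S (grad_y \<alpha> c q)"
  using assms
  by (cases c; cases q; elim disjE; simp add: cart_eq_iff all_index_4 reflection_def grad_x_def grad_y_def
      diff_divide_distrib add_divide_distrib algebra_simps)+

context ellipsoid
begin

abbreviation field_T :: "real \<times> real \<times> real \<Rightarrow> phase \<Rightarrow> real" where
  "field_T c q \<equiv> mult_T \<alpha> q (grad_y \<alpha> c q)"

abbreviation field_L :: "real \<times> real \<times> real \<Rightarrow> phase \<Rightarrow> real" where
  "field_L c q \<equiv> mult_L \<alpha> q (grad_x \<alpha> c q) (grad_y \<alpha> c q)"

lemma ham_vf_comb_reflection:
  assumes S: "S = {0} \<or> S = {3} \<or> S = {1, 2}"
  shows "ham_vf \<alpha> (comb \<alpha> c) (reflection S q) = reflection S (ham_vf \<alpha> (comb \<alpha> c) q)"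
proof -
  have D: "Dfun \<alpha> (reflection S q) = Dfun \<alpha> q"
    by (simp add: Dfun_wt reflection_def flip_simps inner_flip)
  have "field_T c (reflection S q) = field_T c q" "field_L c (reflection S q) = field_L c q"
    unfolding mult_T_def mult_L_def grad_flip[OF S] D
    by (simp_all add: reflection_def flip_simps inner_flip)
  then show ?thesis
    unfolding ham_vf_comb ham_vec_def
    by (simp add: grad_flip[OF S], simp add: reflection_def flip_simps)
qed

lemma differentiable_grad:
  "grad_x \<alpha> c differentiable (at p)" "grad_y \<alpha> c differentiable (at p)"
proof -
  obtain a b d where c: "c = (a, b, d)" by (metis surj_pair)
  have ne: "\<alpha> $ 1 - \<alpha> $ 0 \<noteq> 0" "\<alpha> $ 1 - \<alpha> $ 3 \<noteq> 0" "\<alpha> $ 1 \<noteq> \<alpha> $ 0" "\<alpha> $ 1 \<noteq> \<alpha> $ 3"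
    using \<alpha>01 \<alpha>12 \<alpha>23 by auto
  note d = differentiable_fst_nth differentiable_snd_nth
  have cases: "i = 0 \<or> i = 1 \<or> i = 2 \<or> i = 3" for i :: 4 using exhaust_4[of i] by auto
  show "grad_x \<alpha> c differentiable (at p)"
  proof (rule differentiable_vec_nthI)
    show "(\<lambda>q. grad_x \<alpha> c q $ i) differentiable (at p)" for i
      using cases[of i] by (elim disjE) (simp_all add: c grad_x_def case_prod_unfold ne d)
  qed
  show "grad_y \<alpha> c differentiable (at p)"
  proof (rule differentiable_vec_nthI)
    show "(\<lambda>q. grad_y \<alpha> c q $ i) differentiable (at p)" for i
      using cases[of i] by (elim disjE) (simp_all add: c grad_y_def case_prod_unfold ne d)
  qed
qed

lemma differentiable_field:
  assumes "Dfun \<alpha> p \<noteq> 0"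
  shows "field_T c differentiable (at p)" "field_L c differentiable (at p)"
    "ham_vf \<alpha> (comb \<alpha> c) differentiable (at p)"
proof -
  have D: "Dfun \<alpha> differentiable (at p)"
    unfolding Dfun_wt[abs_def] by (intro differentiable_inner differentiable_wt)
  show T: "field_T c differentiable (at p)"
    unfolding mult_T_def using assms
    by (intro differentiable_divide differentiable_inner differentiable_wt differentiable_grad D)
  show L: "field_L c differentiable (at p)"
    unfolding mult_L_def using assms
    by (intro differentiable_divide differentiable_diff differentiable_inner differentiable_wt differentiable_grad D)
  have "(\<lambda>q. ham_vf \<alpha> (comb \<alpha> c) q) differentiable (at p)"
    unfolding ham_vf_comb ham_vec_def
    by (intro differentiable_Pair differentiable_diff differentiable_add differentiable_scaleR T L differentiable_wt differentiable_grad)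
  then show "ham_vf \<alpha> (comb \<alpha> c) differentiable (at p)" by simp
qed

abbreviation lin_field :: "real \<times> real \<times> real \<Rightarrow> phase \<Rightarrow> phase \<Rightarrow> phase" where
  "lin_field c p \<equiv> frechet_derivative (ham_vf \<alpha> (comb \<alpha> c)) (at p)"

lemma lin_field_has_derivative:
  assumes "p \<in> M \<alpha>"
  shows "(ham_vf \<alpha> (comb \<alpha> c) has_derivative lin_field c p) (at p)"
  using differentiable_field(3)[of p c] Dfun_pos[OF assms] frechet_derivative_works by auto

lemma lin_field_reflection:
  assumes p: "p \<in> M \<alpha>" and S: "S = {0} \<or> S = {3} \<or> S = {1, 2}"
    and "reflection S p = p" "reflection S v = - v"
  shows "reflection S (lin_field c p v) = - lin_field c p v"
proof -
  let ?X = "ham_vf \<alpha> (comb \<alpha> c)"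
  have r: "(reflection S has_derivative reflection S) (at q)" for q
    by (rule linear_imp_has_derivative[OF linear_reflection])
  have "(?X has_derivative lin_field c p) (at (reflection S p))"
    using lin_field_has_derivative[OF p] assms(3) by simp
  from has_derivative_compose[OF r this]
  have 1: "((\<lambda>q. ?X (reflection S q)) has_derivative (\<lambda>v. lin_field c p (reflection S v))) (at p)" .
  have "((\<lambda>q. reflection S (?X q)) has_derivative (\<lambda>v. reflection S (lin_field c p v))) (at p)"
    by (rule has_derivative_compose[OF lin_field_has_derivative[OF p] r])
  then have "((\<lambda>q. ?X (reflection S q)) has_derivative (\<lambda>v. reflection S (lin_field c p v))) (at p)"
    by (simp add: ham_vf_comb_reflection[OF S])
  from has_derivative_unique[OF 1 this]
  have "lin_field c p (reflection S v) = reflection S (lin_field c p v)" by metis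
  then show ?thesis
    using assms(4) linear_neg[OF has_derivative_linear[OF lin_field_has_derivative[OF p]]] by metis
qed

lemma field_T_L_vanishing:
  assumes p: "p \<in> M \<alpha>" and y: "snd p \<noteq> 0" and c: "c \<in> vanishing_combs \<alpha> p"
  shows "field_T c p = 0" "field_L c p = fst p \<bullet> grad_x \<alpha> c p"
proof -
  have *: "grad_y \<alpha> c p = 0" "grad_x \<alpha> c p = (fst p \<bullet> grad_x \<alpha> c p) *\<^sub>R wt \<alpha> (fst p)"
    using vanishing_combs_iff[OF p y] c by auto
  show "field_T c p = 0" by (simp add: mult_T_def *(1))
  have "grad_x \<alpha> c p \<bullet> wt \<alpha> (fst p) = (fst p \<bullet> grad_x \<alpha> c p) * Dfun \<alpha> p"
    by (subst *(2)) (simp add: Dfun_wt)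
  then show "field_L c p = fst p \<bullet> grad_x \<alpha> c p"
    using Dfun_pos[OF p] by (simp add: mult_L_def *(1))
qed

text \<open>Along the line \<open>p + t *\<^sub>R v\<close> the coordinates with index
  \<open>i\<close> are \<open>t\<close> times those of \<open>v\<close>. The multipliers therefore
  occur only as \<open>t\<close> times a continuous function, whose derivative at 0 is its value
  there: zero for \<open>field_T\<close>, and \<open>fst p \<bullet> grad_x \<alpha> c p\<close> for
  \<open>field_L\<close>.\<close>

lemma lin_field_nth:
  assumes p: "p \<in> M \<alpha>" and y: "snd p \<noteq> 0" and c: "c \<in> vanishing_combs \<alpha> p" and i: "off_axis p i"
  shows "(\<And>t. grad_y \<alpha> c (p + t *\<^sub>R v) $ i = t * k) \<Longrightarrow> fst (lin_field c p v) $ i = k"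
    and "(\<And>t. grad_x \<alpha> c (p + t *\<^sub>R v) $ i = t * k) \<Longrightarrow>
      snd (lin_field c p v) $ i = (fst p \<bullet> grad_x \<alpha> c p) * fst v $ i / \<alpha> $ i - k"
proof -
  let ?X = "ham_vf \<alpha> (comb \<alpha> c)" and ?q = "\<lambda>t. p + t *\<^sub>R v"
  have q: "(?q has_derivative (\<lambda>t. t *\<^sub>R v)) (at 0)"
    by (rule has_derivative_eq_rhs, (rule derivative_intros)+, simp)
  have X: "((\<lambda>t. ?X (?q t)) has_derivative (\<lambda>t. lin_field c p (t *\<^sub>R v))) (at 0)"
    by (rule has_derivative_compose[OF q]) (simp add: lin_field_has_derivative[OF p])
  have lin: "lin_field c p (t *\<^sub>R v) = t *\<^sub>R lin_field c p v" for t
    using linear_scale[OF has_derivative_linear[OF lin_field_has_derivative[OF p]]] .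
  have X1: "((\<lambda>t. fst (?X (?q t)) $ i) has_real_derivative fst (lin_field c p v) $ i) (at 0)"
    using has_derivative_compose[OF X has_derivative_fst_nth, of i]
    by (simp add: lin has_field_derivative_def mult.commute[of _ "fst _ $ i"])
  have X2: "((\<lambda>t. snd (?X (?q t)) $ i) has_real_derivative snd (lin_field c p v) $ i) (at 0)"
    using has_derivative_compose[OF X has_derivative_snd_nth, of i]
    by (simp add: lin has_field_derivative_def mult.commute[of _ "snd _ $ i"])
  have cont: "isCont (\<lambda>t. f (?q t)) 0" if "f differentiable (at p)" for f :: "phase \<Rightarrow> real"
    by (rule isCont_o2[of 0 ?q f])
      (use that in \<open>auto intro!: continuous_intros simp: differentiable_imp_continuous_within\<close>)
  have D: "Dfun \<alpha> p \<noteq> 0" using Dfun_pos[OF p] by simp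
  \<comment> \<open>Caratheodory's characterization of the derivative; \<open>g\<close> only has to
    be continuous at 0.\<close>
  have car: "((\<lambda>t. t * g t) has_real_derivative g 0) (at 0)" if "isCont g 0" for g
    by (rule CARAT_DERIV[THEN iffD2]) (use that in \<open>auto intro!: exI[of _ g] simp: mult.commute\<close>)
  have T: "((\<lambda>t. t * field_T c (?q t)) has_real_derivative 0) (at 0)"
    using car[OF cont[OF differentiable_field(1)[OF D, of c]]] field_T_L_vanishing[OF p y c] by simp
  have L: "((\<lambda>t. t * field_L c (?q t)) has_real_derivative fst p \<bullet> grad_x \<alpha> c p) (at 0)"
    using car[OF cont[OF differentiable_field(2)[OF D, of c]]] field_T_L_vanishing[OF p y c] by simp
  have off: "fst p $ i = 0" "snd p $ i = 0" using i by (simp_all add: off_axis_def)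
  show "fst (lin_field c p v) $ i = k" if g: "\<And>t. grad_y \<alpha> c (p + t *\<^sub>R v) $ i = t * k"
  proof -
    have "fst (?X (?q t)) $ i = t * k - t * field_T c (?q t) * (fst v $ i / \<alpha> $ i)" for t
      by (simp add: ham_vf_comb ham_vec_def g off)
    moreover have "((\<lambda>t. t * k - t * field_T c (?q t) * (fst v $ i / \<alpha> $ i)) has_real_derivative k) (at 0)"
      using DERIV_diff[OF DERIV_cmult_right[OF DERIV_ident, of k] DERIV_cmult_right[OF T, of "fst v $ i / \<alpha> $ i"]] by simp
    ultimately show ?thesis using X1 DERIV_unique by simp
  qed
  show "snd (lin_field c p v) $ i = (fst p \<bullet> grad_x \<alpha> c p) * fst v $ i / \<alpha> $ i - k"
    if g: "\<And>t. grad_x \<alpha> c (p + t *\<^sub>R v) $ i = t * k"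
  proof -
    have "snd (?X (?q t)) $ i = t * field_L c (?q t) * (fst v $ i / \<alpha> $ i)
        + t * field_T c (?q t) * (snd v $ i / \<alpha> $ i) - t * k" for t
      by (simp add: ham_vf_comb ham_vec_def g off mult.commute mult.left_commute)
    moreover have "((\<lambda>t. t * field_L c (?q t) * (fst v $ i / \<alpha> $ i) + t * field_T c (?q t) * (snd v $ i / \<alpha> $ i) - t * k)
        has_real_derivative (fst p \<bullet> grad_x \<alpha> c p) * (fst v $ i / \<alpha> $ i) + 0 * (snd v $ i / \<alpha> $ i) - k) (at 0)"
      using DERIV_cmult_right[OF L, of "fst v $ i / \<alpha> $ i"] DERIV_cmult_right[OF T, of "snd v $ i / \<alpha> $ i"]
      by (intro DERIV_diff DERIV_add) (auto intro!: derivative_eq_intros)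
    ultimately show ?thesis using X2 DERIV_unique by simp
  qed
qed

end

section \<open>Linearizations at the critical points\<close>

definition axis_vec :: "4 \<Rightarrow> real \<Rightarrow> real \<Rightarrow> phase" where
  "axis_vec k s t = (axis k s, axis k t)"

lemma axis_vec_add: "axis_vec k s t + axis_vec k s' t' = axis_vec k (s + s') (t + t')"
  and axis_vec_scaleR: "u *\<^sub>R axis_vec k s t = axis_vec k (u * s) (u * t)"
  and axis_vec_zero: "axis_vec k 0 0 = 0"
  by (auto simp: axis_vec_def cart_eq_iff axis_def prod_eq_iff)

lemma omega_axis_vec: "omega (axis_vec k s t) (axis_vec m u v) = (if k = m then s * v - t * u else 0)"
  by (auto simp: omega_def axis_vec_def inner_axis_axis)

lemma fst_axis_vec_nth: "fst (axis_vec k s t) $ i = (if i = k then s else 0)"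
  and snd_axis_vec_nth: "snd (axis_vec k s t) $ i = (if i = k then t else 0)"
  by (simp_all add: axis_vec_def axis_def)

context ellipsoid
begin

lemma axis_vec_tangent: "off_axis p k \<Longrightarrow> axis_vec k s t \<in> tangent_M \<alpha> p"
  by (simp add: tangent_M_iff axis_vec_def inner_axis' off_axis_def)

lemma dEM_axis_vec:
  assumes "\<And>c. grad_x \<alpha> c p $ k = 0" "\<And>c. grad_y \<alpha> c p $ k = 0"
  shows "dEM p (axis_vec k s t) = 0"
proof -
  have "c \<bullet> dEM p (axis_vec k s t) = 0" for c
    by (simp add: inner_dEM has_grad_frechet[OF has_grad_comb] axis_vec_def inner_axis assms)
  then show ?thesis by (metis inner_eq_zero_iff)
qed

lemma dEM_axis_vec_boundary: "off_axis p k \<Longrightarrow> k = 0 \<or> k = 3 \<Longrightarrow> dEM p (axis_vec k s t) = 0"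
  by (rule dEM_axis_vec; cases p; elim disjE) (auto simp: off_axis_def grad_x_def grad_y_def)

lemma dEM_axis_vec_meridian:
  "off_axis p 1 \<Longrightarrow> off_axis p 2 \<Longrightarrow> k = 1 \<or> k = 2 \<Longrightarrow> dEM p (axis_vec k s t) = 0"
  by (rule dEM_axis_vec; cases p; elim disjE) (auto simp: off_axis_def grad_x_def grad_y_def)

text \<open>Reflection in coordinate \<open>k\<close> confines the image to the plane of
  \<open>x\<close> and \<open>y\<close> at index \<open>k\<close>. The gradient components there are
  linear in the displacement, and the multiplier of \<open>C1\<close> adds the term divided by
  \<open>\<alpha> $ k\<close>.\<close>

lemma lin_field_axis_vec:
  fixes p :: phase and k :: 4
  defines "P \<equiv> (fst p $ 1)\<^sup>2 + (fst p $ 2)\<^sup>2" and "q \<equiv> fst p $ 1 * snd p $ 1 + fst p $ 2 * snd p $ 2"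
    and "r \<equiv> (snd p $ 1)\<^sup>2 + (snd p $ 2)\<^sup>2" and "\<beta> \<equiv> \<alpha> $ 1 - \<alpha> $ k"
  assumes p: "p \<in> M \<alpha>" and y: "snd p \<noteq> 0" and k: "off_axis p k" "k = 0 \<or> k = 3"
    and c: "(a, b, d) \<in> vanishing_combs \<alpha> p"
  shows "lin_field (a, b, d) p (axis_vec k s t) = axis_vec k ((a + 2 * d * P / \<beta>) * t - 2 * d * q / \<beta> * s)
    (((b * Jfun p + 2 * d * (Gfun \<alpha> p - r)) / \<alpha> $ k - 2 * d * r / \<beta>) * s + 2 * d * q / \<beta> * t)"
    (is "?L = axis_vec k ?u ?v")
proof -
  have S: "{k} = {0} \<or> {k} = {3} \<or> {k} = {1, 2}" using k by auto
  have rp: "reflection {k} p = p" using k(1)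
    by (auto simp: reflection_def off_axis_def cart_eq_iff prod_eq_iff)
  have rv: "reflection {k} (axis_vec k s t) = - axis_vec k s t"
    by (auto simp: reflection_def cart_eq_iff prod_eq_iff axis_vec_def axis_def)
  have "reflection {k} ?L = - ?L" by (rule lin_field_reflection[OF p S rp rv])
  then have other: "fst ?L $ i = 0 \<and> snd ?L $ i = 0" if "i \<noteq> k" for i
    using that by (auto simp: reflection_def prod_eq_iff cart_eq_iff dest!: spec[of _ i])
  have l: "fst p \<bullet> grad_x \<alpha> (a, b, d) p = b * Jfun p + 2 * d * (Gfun \<alpha> p - r)"
    by (simp add: inner_fst_grad_x r_def)
  have "fst ?L $ k = ?u"
  proof (rule lin_field_nth(1)[OF p y c k(1)])
    fix \<tau> show "grad_y \<alpha> (a, b, d) (p + \<tau> *\<^sub>R axis_vec k s t) $ k = \<tau> * ?u"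
      using k by (cases p; elim disjE)
        (simp_all add: off_axis_def grad_y_def axis_vec_def axis_def P_def q_def \<beta>_def power2_eq_square
          algebra_simps add_divide_distrib diff_divide_distrib)
  qed
  moreover have "snd ?L $ k = ?v"
  proof -
    have "snd ?L $ k = (fst p \<bullet> grad_x \<alpha> (a, b, d) p) * fst (axis_vec k s t) $ k / \<alpha> $ k - (2 * d * r / \<beta> * s - 2 * d * q / \<beta> * t)"
    proof (rule lin_field_nth(2)[OF p y c k(1)])
      fix \<tau> show "grad_x \<alpha> (a, b, d) (p + \<tau> *\<^sub>R axis_vec k s t) $ k = \<tau> * (2 * d * r / \<beta> * s - 2 * d * q / \<beta> * t)"
        using k by (cases p; elim disjE)
          (simp_all add: off_axis_def grad_x_def axis_vec_def axis_def r_def q_def \<beta>_def power2_eq_square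
            algebra_simps add_divide_distrib diff_divide_distrib)
    qed
    then show ?thesis unfolding l by (simp add: fst_axis_vec_nth algebra_simps add_divide_distrib)
  qed
  ultimately show ?thesis
    using other by (auto simp: prod_eq_iff cart_eq_iff fst_axis_vec_nth snd_axis_vec_nth)
qed

text \<open>As a function of the coordinates with indices 1 and 2, \<open>G\<close> is \<open>A *
  (y1\<^sup>2 + y2\<^sup>2) - 2 * B * (x1 * y1 + x2 * y2) + C * (x1\<^sup>2 + x2\<^sup>2)\<close>.
  The coefficient \<open>d\<close> thus yields the same 2 by 2 block in both copies, and
  \<open>b\<close> rotates the copies into each other. The multiplier of \<open>C1\<close> is
  zero.\<close>

lemma lin_field_meridian:
  fixes p :: phase
  defines "A \<equiv> 1 + (fst p $ 0)\<^sup>2 / (\<alpha> $ 1 - \<alpha> $ 0) + (fst p $ 3)\<^sup>2 / (\<alpha> $ 1 - \<alpha> $ 3)"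
    and "B \<equiv> fst p $ 0 * snd p $ 0 / (\<alpha> $ 1 - \<alpha> $ 0) + fst p $ 3 * snd p $ 3 / (\<alpha> $ 1 - \<alpha> $ 3)"
    and "C \<equiv> (snd p $ 0)\<^sup>2 / (\<alpha> $ 1 - \<alpha> $ 0) + (snd p $ 3)\<^sup>2 / (\<alpha> $ 1 - \<alpha> $ 3)"
  assumes p: "p \<in> M \<alpha>" and y: "snd p \<noteq> 0" and o: "off_axis p 1" "off_axis p 2"
    and c: "(0, b, d) \<in> vanishing_combs \<alpha> p"
  shows "lin_field (0, b, d) p (axis_vec 1 s t) =
      axis_vec 2 (b * s) (b * t) + axis_vec 1 (2 * d * (A * t - B * s)) (2 * d * (B * t - C * s))"
    and "lin_field (0, b, d) p (axis_vec 2 s t) =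
      axis_vec 1 (- b * s) (- b * t) + axis_vec 2 (2 * d * (A * t - B * s)) (2 * d * (B * t - C * s))"
proof -
  let ?c = "(0, b, d)"
  have rp: "reflection {1, 2} p = p" using o
    by (auto simp: reflection_def off_axis_def cart_eq_iff prod_eq_iff)
  have other: "fst (lin_field ?c p v) $ i = 0 \<and> snd (lin_field ?c p v) $ i = 0"
    if "reflection {1, 2} v = - v" "i = 0 \<or> i = 3" for i v
  proof -
    have "reflection {1, 2} (lin_field ?c p v) = - lin_field ?c p v"
      by (rule lin_field_reflection[OF p _ rp that(1)]) simp
    then show ?thesis
      using that(2) by (auto simp: reflection_def prod_eq_iff cart_eq_iff dest!: spec[of _ i])
  qed
  obtain x z where pe: "p = (x, z)" by (cases p)
  have o': "x $ 1 = 0" "x $ 2 = 0" "z $ 1 = 0" "z $ 2 = 0" using o by (simp_all add: off_axis_def pe)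
  have l: "fst p \<bullet> grad_x \<alpha> ?c p = 0"
    by (simp add: inner_fst_grad_x) (simp add: pe Jfun_def Gfun_def o')
  have r: "reflection {1, 2} (axis_vec k s t) = - axis_vec k s t" if "k = 1 \<or> k = 2" for k
    using that by (auto simp: reflection_def cart_eq_iff prod_eq_iff axis_vec_def axis_def)
  note simps = pe grad_x_def grad_y_def axis_vec_def axis_def A_def B_def C_def o' power2_eq_square
            algebra_simps add_divide_distrib diff_divide_distrib
  have 11: "fst (lin_field ?c p (axis_vec 1 s t)) $ 1 = 2 * d * (A * t - B * s)"
    by (rule lin_field_nth(1)[OF p y c o(1)]) (simp add: simps)
  have 12: "fst (lin_field ?c p (axis_vec 1 s t)) $ 2 = b * s"
    by (rule lin_field_nth(1)[OF p y c o(2)]) (simp add: simps)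
  have 13: "snd (lin_field ?c p (axis_vec 1 s t)) $ 1 = 2 * d * (B * t - C * s)"
    by (rule trans[OF lin_field_nth(2)[OF p y c o(1), where k = "- (2 * d * (B * t - C * s))"]]) (simp add: simps, simp add: l)
  have 14: "snd (lin_field ?c p (axis_vec 1 s t)) $ 2 = b * t"
    by (rule trans[OF lin_field_nth(2)[OF p y c o(2), where k = "- (b * t)"]]) (simp add: simps, simp add: l)
  have 21: "fst (lin_field ?c p (axis_vec 2 s t)) $ 2 = 2 * d * (A * t - B * s)"
    by (rule lin_field_nth(1)[OF p y c o(2)]) (simp add: simps)
  have 22: "fst (lin_field ?c p (axis_vec 2 s t)) $ 1 = - b * s"
    by (rule lin_field_nth(1)[OF p y c o(1)]) (simp add: simps)
  have 23: "snd (lin_field ?c p (axis_vec 2 s t)) $ 2 = 2 * d * (B * t - C * s)"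
    by (rule trans[OF lin_field_nth(2)[OF p y c o(2), where k = "- (2 * d * (B * t - C * s))"]]) (simp add: simps, simp add: l)
  have 24: "snd (lin_field ?c p (axis_vec 2 s t)) $ 1 = - b * t"
    by (rule trans[OF lin_field_nth(2)[OF p y c o(1), where k = "b * t"]]) (simp add: simps, simp add: l)
  show "lin_field ?c p (axis_vec 1 s t) =
      axis_vec 2 (b * s) (b * t) + axis_vec 1 (2 * d * (A * t - B * s)) (2 * d * (B * t - C * s))"
    using other[OF r[of 1], of 0] other[OF r[of 1], of 3] 11 12 13 14
    by (simp add: prod_eq_iff cart_eq_iff all_index_4 fst_axis_vec_nth snd_axis_vec_nth)
  show "lin_field ?c p (axis_vec 2 s t) =
      axis_vec 1 (- b * s) (- b * t) + axis_vec 2 (2 * d * (A * t - B * s)) (2 * d * (B * t - C * s))"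
    using other[OF r[of 2], of 0] other[OF r[of 2], of 3] 21 22 23 24
    by (simp add: prod_eq_iff cart_eq_iff all_index_4 fst_axis_vec_nth snd_axis_vec_nth)
qed

end

section \<open>Matrix identities, eigenvalues and the Lie algebra read off entrywise\<close>

lemma all_less_4: "(\<forall>i<4::nat. P i) \<longleftrightarrow> P 0 \<and> P 1 \<and> P 2 \<and> P 3"
  by (auto simp: numeral_eq_Suc less_Suc_eq)

lemma all_less_2: "(\<forall>i<2::nat. P i) \<longleftrightarrow> P 0 \<and> P 1"
  by (auto simp: numeral_eq_Suc less_Suc_eq)

lemma sum_less_4: "(\<Sum>k<4::nat. f k) = f 0 + f 1 + f 2 + f 3"
  by (simp add: numeral_eq_Suc)

lemma sum_less_2: "(\<Sum>k<2::nat. f k) = f 0 + f 1"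
  by (simp add: numeral_eq_Suc)

lemma mult_mat_entry:
  "A \<in> carrier_mat n n \<Longrightarrow> B \<in> carrier_mat n n \<Longrightarrow> i < n \<Longrightarrow> j < n \<Longrightarrow>
    (A * B) $$ (i, j) = (\<Sum>k<n. A $$ (i, k) * B $$ (k, j))"
  by (auto simp: scalar_prod_def lessThan_atLeast0 intro!: sum.cong)

lemma commutator_entry:
  "A \<in> carrier_mat n n \<Longrightarrow> B \<in> carrier_mat n n \<Longrightarrow> i < n \<Longrightarrow> j < n \<Longrightarrow>
    commutator A B $$ (i, j) = (\<Sum>k<n. A $$ (i, k) * B $$ (k, j)) - (\<Sum>k<n. B $$ (i, k) * A $$ (k, j))"
  by (simp add: commutator_def mult_mat_entry del: index_mult_mat(1))

lemma eq_mat_iff_entries: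
  "A \<in> carrier_mat n n \<Longrightarrow> B \<in> carrier_mat n n \<Longrightarrow> A = B \<longleftrightarrow> (\<forall>i<n. \<forall>j<n. A $$ (i, j) = B $$ (i, j))"
  by (auto intro!: eq_matI)

lemma eigenvalue_iff_entries:
  assumes "A \<in> carrier_mat n n"
  shows "eigenvalue A k \<longleftrightarrow> (\<exists>f. (\<exists>i<n. f i \<noteq> 0) \<and> (\<forall>i<n. (\<Sum>j<n. A $$ (i, j) * f j) = k * f i))"
proof
  assume "eigenvalue A k"
  then obtain v where v: "v \<in> carrier_vec n" "v \<noteq> 0\<^sub>v n" "A *\<^sub>v v = k \<cdot>\<^sub>v v"
    using assms by (auto simp: eigenvalue_def eigenvector_def)
  have "\<exists>i<n. Matrix.vec_index v i \<noteq> 0"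
  proof (rule ccontr)
    assume "\<not> ?thesis"
    then have "v = 0\<^sub>v n" using v(1) by (intro eq_vecI) auto
    then show False using v(2) by simp
  qed
  moreover have "(\<Sum>j<n. A $$ (i, j) * Matrix.vec_index v j) = k * Matrix.vec_index v i" if "i < n" for i
    using arg_cong[OF v(3), of "\<lambda>w. Matrix.vec_index w i"] that v(1) assms
    by (simp add: scalar_prod_def lessThan_atLeast0)
  ultimately show "\<exists>f. (\<exists>i<n. f i \<noteq> 0) \<and> (\<forall>i<n. (\<Sum>j<n. A $$ (i, j) * f j) = k * f i)" by blast
next
  assume "\<exists>f. (\<exists>i<n. f i \<noteq> 0) \<and> (\<forall>i<n. (\<Sum>j<n. A $$ (i, j) * f j) = k * f i)"
  then obtain f where f: "\<exists>i<n. f i \<noteq> 0" "\<And>i. i < n \<Longrightarrow> (\<Sum>j<n. A $$ (i, j) * f j) = k * f i" by blast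
  have "A *\<^sub>v vec n f = k \<cdot>\<^sub>v vec n f"
    using assms f(2) by (intro eq_vecI) (auto simp: scalar_prod_def lessThan_atLeast0)
  moreover have "vec n f \<noteq> 0\<^sub>v n"
  proof
    assume "vec n f = 0\<^sub>v n"
    note e = this
    obtain i where "i < n" "f i \<noteq> 0" using f(1) by blast
    then show False
      using arg_cong[OF e, of "\<lambda>w. Matrix.vec_index w i"] by simp
  qed
  ultimately show "eigenvalue A k"
    using assms by (auto simp: eigenvalue_def eigenvector_def intro!: exI[of _ "vec n f"])
qed

text \<open>For an abelian algebra, brackets of length one already vanish, which gives nilpotency;
  the substance is that it equals its own normalizer.\<close>

lemma cartan_subalgebra_abelian:
  assumes sp: "\<h> \<subseteq> sp_algebra r" and z: "0\<^sub>m (2 * r) (2 * r) \<in> \<h>"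
    and add: "\<And>A B. A \<in> \<h> \<Longrightarrow> B \<in> \<h> \<Longrightarrow> A + B \<in> \<h>" and scale: "\<And>A t. A \<in> \<h> \<Longrightarrow> t \<cdot>\<^sub>m A \<in> \<h>"
    and comm: "\<And>A B. A \<in> \<h> \<Longrightarrow> B \<in> \<h> \<Longrightarrow> commutator A B = 0\<^sub>m (2 * r) (2 * r)"
    and self: "\<And>X. X \<in> sp_algebra r \<Longrightarrow> (\<And>A. A \<in> \<h> \<Longrightarrow> commutator X A \<in> \<h>) \<Longrightarrow> X \<in> \<h>"
  shows "cartan_subalgebra r \<h>"
proof -
  have "nilpotent_lie r \<h>"
    unfolding nilpotent_lie_def
  proof (intro exI[of _ 1] allI impI)
    fix As B assume "length As = 1 \<and> set As \<subseteq> \<h> \<and> B \<in> \<h>"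
    then show "foldr commutator As B = 0\<^sub>m (2 * r) (2 * r)"
      using comm by (cases As) auto
  qed
  moreover have "lie_subalgebra r \<h>"
    using sp z add scale by (simp add: lie_subalgebra_def comm)
  moreover have "{X \<in> sp_algebra r. \<forall>A\<in>\<h>. commutator X A \<in> \<h>} = \<h>"
  proof (intro Set.set_eqI iffI)
    fix X assume "X \<in> {X \<in> sp_algebra r. \<forall>A\<in>\<h>. commutator X A \<in> \<h>}"
    then show "X \<in> \<h>" using self[of X] by simp
  next
    fix X assume "X \<in> \<h>"
    then show "X \<in> {X \<in> sp_algebra r. \<forall>A\<in>\<h>. commutator X A \<in> \<h>}"
      using z subsetD[OF sp] by (simp add: comm)
  qed
  ultimately show ?thesis by (simp add: cartan_subalgebra_def)
qed

lemma sp_algebra_entries: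
  "X \<in> sp_algebra r \<longleftrightarrow> X \<in> carrier_mat (2 * r) (2 * r) \<and> (\<forall>i<2 * r. \<forall>j<2 * r.
    (\<Sum>k<2 * r. X $$ (k, i) * Omega_mat r $$ (k, j)) + (\<Sum>k<2 * r. Omega_mat r $$ (i, k) * X $$ (k, j)) = 0)"
proof (cases "X \<in> carrier_mat (2 * r) (2 * r)")
  case True
  have O: "Omega_mat r \<in> carrier_mat (2 * r) (2 * r)" by (simp add: Omega_mat_def)
  have "(transpose_mat X * Omega_mat r + Omega_mat r * X) $$ (i, j) =
      (\<Sum>k<2 * r. X $$ (k, i) * Omega_mat r $$ (k, j)) + (\<Sum>k<2 * r. Omega_mat r $$ (i, k) * X $$ (k, j))"
    if "i < 2 * r" "j < 2 * r" for i j
  proof -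
    have "(transpose_mat X * Omega_mat r + Omega_mat r * X) $$ (i, j) = (transpose_mat X * Omega_mat r) $$ (i, j) + (Omega_mat r * X) $$ (i, j)"
      using that True O by simp
    also have "\<dots> = (\<Sum>k<2 * r. transpose_mat X $$ (i, k) * Omega_mat r $$ (k, j)) + (\<Sum>k<2 * r. Omega_mat r $$ (i, k) * X $$ (k, j))"
      using that True O by (simp add: mult_mat_entry[of _ "2 * r"] del: index_mult_mat(1))
    also have "(\<Sum>k<2 * r. transpose_mat X $$ (i, k) * Omega_mat r $$ (k, j)) = (\<Sum>k<2 * r. X $$ (k, i) * Omega_mat r $$ (k, j))"
      using that True by (intro sum.cong) auto
    finally show ?thesis .
  qed
  note entry = this
  have C: "transpose_mat X * Omega_mat r + Omega_mat r * X \<in> carrier_mat (2 * r) (2 * r)"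
    using True O by simp
  have "X \<in> sp_algebra r \<longleftrightarrow> transpose_mat X * Omega_mat r + Omega_mat r * X = 0\<^sub>m (2 * r) (2 * r)"
    using True by (simp add: sp_algebra_def)
  also have "\<dots> \<longleftrightarrow> (\<forall>i<2 * r. \<forall>j<2 * r. (transpose_mat X * Omega_mat r + Omega_mat r * X) $$ (i, j) = 0)"
    by (subst eq_mat_iff_entries[OF C zero_carrier_mat]) simp
  finally show ?thesis using True entry by simp
qed (simp add: sp_algebra_def)

section \<open>Cartan subalgebras and spectra\<close>

lemma ex_less_2: "(\<exists>i<2::nat. P i) \<longleftrightarrow> P 0 \<or> P 1"
  using all_less_2[of "\<lambda>i. \<not> P i"] by blast

lemma sp_algebra_1:
  "X \<in> sp_algebra 1 \<longleftrightarrow> X \<in> carrier_mat 2 2 \<and> X $$ (1, 1) = - X $$ (0, 0)"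
  unfolding sp_algebra_entries
  by (auto simp: all_less_2 sum_less_2 Omega_mat_def)

lemma sp_algebra_2:
  "X \<in> sp_algebra 2 \<longleftrightarrow> X \<in> carrier_mat 4 4 \<and>
     X $$ (2, 2) = - X $$ (0, 0) \<and> X $$ (3, 3) = - X $$ (1, 1) \<and> X $$ (2, 3) = - X $$ (1, 0) \<and> X $$ (3, 2) = - X $$ (0, 1) \<and>
     X $$ (0, 3) = X $$ (1, 2) \<and> X $$ (2, 1) = X $$ (3, 0)"
proof -
  have "X \<in> sp_algebra 2 \<longleftrightarrow> X \<in> carrier_mat 4 4 \<and> (\<forall>i<4. \<forall>j<4.
    (\<Sum>k<4. X $$ (k, i) * Omega_mat 2 $$ (k, j)) + (\<Sum>k<4. Omega_mat 2 $$ (i, k) * X $$ (k, j)) = 0)"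
    unfolding sp_algebra_entries by simp
  also have "\<dots> \<longleftrightarrow> X \<in> carrier_mat 4 4 \<and>
     X $$ (2, 2) = - X $$ (0, 0) \<and> X $$ (3, 3) = - X $$ (1, 1) \<and> X $$ (2, 3) = - X $$ (1, 0) \<and> X $$ (3, 2) = - X $$ (0, 1) \<and>
     X $$ (0, 3) = X $$ (1, 2) \<and> X $$ (2, 1) = X $$ (3, 0)"
    by (auto simp: all_less_4 sum_less_4 Omega_mat_def)
  finally show ?thesis .
qed

text \<open>For \<open>r = 1\<close> the symplectic algebra is that of traceless 2 by 2
  matrices.\<close>

definition sl2_mat :: "real \<Rightarrow> real \<Rightarrow> real \<Rightarrow> real mat" where
  "sl2_mat m n k = mat 2 2 (\<lambda>(i, j). if i = 0 then (if j = 0 then m else n) else (if j = 0 then k else - m))"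

text \<open>Two uncoupled oscillators with frequencies \<open>u\<close> and \<open>v\<close>, in the
  basis order (q1, q2, p1, p2).\<close>

definition ee_mat :: "real \<Rightarrow> real \<Rightarrow> real mat" where
  "ee_mat u v = mat 4 4 (\<lambda>(i, j). if i = 0 \<and> j = 2 then u else if i = 1 \<and> j = 3 then v
     else if i = 2 \<and> j = 0 then - u else if i = 3 \<and> j = 1 then - v else 0)"

text \<open>The Williamson focus-focus block: \<open>u\<close> expands the first pair and contracts
  the second, while \<open>v\<close> rotates both pairs.\<close>

definition ff_mat :: "real \<Rightarrow> real \<Rightarrow> real mat" where
  "ff_mat u v = mat 4 4 (\<lambda>(i, j). if i = j then (if i < 2 then u else - u)
     else if i = 1 \<and> j = 0 \<or> i = 3 \<and> j = 2 then v else if i = 0 \<and> j = 1 \<or> i = 2 \<and> j = 3 then - v else 0)"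

lemma sl2_mat_carrier [simp]: "sl2_mat m n k \<in> carrier_mat 2 2"
  and ee_mat_carrier [simp]: "ee_mat u v \<in> carrier_mat 4 4"
  and ff_mat_carrier [simp]: "ff_mat u v \<in> carrier_mat 4 4"
  by (simp_all add: sl2_mat_def ee_mat_def ff_mat_def)

lemma commutator_carrier [simp]:
  "A \<in> carrier_mat n n \<Longrightarrow> B \<in> carrier_mat n n \<Longrightarrow> commutator A B \<in> carrier_mat n n"
  unfolding commutator_def by (rule minus_carrier_mat) auto

lemma commutator_eq_iff:
  assumes "A \<in> carrier_mat n n" "B \<in> carrier_mat n n" "C \<in> carrier_mat n n"
  shows "commutator A B = C \<longleftrightarrow> (\<forall>i<n. \<forall>j<n.
    (\<Sum>k<n. A $$ (i, k) * B $$ (k, j)) - (\<Sum>k<n. B $$ (i, k) * A $$ (k, j)) = C $$ (i, j))"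
  using assms by (subst eq_mat_iff_entries[of _ n]) (simp_all add: commutator_entry)

text \<open>The hypothesis says that the generator has positive determinant, so it is elliptic. A
  matrix normalizing its line must centralize it and is then a multiple of it.\<close>

lemma cartan_subalgebra_sl2:
  assumes neg: "m\<^sup>2 + n * k < 0"
  shows "cartan_subalgebra 1 (range (\<lambda>t. sl2_mat (t * m) (t * n) (t * k)))"
proof (rule cartan_subalgebra_abelian)
  let ?h = "range (\<lambda>t. sl2_mat (t * m) (t * n) (t * k))"
  show "?h \<subseteq> sp_algebra 1"
    by (auto simp: sp_algebra_1 simp del: One_nat_def) (simp add: sl2_mat_def)
  have "0\<^sub>m (2 * 1) (2 * 1) = sl2_mat (0 * m) (0 * n) (0 * k)"
    by (rule eq_matI) (auto simp: sl2_mat_def)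
  then show "0\<^sub>m (2 * 1) (2 * 1) \<in> ?h" by blast
  show "A + B \<in> ?h" if "A \<in> ?h" "B \<in> ?h" for A B
  proof -
    from that obtain s t where "A = sl2_mat (s * m) (s * n) (s * k)" "B = sl2_mat (t * m) (t * n) (t * k)" by auto
    then have "A + B = sl2_mat ((s + t) * m) ((s + t) * n) ((s + t) * k)"
      by (intro eq_matI) (auto simp: sl2_mat_def algebra_simps)
    then show ?thesis by blast
  qed
  show "t \<cdot>\<^sub>m A \<in> ?h" if "A \<in> ?h" for A t
  proof -
    from that obtain s where "A = sl2_mat (s * m) (s * n) (s * k)" by auto
    then have "t \<cdot>\<^sub>m A = sl2_mat ((t * s) * m) ((t * s) * n) ((t * s) * k)"
      by (intro eq_matI) (auto simp: sl2_mat_def algebra_simps)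
    then show ?thesis by blast
  qed
  show "commutator A B = 0\<^sub>m (2 * 1) (2 * 1)" if "A \<in> ?h" "B \<in> ?h" for A B
  proof -
    from that obtain s t where "A = sl2_mat (s * m) (s * n) (s * k)" "B = sl2_mat (t * m) (t * n) (t * k)" by auto
    then show ?thesis
      by (subst commutator_eq_iff[of _ 2]) (simp_all add: all_less_2 sum_less_2, simp_all add: sl2_mat_def algebra_simps)
  qed
  show "X \<in> ?h" if X: "X \<in> sp_algebra 1" and comm: "\<And>A. A \<in> ?h \<Longrightarrow> commutator X A \<in> ?h" for X
  proof -
    have C: "X \<in> carrier_mat 2 2" and X11: "X $$ (1, 1) = - X $$ (0, 0)" using X sp_algebra_1 by auto
    define x y z where "x = X $$ (0, 0)" and "y = X $$ (0, 1)" and "z = X $$ (1, 0)"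
    have "commutator X (sl2_mat (1 * m) (1 * n) (1 * k)) \<in> ?h" by (rule comm) (rule rangeI)
    then obtain t where "commutator X (sl2_mat m n k) = sl2_mat (t * m) (t * n) (t * k)" by auto
    then have "\<forall>i<2. \<forall>j<2. (\<Sum>l<2. X $$ (i, l) * sl2_mat m n k $$ (l, j)) - (\<Sum>l<2. sl2_mat m n k $$ (i, l) * X $$ (l, j))
        = sl2_mat (t * m) (t * n) (t * k) $$ (i, j)"
      using commutator_eq_iff[OF C] by simp
    note entries = this[unfolded all_less_2 sum_less_2]
    have X: "X $$ (0, 0) = x" "X $$ (0, Suc 0) = y" "X $$ (Suc 0, 0) = z" "X $$ (Suc 0, Suc 0) = - x"
      using X11 by (simp_all add: x_def y_def z_def)
    have "x * m + y * k - (m * x + n * z) = t * m" "x * n - y * m - (m * y - n * x) = t * n"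
      "z * m - x * k - (k * x - m * z) = t * k"
      using entries by (simp_all add: sl2_mat_def X)
    then have e: "y * k - n * z = t * m" "2 * (x * n - m * y) = t * n" "2 * (z * m - k * x) = t * k"
      by (simp_all add: mult.commute)
    \<comment> \<open>The trace form of the generator with itself is
      \<open>2 * (m\<^sup>2 + n * k)\<close>, while every commutator with the generator is
      trace-orthogonal to it; hence \<open>t = 0\<close>.\<close>
    have "t * (2 * (m\<^sup>2 + n * k)) = 2 * m * (t * m) + k * (t * n) + n * (t * k)"
      by (simp add: power2_eq_square algebra_simps)
    also have "\<dots> = 0" unfolding e[symmetric] by (simp add: algebra_simps)
    finally have t: "t = 0" using neg by simp
    have n: "n \<noteq> 0" using neg by (auto simp: not_less)
    \<comment> \<open>Since \<open>n\<close> is nonzero, the upper right entry determines the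
      multiple.\<close>
    have "X = sl2_mat (y / n * m) (y / n * n) (y / n * k)"
    proof (subst eq_mat_iff_entries[OF C], simp)
      show "\<forall>i<2. \<forall>j<2. X $$ (i, j) = sl2_mat (y / n * m) (y / n * n) (y / n * k) $$ (i, j)"
        using e n t unfolding all_less_2 by (simp add: sl2_mat_def X) (simp add: field_simps)
    qed
    then show ?thesis by blast
  qed
qed

lemma spectrum_sl2:
  assumes "m\<^sup>2 + n * k = - w\<^sup>2" "n \<noteq> 0"
  shows "spectrum (map_mat complex_of_real (sl2_mat m n k)) = {\<i> * of_real w, - \<i> * of_real w}"
proof (rule Set.set_eqI)
  fix \<mu> :: complex
  let ?m = "complex_of_real m" and ?n = "complex_of_real n" and ?k = "complex_of_real k" and ?w = "complex_of_real w"
  have w: "?m * ?m + ?n * ?k = - (?w * ?w)"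
    using arg_cong[OF assms(1), of complex_of_real] by (simp add: power2_eq_square)
  have "\<mu> \<in> spectrum (map_mat complex_of_real (sl2_mat m n k)) \<longleftrightarrow>
      (\<exists>f. (\<exists>i<2. f i \<noteq> 0) \<and> (\<forall>i<2. (\<Sum>j<2. map_mat complex_of_real (sl2_mat m n k) $$ (i, j) * f j) = \<mu> * f i))"
    by (simp add: spectrum_def eigenvalue_iff_entries[of _ 2])
  also have "\<dots> \<longleftrightarrow> (\<exists>f. (f 0 \<noteq> 0 \<or> f 1 \<noteq> 0) \<and> ?m * f 0 + ?n * f 1 = \<mu> * f 0 \<and> ?k * f 0 - ?m * f 1 = \<mu> * f (1::nat))"
    unfolding all_less_2 ex_less_2 sum_less_2 by (simp add: sl2_mat_def)
  also have "\<dots> \<longleftrightarrow> \<mu> * \<mu> = - (?w * ?w)"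
  proof
    assume "\<exists>f. (f 0 \<noteq> 0 \<or> f 1 \<noteq> 0) \<and> ?m * f 0 + ?n * f 1 = \<mu> * f 0 \<and> ?k * f 0 - ?m * f 1 = \<mu> * f (1::nat)"
    then obtain f where f: "f 0 \<noteq> 0 \<or> f 1 \<noteq> 0" "?m * f 0 + ?n * f 1 = \<mu> * f 0" "?k * f 0 - ?m * f 1 = \<mu> * f (1::nat)" by blast
    have "\<mu> * \<mu> * f 0 = \<mu> * (?m * f 0 + ?n * f 1)" unfolding f(2) by simp
    also have "\<dots> = ?m * (\<mu> * f 0) + ?n * (\<mu> * f 1)" by (simp add: algebra_simps)
    also have "\<dots> = (?m * ?m + ?n * ?k) * f 0" unfolding f(2,3)[symmetric] by (simp add: algebra_simps)
    finally have 1: "\<mu> * \<mu> * f 0 = - (?w * ?w) * f 0" unfolding w .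
    have "\<mu> * \<mu> * f 1 = \<mu> * (?k * f 0 - ?m * f 1)" unfolding f(3) by simp
    also have "\<dots> = ?k * (\<mu> * f 0) - ?m * (\<mu> * f 1)" by (simp add: algebra_simps)
    also have "\<dots> = (?m * ?m + ?n * ?k) * f 1" unfolding f(2,3)[symmetric] by (simp add: algebra_simps)
    finally have "\<mu> * \<mu> * f 1 = - (?w * ?w) * f 1" unfolding w .
    with 1 f(1) show "\<mu> * \<mu> = - (?w * ?w)" by (metis mult_right_cancel)
  next
    assume mu: "\<mu> * \<mu> = - (?w * ?w)"
    \<comment> \<open>An eigenvector solving the first row; it is nonzero because \<open>n\<close>
      is, and the characteristic equation gives the second row.\<close>
    let ?f = "\<lambda>i::nat. if i = 0 then ?n else \<mu> - ?m"
    have "?k * ?n - ?m * (\<mu> - ?m) = (?m * ?m + ?n * ?k) - ?m * \<mu>" by (simp add: algebra_simps)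
    also have "\<dots> = \<mu> * (\<mu> - ?m)" unfolding w mu[symmetric] by (simp add: algebra_simps)
    finally have "(?f 0 \<noteq> 0 \<or> ?f 1 \<noteq> 0) \<and> ?m * ?f 0 + ?n * ?f 1 = \<mu> * ?f 0 \<and> ?k * ?f 0 - ?m * ?f 1 = \<mu> * ?f 1"
      using assms(2) by (simp add: algebra_simps)
    then show "\<exists>f. (f 0 \<noteq> 0 \<or> f 1 \<noteq> 0) \<and> ?m * f 0 + ?n * f 1 = \<mu> * f 0 \<and> ?k * f 0 - ?m * f 1 = \<mu> * f (1::nat)"
      by (intro exI[of _ ?f])
  qed
  also have "\<dots> \<longleftrightarrow> (\<mu> - \<i> * ?w) * (\<mu> + \<i> * ?w) = 0" by (simp add: algebra_simps eq_neg_iff_add_eq_0)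
  also have "\<dots> \<longleftrightarrow> \<mu> \<in> {\<i> * of_real w, - \<i> * of_real w}" by (simp add: eq_neg_iff_add_eq_0)
  finally show "\<mu> \<in> spectrum (map_mat complex_of_real (sl2_mat m n k)) \<longleftrightarrow> \<mu> \<in> {\<i> * of_real w, - \<i> * of_real w}" .
qed

text \<open>By linearity the normalizer condition is tested on the generators \<open>F 1 0\<close>
  and \<open>F 0 1\<close>, which leaves a finite system of equations for the entries of
  \<open>X\<close>.\<close>

lemma two_parameter_cartan:
  fixes F :: "real \<Rightarrow> real \<Rightarrow> real mat"
  assumes sp: "\<And>u v. F u v \<in> sp_algebra 2" and z: "F 0 0 = 0\<^sub>m 4 4"
    and add: "\<And>u v u' v'. F u v + F u' v' = F (u + u') (v + v')" and scale: "\<And>t u v. t \<cdot>\<^sub>m F u v = F (t * u) (t * v)"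
    and comm: "\<And>u v u' v'. commutator (F u v) (F u' v') = 0\<^sub>m 4 4"
    and self: "\<And>X u v u' v'. X \<in> sp_algebra 2 \<Longrightarrow> commutator X (F 1 0) = F u v \<Longrightarrow> commutator X (F 0 1) = F u' v' \<Longrightarrow>
      \<exists>s t. X = F s t"
  shows "cartan_subalgebra 2 {F u v |u v. True}"
proof (rule cartan_subalgebra_abelian)
  show "{F u v |u v. True} \<subseteq> sp_algebra 2" using sp by auto
  show "0\<^sub>m (2 * 2) (2 * 2) \<in> {F u v |u v. True}" using z[symmetric] by auto
  show "A + B \<in> {F u v |u v. True}" if "A \<in> {F u v |u v. True}" "B \<in> {F u v |u v. True}" for A B
    using that by (clarsimp simp: add) blast
  show "t \<cdot>\<^sub>m A \<in> {F u v |u v. True}" if "A \<in> {F u v |u v. True}" for A t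
    using that by (clarsimp simp: scale) blast
  show "commutator A B = 0\<^sub>m (2 * 2) (2 * 2)" if "A \<in> {F u v |u v. True}" "B \<in> {F u v |u v. True}" for A B
    using that comm by auto
  show "X \<in> {F u v |u v. True}" if X: "X \<in> sp_algebra 2" and c: "\<And>A. A \<in> {F u v |u v. True} \<Longrightarrow> commutator X A \<in> {F u v |u v. True}" for X
  proof -
    have "commutator X (F 1 0) \<in> {F u v |u v. True}" "commutator X (F 0 1) \<in> {F u v |u v. True}"
      by (rule c, blast)+
    then show ?thesis using self[OF X] by blast
  qed
qed

lemma cartan_subalgebra_ee: "cartan_subalgebra 2 {ee_mat u v |u v. True}"
proof (rule two_parameter_cartan)
  show "ee_mat u v \<in> sp_algebra 2" for u v by (simp add: sp_algebra_2) (simp add: ee_mat_def)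
  show "ee_mat 0 0 = 0\<^sub>m 4 4" by (rule eq_matI) (auto simp: ee_mat_def)
  show "ee_mat u v + ee_mat u' v' = ee_mat (u + u') (v + v')" for u v u' v' by (rule eq_matI) (auto simp: ee_mat_def)
  show "t \<cdot>\<^sub>m ee_mat u v = ee_mat (t * u) (t * v)" for t u v by (rule eq_matI) (auto simp: ee_mat_def)
  show "commutator (ee_mat u v) (ee_mat u' v') = 0\<^sub>m 4 4" for u v u' v'
    by (subst commutator_eq_iff[of _ 4]) (simp_all add: all_less_4 sum_less_4, simp_all add: ee_mat_def)
  show "\<exists>s t. X = ee_mat s t"
    if X: "X \<in> sp_algebra 2" and c: "commutator X (ee_mat 1 0) = ee_mat u v" "commutator X (ee_mat 0 1) = ee_mat u' v'"
    for X u v u' v'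
  proof -
    have C: "X \<in> carrier_mat 4 4" and s: "X $$ (2, 2) = - X $$ (0, 0)" "X $$ (3, 3) = - X $$ (1, 1)"
      using X sp_algebra_2 by auto
    note e1 = c(1)[unfolded commutator_eq_iff[OF C ee_mat_carrier ee_mat_carrier] all_less_4 sum_less_4]
    note e2 = c(2)[unfolded commutator_eq_iff[OF C ee_mat_carrier ee_mat_carrier] all_less_4 sum_less_4]
    have "X = ee_mat (X $$ (0, 2)) (X $$ (1, 3))"
      unfolding eq_mat_iff_entries[OF C ee_mat_carrier] all_less_4
      using e1 e2 s by (simp add: ee_mat_def)
    then show ?thesis by blast
  qed
qed

lemma cartan_subalgebra_ff: "cartan_subalgebra 2 {ff_mat u v |u v. True}"
proof (rule two_parameter_cartan)
  show "ff_mat u v \<in> sp_algebra 2" for u v by (simp add: sp_algebra_2) (simp add: ff_mat_def)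
  show "ff_mat 0 0 = 0\<^sub>m 4 4" by (rule eq_matI) (auto simp: ff_mat_def)
  show "ff_mat u v + ff_mat u' v' = ff_mat (u + u') (v + v')" for u v u' v' by (rule eq_matI) (auto simp: ff_mat_def)
  show "t \<cdot>\<^sub>m ff_mat u v = ff_mat (t * u) (t * v)" for t u v by (rule eq_matI) (auto simp: ff_mat_def)
  show "commutator (ff_mat u v) (ff_mat u' v') = 0\<^sub>m 4 4" for u v u' v'
    by (subst commutator_eq_iff[of _ 4]) (simp_all add: all_less_4 sum_less_4, simp_all add: ff_mat_def)
  show "\<exists>s t. X = ff_mat s t"
    if X: "X \<in> sp_algebra 2" and c: "commutator X (ff_mat 1 0) = ff_mat u v" "commutator X (ff_mat 0 1) = ff_mat u' v'"
    for X u v u' v'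
  proof -
    have C: "X \<in> carrier_mat 4 4" and s: "X $$ (2, 2) = - X $$ (0, 0)" "X $$ (3, 3) = - X $$ (1, 1)"
        "X $$ (2, 3) = - X $$ (1, 0)" "X $$ (3, 2) = - X $$ (0, 1)"
      using X sp_algebra_2 by auto
    note e1 = c(1)[unfolded commutator_eq_iff[OF C ff_mat_carrier ff_mat_carrier] all_less_4 sum_less_4]
    note e2 = c(2)[unfolded commutator_eq_iff[OF C ff_mat_carrier ff_mat_carrier] all_less_4 sum_less_4]
    have "X = ff_mat (X $$ (0, 0)) (X $$ (1, 0))"
      unfolding eq_mat_iff_entries[OF C ff_mat_carrier] all_less_4
      using e1 e2 s by (simp add: ff_mat_def)
    then show ?thesis by blast
  qed
qed

lemma ex_less_4: "(\<exists>i<4::nat. P i) \<longleftrightarrow> P 0 \<or> P 1 \<or> P 2 \<or> P 3"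
  using all_less_4[of "\<lambda>i. \<not> P i"] by blast

lemma spectrum_4_iff:
  fixes A :: "real mat" and \<mu> :: complex
  assumes "A \<in> carrier_mat 4 4"
  shows "\<mu> \<in> spectrum (map_mat complex_of_real A) \<longleftrightarrow> (\<exists>a b c d :: complex. (a \<noteq> 0 \<or> b \<noteq> 0 \<or> c \<noteq> 0 \<or> d \<noteq> 0) \<and>
    (\<forall>i<4. complex_of_real (A $$ (i, 0)) * a + complex_of_real (A $$ (i, 1)) * b + complex_of_real (A $$ (i, 2)) * c
        + complex_of_real (A $$ (i, 3)) * d =
       \<mu> * (if i = 0 then a else if i = 1 then b else if i = 2 then c else d)))"
    (is "_ \<longleftrightarrow> (\<exists>a b c d. ?Q a b c d)")
proof -
  have "\<mu> \<in> spectrum (map_mat complex_of_real A) \<longleftrightarrow>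
      (\<exists>f. (\<exists>i<4. f i \<noteq> 0) \<and> (\<forall>i<4. (\<Sum>j<4. map_mat complex_of_real A $$ (i, j) * f j) = \<mu> * f i))"
    using assms by (simp add: spectrum_def eigenvalue_iff_entries[of _ 4])
  also have "\<dots> \<longleftrightarrow> (\<exists>f::nat \<Rightarrow> complex. ?Q (f 0) (f 1) (f 2) (f 3))"
    unfolding all_less_4 ex_less_4 sum_less_4 using assms by simp
  also have "\<dots> \<longleftrightarrow> (\<exists>a b c d. ?Q a b c d)"
  proof
    assume "\<exists>a b c d. ?Q a b c d"
    then obtain a b c d where "?Q a b c d" by blast
    then show "\<exists>f::nat \<Rightarrow> complex. ?Q (f 0) (f 1) (f 2) (f 3)"
      by (intro exI[of _ "\<lambda>i. if i = 0 then a else if i = 1 then b else if i = 2 then c else d"]) simp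
  next
    assume "\<exists>f::nat \<Rightarrow> complex. ?Q (f 0) (f 1) (f 2) (f 3)"
    then obtain f :: "nat \<Rightarrow> complex" where "?Q (f 0) (f 1) (f 2) (f 3)" by blast
    then show "\<exists>a b c d. ?Q a b c d" by (intro exI)
  qed
  finally show ?thesis .
qed

lemma spectrum_ee:
  "spectrum (map_mat complex_of_real (ee_mat u v)) =
    {\<i> * of_real u, - \<i> * of_real u, \<i> * of_real v, - \<i> * of_real v}"
proof (rule Set.set_eqI)
  fix \<mu> :: complex
  let ?u = "complex_of_real u" and ?v = "complex_of_real v"
  have sq: "\<mu> * \<mu> = - (w * w) \<longleftrightarrow> \<mu> = \<i> * w \<or> \<mu> = - \<i> * w" for w
  proof -
    have "\<mu> * \<mu> = - (w * w) \<longleftrightarrow> (\<mu> - \<i> * w) * (\<mu> + \<i> * w) = 0" by (simp add: algebra_simps eq_neg_iff_add_eq_0)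
    then show ?thesis by (simp add: eq_neg_iff_add_eq_0)
  qed
  have pair: "(\<exists>a c. (a \<noteq> 0 \<or> c \<noteq> 0) \<and> w * c = \<mu> * a \<and> - w * a = \<mu> * c) \<longleftrightarrow> \<mu> * \<mu> = - (w * w)" for w
  proof
    assume "\<exists>a c. (a \<noteq> 0 \<or> c \<noteq> 0) \<and> w * c = \<mu> * a \<and> - w * a = \<mu> * c"
    then obtain a c where ac: "a \<noteq> 0 \<or> c \<noteq> 0" "\<mu> * a = w * c" "\<mu> * c = - w * a" by metis
    have "\<mu> * \<mu> * a = w * (\<mu> * c)" unfolding mult.assoc ac(2) by (rule mult.left_commute)
    then have 1: "\<mu> * \<mu> * a = - (w * w) * a" unfolding ac(3) by simp
    have "\<mu> * \<mu> * c = - w * (\<mu> * a)" unfolding mult.assoc ac(3) by (rule mult.left_commute)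
    then have "\<mu> * \<mu> * c = - (w * w) * c" unfolding ac(2) by simp
    with 1 show "\<mu> * \<mu> = - (w * w)" using ac(1) by (metis mult_right_cancel)
  next
    assume "\<mu> * \<mu> = - (w * w)"
    then show "\<exists>a c. (a \<noteq> 0 \<or> c \<noteq> 0) \<and> w * c = \<mu> * a \<and> - w * a = \<mu> * c"
      unfolding sq
    proof
      assume "\<mu> = \<i> * w"
      then show ?thesis by - (rule exI[of _ 1], rule exI[of _ \<i>], simp add: algebra_simps)
    next
      assume "\<mu> = - \<i> * w"
      then show ?thesis by - (rule exI[of _ 1], rule exI[of _ "- \<i>"], simp add: algebra_simps)
    qed
  qed
  have "\<mu> \<in> spectrum (map_mat complex_of_real (ee_mat u v)) \<longleftrightarrow>
    (\<exists>a b c d. (a \<noteq> 0 \<or> b \<noteq> 0 \<or> c \<noteq> 0 \<or> d \<noteq> 0) \<and> ?u * c = \<mu> * a \<and> ?v * d = \<mu> * b \<and> - ?u * a = \<mu> * c \<and> - ?v * b = \<mu> * d)"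
    unfolding spectrum_4_iff[OF ee_mat_carrier] all_less_4 by (simp add: ee_mat_def)
  \<comment> \<open>The matrix couples positions 0 with 2 and 1 with 3, so an eigenvector restricts
    to one of two independent 2 by 2 systems, and either of them extends by zeros.\<close>
  also have "\<dots> \<longleftrightarrow> (\<exists>a c. (a \<noteq> 0 \<or> c \<noteq> 0) \<and> ?u * c = \<mu> * a \<and> - ?u * a = \<mu> * c) \<or>
     (\<exists>a c. (a \<noteq> 0 \<or> c \<noteq> 0) \<and> ?v * c = \<mu> * a \<and> - ?v * a = \<mu> * c)"
    (is "?L \<longleftrightarrow> ?A \<or> ?B")
  proof
    show "?L \<Longrightarrow> ?A \<or> ?B" by blast
    assume "?A \<or> ?B"
    then show ?L
    proof
      assume ?A
      then obtain a c where "(a \<noteq> 0 \<or> c \<noteq> 0) \<and> ?u * c = \<mu> * a \<and> - ?u * a = \<mu> * c" by blast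
      then show ?L by - (rule exI[of _ a], rule exI[of _ 0], rule exI[of _ c], rule exI[of _ 0], simp)
    next
      assume ?B
      then obtain b d where "(b \<noteq> 0 \<or> d \<noteq> 0) \<and> ?v * d = \<mu> * b \<and> - ?v * b = \<mu> * d" by blast
      then show ?L
        by - (rule exI[of _ 0], rule exI[of _ b], rule exI[of _ 0], rule exI[of _ d], simp)
    qed
  qed
  finally show "\<mu> \<in> spectrum (map_mat complex_of_real (ee_mat u v)) \<longleftrightarrow>
      \<mu> \<in> {\<i> * of_real u, - \<i> * of_real u, \<i> * of_real v, - \<i> * of_real v}"
    unfolding pair sq by auto
qed

lemma spectrum_ff:
  "spectrum (map_mat complex_of_real (ff_mat u v)) = {Complex u v, Complex u (- v), Complex (- u) v, Complex (- u) (- v)}"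
proof (rule Set.set_eqI)
  fix \<mu> :: complex
  let ?u = "complex_of_real u" and ?v = "complex_of_real v"
  have pair: "(\<exists>a b. (a \<noteq> 0 \<or> b \<noteq> 0) \<and> w * a - ?v * b = \<mu> * a \<and> ?v * a + w * b = \<mu> * b) \<longleftrightarrow> \<mu> = w + \<i> * ?v \<or> \<mu> = w - \<i> * ?v" for w
  proof
    assume "\<exists>a b. (a \<noteq> 0 \<or> b \<noteq> 0) \<and> w * a - ?v * b = \<mu> * a \<and> ?v * a + w * b = \<mu> * b"
    then obtain a b where ab: "a \<noteq> 0 \<or> b \<noteq> 0" "w * a - ?v * b = \<mu> * a" "?v * a + w * b = \<mu> * b" by blast
    have e: "(\<mu> - w) * a = - ?v * b" "(\<mu> - w) * b = ?v * a" using ab(2,3) by (simp_all add: algebra_simps)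
    have "(\<mu> - w - \<i> * ?v) * (\<mu> - w + \<i> * ?v) * a = (\<mu> - w) * ((\<mu> - w) * a) + ?v * ?v * a"
      by (simp add: algebra_simps)
    also have "\<dots> = - ?v * ((\<mu> - w) * b) + ?v * ?v * a" unfolding e(1) by (simp only: mult.left_commute)
    also have "\<dots> = 0" unfolding e(2) by simp
    finally have 1: "(\<mu> - w - \<i> * ?v) * (\<mu> - w + \<i> * ?v) * a = 0" .
    have "(\<mu> - w - \<i> * ?v) * (\<mu> - w + \<i> * ?v) * b = (\<mu> - w) * ((\<mu> - w) * b) + ?v * ?v * b"
      by (simp add: algebra_simps)
    also have "\<dots> = ?v * ((\<mu> - w) * a) + ?v * ?v * b" unfolding e(2) by (simp only: mult.left_commute)
    also have "\<dots> = 0" unfolding e(1) by simp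
    finally have "(\<mu> - w - \<i> * ?v) * (\<mu> - w + \<i> * ?v) * b = 0" .
    with 1 ab(1) have "\<mu> - w - \<i> * ?v = 0 \<or> \<mu> - w + \<i> * ?v = 0" by auto
    then show "\<mu> = w + \<i> * ?v \<or> \<mu> = w - \<i> * ?v" by (auto simp: algebra_simps eq_neg_iff_add_eq_0)
  next
    assume "\<mu> = w + \<i> * ?v \<or> \<mu> = w - \<i> * ?v"
    then show "\<exists>a b. (a \<noteq> 0 \<or> b \<noteq> 0) \<and> w * a - ?v * b = \<mu> * a \<and> ?v * a + w * b = \<mu> * b"
    proof
      assume "\<mu> = w + \<i> * ?v"
      then show ?thesis by - (rule exI[of _ 1], rule exI[of _ "- \<i>"], simp add: algebra_simps)
    next
      assume mu: "\<mu> = w - \<i> * ?v"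
      show ?thesis unfolding mu by (rule exI[of _ 1], rule exI[of _ "\<i>"]) (simp add: algebra_simps)
    qed
  qed
  have "\<mu> \<in> spectrum (map_mat complex_of_real (ff_mat u v)) \<longleftrightarrow>
    (\<exists>a b c d. (a \<noteq> 0 \<or> b \<noteq> 0 \<or> c \<noteq> 0 \<or> d \<noteq> 0) \<and> ?u * a - ?v * b = \<mu> * a \<and> ?v * a + ?u * b = \<mu> * b \<and>
       - ?u * c - ?v * d = \<mu> * c \<and> ?v * c + - ?u * d = \<mu> * d)"
    unfolding spectrum_4_iff[OF ff_mat_carrier] all_less_4 by (simp add: ff_mat_def)
  \<comment> \<open>Positions 0, 1 and 2, 3 decouple; the second system is the first with
    \<open>u\<close> replaced by \<open>- u\<close>.\<close>
  also have "\<dots> \<longleftrightarrow> (\<exists>a b. (a \<noteq> 0 \<or> b \<noteq> 0) \<and> ?u * a - ?v * b = \<mu> * a \<and> ?v * a + ?u * b = \<mu> * b) \<or>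
     (\<exists>a b. (a \<noteq> 0 \<or> b \<noteq> 0) \<and> - ?u * a - ?v * b = \<mu> * a \<and> ?v * a + - ?u * b = \<mu> * b)"
    (is "?L \<longleftrightarrow> ?A \<or> ?B")
  proof
    show "?L \<Longrightarrow> ?A \<or> ?B" by blast
    assume "?A \<or> ?B"
    then show ?L
    proof
      assume ?A
      then obtain a b where "(a \<noteq> 0 \<or> b \<noteq> 0) \<and> ?u * a - ?v * b = \<mu> * a \<and> ?v * a + ?u * b = \<mu> * b" by blast
      then show ?L by - (rule exI[of _ a], rule exI[of _ b], rule exI[of _ 0], rule exI[of _ 0], simp)
    next
      assume ?B
      then obtain c d where "(c \<noteq> 0 \<or> d \<noteq> 0) \<and> - ?u * c - ?v * d = \<mu> * c \<and> ?v * c + - ?u * d = \<mu> * d" by blast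
      then show ?L
        by - (rule exI[of _ 0], rule exI[of _ 0], rule exI[of _ c], rule exI[of _ d], simp)
    qed
  qed
  finally show "\<mu> \<in> spectrum (map_mat complex_of_real (ff_mat u v)) \<longleftrightarrow>
      \<mu> \<in> {Complex u v, Complex u (- v), Complex (- u) v, Complex (- u) (- v)}"
    unfolding pair by (simp add: complex_eq_iff)
qed

section \<open>Types of the critical points\<close>

text \<open>The product exceeds \<open>P * r * D\<^sup>2\<close> by terms of which
  \<open>b * E * (r * D + S)\<close> is strictly positive. It gives the positive determinant of the
  block at a corank one point.\<close>

lemma elliptic_determinant:
  fixes D E P q r S b :: real
  assumes "0 < D" "0 < E" "0 < b" "q\<^sup>2 \<le> P * r" "0 \<le> P" "0 \<le> r" "0 \<le> S" "0 < r \<or> 0 < S"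
  shows "(q * D)\<^sup>2 < (b * E + P * D) * (r * D + S)"
proof -
  have "(q * D)\<^sup>2 \<le> P * r * D\<^sup>2"
    using assms(4) by (simp add: power_mult_distrib mult_right_mono)
  also have "\<dots> < P * r * D\<^sup>2 + (b * E * (r * D + S) + P * D * S)"
  proof -
    have "0 < r * D + S" using assms by (auto simp: add_pos_nonneg add_nonneg_pos)
    then have "0 < b * E * (r * D + S)" using assms by simp
    moreover have "0 \<le> P * D * S" using assms by simp
    ultimately show ?thesis by linarith
  qed
  also have "\<dots> = (b * E + P * D) * (r * D + S)" by (simp add: power2_eq_square algebra_simps)
  finally show ?thesis .
qed

text \<open>A traceless real 2 by 2 matrix with negative determinant has two real eigenvectors;
  scaling one of them makes the pair unimodular, hence symplectic.\<close>

lemma hyperbolic_normal_form: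
  fixes a b c :: real
  assumes "0 < a\<^sup>2 + b * c"
  obtains \<mu> s1 t1 s2 t2 where "\<mu> \<noteq> 0" "s1 * t2 - t1 * s2 = 1"
    "a * s1 + b * t1 = \<mu> * s1" "c * s1 - a * t1 = \<mu> * t1"
    "a * s2 + b * t2 = - \<mu> * s2" "c * s2 - a * t2 = - \<mu> * t2"
proof (cases "b = 0")
  case True
  with assms have a: "a \<noteq> 0" by auto
  show ?thesis
    \<comment> \<open>The instances follow the order in which the variables occur in the goal:
      \<open>\<mu>\<close>, \<open>s1\<close>, \<open>t2\<close>, \<open>t1\<close>,
      \<open>s2\<close>.\<close>
    by (rule that[of a 1 1 "c / (2 * a)" 0]) (use True a in \<open>simp_all add: field_simps\<close>)
next
  case False
  define \<mu> where "\<mu> = sqrt (a\<^sup>2 + b * c)"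
  have \<mu>: "\<mu> \<noteq> 0" "\<mu> * \<mu> = a * a + b * c" using assms by (auto simp: \<mu>_def simp flip: power2_eq_square)
  show ?thesis
  \<comment> \<open>The eigenvectors are \<open>(b, \<mu> - a)\<close> and
    \<open>(b, - \<mu> - a)\<close>, the second scaled by \<open>- 1 / (2 * \<mu> * b)\<close> for
    determinant one; the instances are again in the order \<open>\<mu>\<close>, \<open>s1\<close>,
    \<open>t2\<close>, \<open>t1\<close>, \<open>s2\<close>.\<close>
  proof (rule that[of \<mu> b "(\<mu> + a) / (2 * \<mu> * b)" "\<mu> - a" "- 1 / (2 * \<mu>)"])
    show "\<mu> \<noteq> 0" by (rule \<mu>)
    show "b * ((\<mu> + a) / (2 * \<mu> * b)) - (\<mu> - a) * (- 1 / (2 * \<mu>)) = 1"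
      using \<mu>(1) False by (simp add: field_simps)
    show "a * b + b * (\<mu> - a) = \<mu> * b" by (simp add: algebra_simps)
    show "c * b - a * (\<mu> - a) = \<mu> * (\<mu> - a)" using \<mu>(2) by (simp add: algebra_simps)
    show "a * (- 1 / (2 * \<mu>)) + b * ((\<mu> + a) / (2 * \<mu> * b)) = - \<mu> * (- 1 / (2 * \<mu>))"
      using \<mu>(1) False by (simp add: field_simps)
    have "- \<mu> * (\<mu> + a) - c * b * - 1 = a * - 1 * (\<mu> + a)" using \<mu>(2) by (simp add: algebra_simps)
    then have "c * - b = a * (\<mu> + a) - \<mu> * (\<mu> + a)" by (simp add: algebra_simps)
    then show "c * (- 1 / (2 * \<mu>)) - a * ((\<mu> + a) / (2 * \<mu> * b)) = - \<mu> * ((\<mu> + a) / (2 * \<mu> * b))"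
      using \<mu>(1) False by (simp add: field_simps)
  qed
qed

context ellipsoid
begin

text \<open>The matrices \<open>A c\<close> describe the linearized fields in the frame exactly, so
  the set in the definition of non-degeneracy is \<open>A\<close> applied to the vanishing
  combinations, and each spectrum belongs to a unique matrix.\<close>

lemma nondegenerateI:
  assumes p: "p \<in> M \<alpha>" and r: "corank \<alpha> p = r"
    and v: "v \<in> vanishing_combs \<alpha> p" "snd (snd v) = - 1"
    and e: "symplectic_frame r e" "\<And>i. i < 2 * r \<Longrightarrow> e i \<in> tangent_M \<alpha> p \<and> dEM p (e i) = 0"
    and A: "\<And>c. c \<in> vanishing_combs \<alpha> p \<Longrightarrow> A c \<in> carrier_mat (2 * r) (2 * r)"
      "\<And>c j. c \<in> vanishing_combs \<alpha> p \<Longrightarrow> j < 2 * r \<Longrightarrow> lin_field c p (e j) = (\<Sum>i<2 * r. A c $$ (i, j) *\<^sub>R e i)"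
    and cartan: "cartan_subalgebra r (A ` vanishing_combs \<alpha> p)"
  shows "nondegenerate \<alpha> p e"
    and "c \<in> vanishing_combs \<alpha> p \<Longrightarrow> has_spectrum \<alpha> p e c S \<longleftrightarrow> spectrum (map_mat complex_of_real (A c)) = S"
proof -
  have lin: "linearization \<alpha> p r e c B \<longleftrightarrow> B = A c" if "c \<in> vanishing_combs \<alpha> p" for c B
    by (rule linearization_eq[OF e]) (use A that in auto)
  have "v \<noteq> 0" using v(2) by auto
  then have "critical \<alpha> p" using v(1) p critical_iff by blast
  moreover have "reduced_basis \<alpha> p r e" by (rule reduced_basisI[OF p r v e])
  moreover have "{B. \<exists>c\<in>vanishing_combs \<alpha> p. linearization \<alpha> p r e c B} = A ` vanishing_combs \<alpha> p"
    using lin by blast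
  ultimately show "nondegenerate \<alpha> p e" using cartan by (simp add: nondegenerate_def r)
  show "has_spectrum \<alpha> p e c S \<longleftrightarrow> spectrum (map_mat complex_of_real (A c)) = S" if "c \<in> vanishing_combs \<alpha> p"
    using lin[OF that] by (simp add: has_spectrum_def r)
qed

lemma Gfun_off_axis:
  assumes "off_axis p k" "k = 0 \<and> m = 3 \<or> k = 3 \<and> m = 0"
  shows "Gfun \<alpha> p - ((snd p $ 1)\<^sup>2 + (snd p $ 2)\<^sup>2) =
    ((fst p $ m * snd p $ 1 - fst p $ 1 * snd p $ m)\<^sup>2 + (fst p $ m * snd p $ 2 - fst p $ 2 * snd p $ m)\<^sup>2) / (\<alpha> $ 1 - \<alpha> $ m)"
  using assms by (cases p) (auto simp: Gfun_def off_axis_def power2_commute)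

text \<open>Both curves are treated together: \<open>k\<close> is the vanishing index and
  \<open>m\<close> the other one. Since \<open>\<alpha> $ 1\<close> lies between the two outer
  parameters, \<open>\<beta>\<close> and \<open>\<alpha> $ 1 - \<alpha> $ m\<close> have opposite
  signs, and this makes the block elliptic in either case.\<close>

lemma elliptic_boundary:
  assumes p: "p \<in> M \<alpha>" and h: "0 < Hfun p" and k: "off_axis p k" "\<not> off_axis p m" "k = 0 \<and> m = 3 \<or> k = 3 \<and> m = 0"
  shows "elliptic \<alpha> p"
proof -
  note y = nonzero_of_Hfun_pos[OF h]
  define e where "e = (\<lambda>i::nat. if i = 0 then axis_vec k 1 0 else axis_vec k 0 1)"
  define v where "v = boundary_comb \<alpha> m p"
  have V: "vanishing_combs \<alpha> p = span {v}"
    using vanishing_combs_boundary[OF p h] k by (auto simp: v_def)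
  have r: "corank \<alpha> p = 1" using corank_boundary[OF p h] k by auto
  have vV: "v \<in> vanishing_combs \<alpha> p" unfolding V by (simp add: span_base)
  define P q r where "P = (fst p $ 1)\<^sup>2 + (fst p $ 2)\<^sup>2" and "q = fst p $ 1 * snd p $ 1 + fst p $ 2 * snd p $ 2"
    and "r = (snd p $ 1)\<^sup>2 + (snd p $ 2)\<^sup>2"
  define \<beta> where "\<beta> = \<alpha> $ 1 - \<alpha> $ k"
  define m11 m12 m21 where "m11 = (\<lambda>c::real \<times> real \<times> real. - 2 * snd (snd c) * q / \<beta>)"
    and "m12 = (\<lambda>c::real \<times> real \<times> real. fst c + 2 * snd (snd c) * P / \<beta>)"
    and "m21 = (\<lambda>c::real \<times> real \<times> real. (fst (snd c) * Jfun p + 2 * snd (snd c) * (Gfun \<alpha> p - r)) / \<alpha> $ k - 2 * snd (snd c) * r / \<beta>)"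
  define A where "A = (\<lambda>c. sl2_mat (m11 c) (m12 c) (m21 c))"
  have scale: "m11 (t *\<^sub>R c) = t * m11 c" "m12 (t *\<^sub>R c) = t * m12 c" "m21 (t *\<^sub>R c) = t * m21 c" for t c
    by (simp_all add: m11_def m12_def m21_def add_divide_distrib diff_divide_distrib algebra_simps)
  have AV: "A ` vanishing_combs \<alpha> p = range (\<lambda>t. sl2_mat (t * m11 v) (t * m12 v) (t * m21 v))"
    unfolding V span_singleton A_def by (auto simp: scale image_iff)
  have lin: "lin_field c p (axis_vec k s t) = axis_vec k (m12 c * t + m11 c * s) (m21 c * s - m11 c * t)"
    if "c \<in> vanishing_combs \<alpha> p" for c s t
  proof -
    obtain a b d where c: "c = (a, b, d)" by (metis surj_pair)
    show ?thesis
      unfolding c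
      by (subst lin_field_axis_vec[OF p y k(1)]) (use k that c in \<open>auto simp: m11_def m12_def m21_def P_def q_def r_def \<beta>_def\<close>)
  qed
  have e_tan: "e i \<in> tangent_M \<alpha> p \<and> dEM p (e i) = 0" for i
    using axis_vec_tangent[OF k(1)] dEM_axis_vec_boundary[OF k(1)] k(3) by (auto simp: e_def)
  have frame: "symplectic_frame 1 e"
    by (auto simp: symplectic_frame_def e_def omega_axis_vec all_less_2)
  have neg: "(m11 v)\<^sup>2 + m12 v * m21 v < 0"
  proof -
    \<comment> \<open>\<open>D\<close>, \<open>E\<close> and \<open>S\<close> collect absolute
      values, so that \<open>m12 v\<close> and \<open>m21 v\<close> become opposite signs times
      nonnegative quantities.\<close>
    define D E where "D = inverse \<bar>\<beta>\<bar>" and "E = inverse \<bar>\<alpha> $ 1 - \<alpha> $ m\<bar>"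
    define N where "N = (fst p $ m * snd p $ 1 - fst p $ 1 * snd p $ m)\<^sup>2 + (fst p $ m * snd p $ 2 - fst p $ 2 * snd p $ m)\<^sup>2"
    define S where "S = (\<alpha> $ m * (Jfun p)\<^sup>2 / \<alpha> $ 1 + N) * E / \<alpha> $ k"
    have pos: "0 < D" "0 < E" "0 < \<alpha> $ 1" "0 \<le> P" "0 \<le> r" "0 \<le> N" "0 \<le> S"
      using k(3) \<alpha>01 \<alpha>12 \<alpha>23 \<alpha>_pos[of 0] \<alpha>_pos[of 1] \<alpha>_pos[of 3]
      by (auto simp: D_def E_def \<beta>_def P_def r_def N_def S_def intro!: divide_nonneg_pos mult_nonneg_nonneg add_nonneg_nonneg)
    have lagrange: "P * r = q\<^sup>2 + (Jfun p)\<^sup>2"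
      by (cases p) (simp add: P_def r_def q_def Jfun_def power2_eq_square algebra_simps)
    \<comment> \<open>If both vanished, coordinate pairs 1 and 2 would vanish besides pair
      \<open>k\<close>, which \<open>not_all_off_axis\<close> excludes.\<close>
    have rS: "0 < r \<or> 0 < S"
    proof (rule ccontr)
      assume "\<not> ?thesis"
      with pos have r0: "r = 0" and S0: "S = 0" by linarith+
      from r0 have y12: "snd p $ 1 = 0" "snd p $ 2 = 0" by (auto simp: r_def)
      have "0 \<le> \<alpha> $ m * (Jfun p)\<^sup>2 / \<alpha> $ 1" using \<alpha>_pos[of m] pos by simp
      moreover have "\<alpha> $ m * (Jfun p)\<^sup>2 / \<alpha> $ 1 + N = 0" using S0 pos \<alpha>_pos[of k] by (auto simp: S_def)
      ultimately have "N = 0" using pos by linarith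
      then have N0: "fst p $ 1 * snd p $ m = 0" "fst p $ 2 * snd p $ m = 0" by (auto simp: N_def y12 sum_power2_eq_zero_iff)
      have ym: "snd p $ m \<noteq> 0"
        using y y12 k by (auto simp: off_axis_def cart_eq_iff all_index_4)
      then have "off_axis p 1" "off_axis p 2" using N0 y12 by (auto simp: off_axis_def)
      then show False using not_all_off_axis[OF p h] k by auto
    qed
    have GN: "Gfun \<alpha> p - r = N / (\<alpha> $ 1 - \<alpha> $ m)"
      unfolding r_def N_def by (rule Gfun_off_axis[OF k(1,3)])
    have vv: "fst v = 2 * \<alpha> $ 1 / (\<alpha> $ 1 - \<alpha> $ m)" "fst (snd v) = - 2 * \<alpha> $ m * Jfun p / (\<alpha> $ 1 * (\<alpha> $ 1 - \<alpha> $ m))" "snd (snd v) = - 1"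
      by (simp_all add: v_def boundary_comb_def)
    have "(q * D)\<^sup>2 < (\<alpha> $ 1 * E + P * D) * (r * D + S)"
      by (rule elliptic_determinant) (use pos rS lagrange in auto)
    moreover have "(m11 v)\<^sup>2 = 4 * (q * D)\<^sup>2"
    proof -
      have D2: "D * D = inverse \<beta> * inverse \<beta>"
        by (simp add: D_def abs_mult_self_eq flip: inverse_mult_distrib)
      have "(m11 v)\<^sup>2 = 4 * q * q * (inverse \<beta> * inverse \<beta>)"
        by (simp add: m11_def vv power2_eq_square divide_inverse)
      then show ?thesis unfolding D2[symmetric] by (simp add: power2_eq_square)
    qed
    moreover have "m12 v * m21 v = - 4 * ((\<alpha> $ 1 * E + P * D) * (r * D + S))"
    proof -
      \<comment> \<open>\<open>\<sigma>\<close> is the sign of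
        \<open>\<alpha> $ 1 - \<alpha> $ m\<close>; it cancels in the product of the off-diagonal
        entries.\<close>
      obtain \<sigma> :: real where \<sigma>: "\<sigma> * \<sigma> = 1" "inverse (\<alpha> $ 1 - \<alpha> $ m) = \<sigma> * E" "inverse \<beta> = - \<sigma> * D"
      proof (rule that[of "sgn (\<alpha> $ 1 - \<alpha> $ m)"])
        have *: "\<alpha> $ 1 - \<alpha> $ 0 > 0" "\<alpha> $ 1 - \<alpha> $ 3 < 0" using \<alpha>01 \<alpha>12 \<alpha>23 by auto
        show "sgn (\<alpha> $ 1 - \<alpha> $ m) * sgn (\<alpha> $ 1 - \<alpha> $ m) = 1" using * k(3) by auto
        show "inverse (\<alpha> $ 1 - \<alpha> $ m) = sgn (\<alpha> $ 1 - \<alpha> $ m) * E" using * k(3)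
          by (auto simp: E_def simp flip: inverse_minus_eq)
        show "inverse \<beta> = - sgn (\<alpha> $ 1 - \<alpha> $ m) * D" using * k(3) by (auto simp: D_def \<beta>_def simp flip: inverse_minus_eq)
      qed
      have 12: "m12 v = 2 * \<sigma> * (\<alpha> $ 1 * E + P * D)"
        unfolding m12_def vv divide_inverse \<sigma> by (simp add: algebra_simps)
      have 21: "m21 v = - 2 * \<sigma> * (r * D + S)"
      proof -
        have "m21 v = (- 2 * \<alpha> $ m * Jfun p * (inverse (\<alpha> $ 1) * inverse (\<alpha> $ 1 - \<alpha> $ m)) * Jfun p
            - 2 * (N * inverse (\<alpha> $ 1 - \<alpha> $ m))) * inverse (\<alpha> $ k) + 2 * r * inverse \<beta>"
          unfolding m21_def vv GN divide_inverse by simp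
        then show ?thesis
          unfolding \<sigma> S_def divide_inverse by (simp add: power2_eq_square algebra_simps)
      qed
      have "m12 v * m21 v = - 4 * (\<sigma> * \<sigma>) * ((\<alpha> $ 1 * E + P * D) * (r * D + S))"
        unfolding 12 21 by simp
      then show ?thesis unfolding \<sigma>(1) by simp
    qed
    ultimately show ?thesis by linarith
  qed
  have nth: "e 0 = axis_vec k 1 0" "e 1 = axis_vec k 0 1" "e (Suc 0) = axis_vec k 0 1" by (simp_all add: e_def)
  have A: "A c \<in> carrier_mat (2 * 1) (2 * 1)"
    "j < 2 * 1 \<Longrightarrow> lin_field c p (e j) = (\<Sum>i<2 * 1. A c $$ (i, j) *\<^sub>R e i)" if "c \<in> vanishing_combs \<alpha> p" for c j
  proof -
    show "A c \<in> carrier_mat (2 * 1) (2 * 1)" by (simp add: A_def)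
    assume "j < 2 * 1"
    then have "j = 0 \<or> j = 1" by auto
    then show "lin_field c p (e j) = (\<Sum>i<2 * 1. A c $$ (i, j) *\<^sub>R e i)"
      by (auto simp: nth lin[OF that] sum_less_2 A_def sl2_mat_def axis_vec_scaleR axis_vec_add)
  qed
  have v1: "snd (snd v) = - 1" by (simp add: v_def boundary_comb_def)
  have cartan: "cartan_subalgebra 1 (A ` vanishing_combs \<alpha> p)"
    unfolding AV by (rule cartan_subalgebra_sl2[OF neg])
  have nd1: "nondegenerate \<alpha> p e"
    by (rule nondegenerateI(1)[OF p r vV v1 frame e_tan _ _ cartan]) (use A in auto)
  have nd2: "has_spectrum \<alpha> p e c S \<longleftrightarrow> spectrum (map_mat complex_of_real (A c)) = S"
    if "c \<in> vanishing_combs \<alpha> p" for c S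
    by (rule nondegenerateI(2)[OF p r vV v1 frame e_tan _ _ cartan that]) (use A in auto)
  define w where "w = sqrt (- ((m11 v)\<^sup>2 + m12 v * m21 v))"
  have w: "w \<noteq> 0" "(m11 v)\<^sup>2 + m12 v * m21 v = - w\<^sup>2" using neg by (simp_all add: w_def)
  have "m12 v \<noteq> 0" using neg by (auto simp: not_less)
  then have "has_spectrum \<alpha> p e v {\<i> * of_real w, - \<i> * of_real w}"
    using nd2[OF vV] spectrum_sl2[OF w(2)] by (simp add: A_def)
  then show ?thesis
    using nd1 w(1) vV r by (auto simp: elliptic_def)
qed

lemma elliptic_elliptic_equator:
  assumes p: "p \<in> M \<alpha>" and h: "0 < Hfun p" and o: "off_axis p 0" "off_axis p 3"
  shows "elliptic_elliptic \<alpha> p"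
proof -
  note y = nonzero_of_Hfun_pos[OF h]
  define b where "b = \<alpha> $ 1"
  define r where "r = (snd p $ 1)\<^sup>2 + (snd p $ 2)\<^sup>2"
  have b: "0 < b" using \<alpha>_pos[of 1] by (simp add: b_def)
  note eq = equator_eqs[OF p o]
  have r: "2 * Hfun p = r" using o by (cases p) (simp add: r_def Hfun_def off_axis_def)
  have rpos: "0 < r" using h r by simp
  have G: "Gfun \<alpha> p = r" using o by (cases p) (simp add: r_def Gfun_def off_axis_def)
  have JJ: "Jfun p * Jfun p = b * r"
  proof -
    have "Jfun p * Jfun p = ((fst p $ 1)\<^sup>2 + (fst p $ 2)\<^sup>2) * r - (fst p $ 1 * snd p $ 1 + fst p $ 2 * snd p $ 2)\<^sup>2"
      by (cases p) (simp add: Jfun_def r_def power2_eq_square algebra_simps)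
    then show ?thesis unfolding eq by (simp add: b_def)
  qed
  have cor: "corank \<alpha> p = 2" by (rule corank_equator[OF p h o])
  have V: "(a, d, g) \<in> vanishing_combs \<alpha> p \<longleftrightarrow> Jfun p * a + b * d + 2 * Jfun p * g = 0" for a d g
    unfolding vanishing_combs_equator[OF p h o] b_def by (simp add: add.assoc)
  define \<nu> where "\<nu> = (\<lambda>k. sqrt (r / \<alpha> $ k))"
  have \<nu>: "0 < \<nu> k" "\<nu> k * \<nu> k = r / \<alpha> $ k" for k
    using rpos \<alpha>_pos[of k] by (simp_all add: \<nu>_def)
  define w where "w = (\<lambda>k (c::real \<times> real \<times> real). \<nu> k * (fst c + 2 * snd (snd c) * b / (b - \<alpha> $ k)))"
  \<comment> \<open>Scaling position by \<open>s k\<close> and momentum by its inverse preserves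
    \<open>omega\<close> and turns the block of index \<open>k\<close> into a rotation with
    frequency \<open>w k c\<close>.\<close>
  define s where "s = (\<lambda>k. 1 / sqrt (\<nu> k))"
  have s: "s k * s k = 1 / \<nu> k" "s k \<noteq> 0" "s k * inverse (s k) = 1" for k
    using \<nu>(1)[of k] by (simp_all add: s_def)
  have dbk: "b - \<alpha> $ 0 > 0" "b - \<alpha> $ 3 < 0" using \<alpha>01 \<alpha>12 \<alpha>23 by (auto simp: b_def)
  have lin: "lin_field c p (axis_vec k (s k) 0) = axis_vec k 0 (- w k c / s k)"
    "lin_field c p (axis_vec k 0 (1 / s k)) = axis_vec k (w k c * s k) 0"
    if c: "c \<in> vanishing_combs \<alpha> p" and k: "k = 0 \<or> k = 3" for c k
  proof -
    obtain a d g where cc: "c = (a, d, g)" by (metis surj_pair)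
    have ok: "off_axis p k" using k o by auto
    have bk: "b - \<alpha> $ k \<noteq> 0" "\<alpha> $ k \<noteq> 0" using k dbk \<alpha>_pos[of k] by auto
    define f where "f = a + 2 * g * b / (b - \<alpha> $ k)"
    have wf: "w k c = \<nu> k * f" by (simp add: w_def cc f_def)
    \<comment> \<open>Multiplying the relation for vanishing combinations by \<open>Jfun p\<close>
      lets \<open>J * J = b * r\<close> eliminate \<open>J\<close>, so both orientations of the
      equator are covered.\<close>
    have "0 = Jfun p * (Jfun p * a + b * d + 2 * Jfun p * g)" using c cc V by simp
    also have "\<dots> = (Jfun p * Jfun p) * a + b * (d * Jfun p) + 2 * (Jfun p * Jfun p) * g" by (simp add: algebra_simps)
    also have "\<dots> = b * (r * a + d * Jfun p + 2 * r * g)" unfolding JJ by (simp add: algebra_simps)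
    finally have "r * a + d * Jfun p + 2 * r * g = 0" using b by simp
    then have dJ: "d * Jfun p = - r * (a + 2 * g)" by (simp add: algebra_simps)
    have m21: "d * Jfun p / \<alpha> $ k - 2 * g * r / (b - \<alpha> $ k) = - (r / \<alpha> $ k) * f"
      unfolding dJ f_def using bk by (simp add: field_simps)
    have L: "lin_field c p (axis_vec k u t) = axis_vec k (f * t) (- (r / \<alpha> $ k) * f * u)" for u t
    proof -
      have "lin_field c p (axis_vec k u t) = axis_vec k (f * t) ((d * Jfun p / \<alpha> $ k - 2 * g * r / (b - \<alpha> $ k)) * u)"
        unfolding cc by (subst lin_field_axis_vec[OF p y ok k])
          (use c cc eq G in \<open>simp_all add: f_def r_def b_def\<close>)
      then show ?thesis unfolding m21 .
    qed
    have "r / \<alpha> $ k * f * s k = \<nu> k * f * (\<nu> k * s k)" unfolding \<nu>(2)[symmetric] by simp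
    also have "\<nu> k * s k = 1 / s k" using s[of k] \<nu>(1)[of k] by (simp add: field_simps)
    finally have 1: "r / \<alpha> $ k * f * s k = w k c / s k" by (simp add: wf)
    have 2: "f * (1 / s k) = w k c * s k"
      using s[of k] \<nu>(1)[of k] by (simp add: wf field_simps)
    show "lin_field c p (axis_vec k (s k) 0) = axis_vec k 0 (- w k c / s k)"
      unfolding L using 1 by simp
    show "lin_field c p (axis_vec k 0 (1 / s k)) = axis_vec k (w k c * s k) 0"
      unfolding L 2 by simp
  qed
  define e where "e = (\<lambda>i::nat. if i = 0 then axis_vec 0 (s 0) 0 else if i = 1 then axis_vec 3 (s 3) 0
    else if i = 2 then axis_vec 0 0 (1 / s 0) else axis_vec 3 0 (1 / s 3))"
  have nth: "e 0 = axis_vec 0 (s 0) 0" "e 1 = axis_vec 3 (s 3) 0" "e (Suc 0) = axis_vec 3 (s 3) 0"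
    "e 2 = axis_vec 0 0 (1 / s 0)" "e 3 = axis_vec 3 0 (1 / s 3)" by (simp_all add: e_def)
  have e_tan: "e i \<in> tangent_M \<alpha> p \<and> dEM p (e i) = 0" for i
    using axis_vec_tangent o dEM_axis_vec_boundary by (auto simp: e_def)
  have frame: "symplectic_frame 2 e"
    unfolding symplectic_frame_def using s(2) by (simp add: all_less_4 nth omega_axis_vec)
  define A where "A = (\<lambda>c. ee_mat (w 0 c) (w 3 c))"
  have A: "A c \<in> carrier_mat (2 * 2) (2 * 2)"
    "j < 2 * 2 \<Longrightarrow> lin_field c p (e j) = (\<Sum>i<2 * 2. A c $$ (i, j) *\<^sub>R e i)" if "c \<in> vanishing_combs \<alpha> p" for c j
  proof -
    show "A c \<in> carrier_mat (2 * 2) (2 * 2)" by (simp add: A_def)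
    assume "j < 2 * 2"
    then have "j = 0 \<or> j = 1 \<or> j = 2 \<or> j = 3" by auto
    then show "lin_field c p (e j) = (\<Sum>i<2 * 2. A c $$ (i, j) *\<^sub>R e i)"
      by (elim disjE) (simp_all add: nth lin[OF that] sum_less_4 A_def ee_mat_def axis_vec_scaleR axis_vec_zero)
  qed
  have AV: "A ` vanishing_combs \<alpha> p = {ee_mat u v |u v. True}"
  proof (intro Set.set_eqI iffI)
    fix B assume "B \<in> {ee_mat u v |u v. True}"
    then obtain u v where B: "B = ee_mat u v" by blast
    define u' v' where "u' = u / \<nu> 0" and "v' = v / \<nu> 3"
    define \<delta> where "\<delta> = 1 / (b - \<alpha> $ 0) - 1 / (b - \<alpha> $ 3)"
    have "1 / (b - \<alpha> $ 0) > 0" "1 / (b - \<alpha> $ 3) < 0" using dbk by simp_all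
    then have \<delta>: "\<delta> > 0" unfolding \<delta>_def by linarith
    \<comment> \<open>The frequencies divided by \<open>\<nu> 0\<close> and \<open>\<nu> 3\<close>
      differ by \<open>2 * g * b * \<delta>\<close>, which determines \<open>g\<close>; then
      \<open>a\<close> follows from the first frequency and the \<open>J\<close> coefficient from
      the vanishing condition.\<close>
    define g where "g = (u' - v') / (2 * b * \<delta>)"
    define a where "a = u' - 2 * g * b / (b - \<alpha> $ 0)"
    define c where "c = (a, - Jfun p * (a + 2 * g) / b, g)"
    have cV: "c \<in> vanishing_combs \<alpha> p"
    proof -
      have "b * (- Jfun p * (a + 2 * g) / b) = - Jfun p * (a + 2 * g)" using b by simp
      then show ?thesis unfolding c_def V by (simp add: algebra_simps)
    qed
    have "2 * g * b * \<delta> = u' - v'" using b \<delta> by (simp add: g_def)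
    then have "2 * g * b / (b - \<alpha> $ 0) - 2 * g * b / (b - \<alpha> $ 3) = u' - v'" by (simp add: \<delta>_def right_diff_distrib)
    then have "w 0 c = \<nu> 0 * u'" "w 3 c = \<nu> 3 * v'" by (simp_all add: w_def c_def a_def)
    then have "A c = B" using \<nu>(1) by (simp add: A_def B u'_def v'_def less_imp_neq[symmetric])
    then show "B \<in> A ` vanishing_combs \<alpha> p" using cV by blast
  qed (auto simp: A_def)
  define v where "v = boundary_comb \<alpha> 0 p"
  have v: "v \<in> vanishing_combs \<alpha> p" "snd (snd v) = - 1"
    using boundary_comb_vanishing(1)[OF p y o(2)] by (simp_all add: v_def boundary_comb_def)
  have cartan: "cartan_subalgebra 2 (A ` vanishing_combs \<alpha> p)"
    unfolding AV by (rule cartan_subalgebra_ee)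
  have nd1: "nondegenerate \<alpha> p e"
    by (rule nondegenerateI(1)[OF p cor v frame e_tan _ _ cartan]) (use A in auto)
  have nd2: "has_spectrum \<alpha> p e c S \<longleftrightarrow> spectrum (map_mat complex_of_real (A c)) = S"
    if "c \<in> vanishing_combs \<alpha> p" for c S
    by (rule nondegenerateI(2)[OF p cor v frame e_tan _ _ cartan that]) (use A in auto)
  have spec: "has_spectrum \<alpha> p e c {\<i> * of_real (w 0 c), - \<i> * of_real (w 0 c), \<i> * of_real (w 3 c), - \<i> * of_real (w 3 c)}"
    if "c \<in> vanishing_combs \<alpha> p" for c
    using nd2[OF that] by (simp add: A_def spectrum_ee)
  have "linear (w k)" for k
    by (rule linearI) (simp_all add: w_def algebra_simps add_divide_distrib)
  moreover have "x = 0 \<and> z = 0" if xz: "\<forall>c\<in>vanishing_combs \<alpha> p. x * w 0 c + z * w 3 c = 0" for x z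
  proof -
    \<comment> \<open>On these two combinations the frequencies are \<open>\<nu> k\<close> and
      \<open>\<nu> k * 2 * b / (b - \<alpha> $ k)\<close>; the resulting 2 by 2 system is regular
      because \<open>\<alpha> $ 0 < b < \<alpha> $ 3\<close>.\<close>
    have "(1, - Jfun p / b, 0) \<in> vanishing_combs \<alpha> p" "(0, - 2 * Jfun p / b, 1) \<in> vanishing_combs \<alpha> p"
      unfolding V using b by simp_all
    note c = bspec[OF xz this(1)] bspec[OF xz this(2)]
    have 1: "x * \<nu> 0 + z * \<nu> 3 = 0" using c(1) by (simp add: w_def)
    have "2 * b * (x * \<nu> 0 / (b - \<alpha> $ 0) + z * \<nu> 3 / (b - \<alpha> $ 3)) = 0" using c(2) by (simp add: w_def algebra_simps)
    then have 2: "x * \<nu> 0 / (b - \<alpha> $ 0) + z * \<nu> 3 / (b - \<alpha> $ 3) = 0" using b by simp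
    have "z * \<nu> 3 = - (x * \<nu> 0)" using 1 by simp
    then have "x * \<nu> 0 * (1 / (b - \<alpha> $ 0) - 1 / (b - \<alpha> $ 3)) = 0" using 2 by (simp add: right_diff_distrib)
    moreover have "1 / (b - \<alpha> $ 0) > 0" "1 / (b - \<alpha> $ 3) < 0" using dbk by simp_all
    ultimately have "x * \<nu> 0 = 0" by auto
    then show ?thesis using 1 \<nu>(1)[of 0] \<nu>(1)[of 3] by auto
  qed
  ultimately show ?thesis
    unfolding elliptic_elliptic_def
    using cor nd1 spec by blast
qed

lemma focus_focus_meridian:
  assumes p: "p \<in> M \<alpha>" and h: "0 < Hfun p" and o: "off_axis p 1" "off_axis p 2"
  shows "focus_focus \<alpha> p"
proof -
  note y = nonzero_of_Hfun_pos[OF h]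
  define A B C where "A = 1 + (fst p $ 0)\<^sup>2 / (\<alpha> $ 1 - \<alpha> $ 0) + (fst p $ 3)\<^sup>2 / (\<alpha> $ 1 - \<alpha> $ 3)"
    and "B = fst p $ 0 * snd p $ 0 / (\<alpha> $ 1 - \<alpha> $ 0) + fst p $ 3 * snd p $ 3 / (\<alpha> $ 1 - \<alpha> $ 3)"
    and "C = (snd p $ 0)\<^sup>2 / (\<alpha> $ 1 - \<alpha> $ 0) + (snd p $ 3)\<^sup>2 / (\<alpha> $ 1 - \<alpha> $ 3)"
  have cor: "corank \<alpha> p = 2" by (rule corank_meridian[OF p h o])
  have V: "(a, b, d) \<in> vanishing_combs \<alpha> p \<longleftrightarrow> a = 0" for a b d
    unfolding vanishing_combs_meridian[OF p h o] by simp
  note lin = lin_field_meridian[OF p y o, folded A_def B_def C_def]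
  \<comment> \<open>The negative determinant of the block with rows (\<open>- B\<close>,
    \<open>A\<close>) and (\<open>- C\<close>, \<open>B\<close>). Its sign makes the motion
    generated by \<open>G\<close> hyperbolic in each copy.\<close>
  have "0 < (- B)\<^sup>2 + A * - C"
  proof -
    obtain x0 x3 y0 y3 where xy: "x0 = fst p $ 0" "x3 = fst p $ 3" "y0 = snd p $ 0" "y3 = snd p $ 3" by blast
    define \<epsilon> \<delta> where "\<epsilon> = \<alpha> $ 1 - \<alpha> $ 0" and "\<delta> = \<alpha> $ 3 - \<alpha> $ 1"
    have ed: "0 < \<epsilon>" "0 < \<delta>" using \<alpha>01 \<alpha>12 \<alpha>23 by (auto simp: \<epsilon>_def \<delta>_def)
    have minus: "\<alpha> $ 1 - \<alpha> $ 3 = - \<delta>" by (simp add: \<delta>_def)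
    define a c where "a = \<alpha> $ 0" and "c = \<alpha> $ 3"
    have ac: "0 < a" "0 < c" using \<alpha>_pos by (simp_all add: a_def c_def)
    have m: "x0\<^sup>2 / a + x3\<^sup>2 / c = 1" "x0 * y0 / a + x3 * y3 / c = 0"
      using M_eqs[OF p] o by (simp_all add: off_axis_def xy a_def c_def)
    \<comment> \<open>Lagrange's identity in the metric of the ellipse cut out by the (0, 3) plane,
      with both constraints inserted.\<close>
    have L: "(x0 * y3 - x3 * y0)\<^sup>2 = c * y0\<^sup>2 + a * y3\<^sup>2"
    proof -
      have "(x0 * y3 - x3 * y0)\<^sup>2 / (a * c) = (x0\<^sup>2 / a + x3\<^sup>2 / c) * (y0\<^sup>2 / a + y3\<^sup>2 / c) - (x0 * y0 / a + x3 * y3 / c)\<^sup>2"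
        using ac by (simp add: power2_eq_square field_simps)
      also have "\<dots> = y0\<^sup>2 / a + y3\<^sup>2 / c" unfolding m by simp
      finally show ?thesis using ac by (simp add: field_simps)
    qed
    have "(- B)\<^sup>2 + A * - C = ((x0 * y3 - x3 * y0)\<^sup>2 - \<delta> * y0\<^sup>2 + \<epsilon> * y3\<^sup>2) / (\<epsilon> * \<delta>)"
      unfolding A_def B_def C_def xy[symmetric] \<epsilon>_def[symmetric] minus
      using ed by (simp add: power2_eq_square field_simps)
    also have "\<dots> = \<alpha> $ 1 * (y0\<^sup>2 + y3\<^sup>2) / (\<epsilon> * \<delta>)"
      unfolding L by (simp add: \<epsilon>_def \<delta>_def a_def c_def algebra_simps)
    also have "\<dots> > 0"
    proof -
      have "y0 \<noteq> 0 \<or> y3 \<noteq> 0"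
        using y o by (auto simp: xy off_axis_def cart_eq_iff all_index_4)
      then have "0 < y0\<^sup>2 + y3\<^sup>2" by (simp add: sum_power2_gt_zero_iff)
      then show ?thesis using ed \<alpha>_pos[of 1] by simp
    qed
    finally show ?thesis .
  qed
  then obtain \<mu> s1 t1 s2 t2 where \<mu>: "\<mu> \<noteq> 0" "s1 * t2 - t1 * s2 = 1"
    "- B * s1 + A * t1 = \<mu> * s1" "- C * s1 - - B * t1 = \<mu> * t1"
    "- B * s2 + A * t2 = - \<mu> * s2" "- C * s2 - - B * t2 = - \<mu> * t2"
    by (rule hyperbolic_normal_form)
  have eig: "A * t1 - B * s1 = \<mu> * s1" "B * t1 - C * s1 = \<mu> * t1" "A * t2 - B * s2 = - \<mu> * s2" "B * t2 - C * s2 = - \<mu> * t2"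
    using \<mu>(3-6) by (simp_all add: algebra_simps)
  \<comment> \<open>The same eigenvectors are placed at index 1 and at index 2, so \<open>G\<close>
    acts diagonally and the rotation of \<open>J\<close> keeps each eigenspace.\<close>
  define e where "e = (\<lambda>i::nat. if i = 0 then axis_vec 1 s1 t1 else if i = 1 then axis_vec 2 s1 t1
    else if i = 2 then axis_vec 1 s2 t2 else axis_vec 2 s2 t2)"
  have nth: "e 0 = axis_vec 1 s1 t1" "e 1 = axis_vec 2 s1 t1" "e (Suc 0) = axis_vec 2 s1 t1"
    "e 2 = axis_vec 1 s2 t2" "e 3 = axis_vec 2 s2 t2" by (simp_all add: e_def)
  have e_tan: "e i \<in> tangent_M \<alpha> p \<and> dEM p (e i) = 0" for i
    using axis_vec_tangent o dEM_axis_vec_meridian by (auto simp: e_def)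
  have frame: "symplectic_frame 2 e"
    unfolding symplectic_frame_def using \<mu>(2) by (simp add: all_less_4 nth omega_axis_vec) (simp add: algebra_simps)
  define F where "F = (\<lambda>c::real \<times> real \<times> real. ff_mat (2 * snd (snd c) * \<mu>) (fst (snd c)))"
  have F: "F c \<in> carrier_mat (2 * 2) (2 * 2)"
    "j < 2 * 2 \<Longrightarrow> lin_field c p (e j) = (\<Sum>i<2 * 2. F c $$ (i, j) *\<^sub>R e i)" if c: "c \<in> vanishing_combs \<alpha> p" for c j
  proof -
    show "F c \<in> carrier_mat (2 * 2) (2 * 2)" by (simp add: F_def)
    obtain b d where cc: "c = (0, b, d)" using c V by (metis surj_pair)
    note l = lin[OF c[unfolded cc]]
    assume "j < 2 * 2"
    then have "j = 0 \<or> j = 1 \<or> j = 2 \<or> j = 3" by auto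
    then show "lin_field c p (e j) = (\<Sum>i<2 * 2. F c $$ (i, j) *\<^sub>R e i)"
      by (elim disjE)
        (simp_all add: cc nth l eig sum_less_4 F_def ff_mat_def axis_vec_scaleR axis_vec_zero axis_vec_add add.commute mult.assoc)
  qed
  have FV: "F ` vanishing_combs \<alpha> p = {ff_mat u v |u v. True}"
  proof (intro Set.set_eqI iffI)
    fix X assume "X \<in> {ff_mat u v |u v. True}"
    then obtain u v where X: "X = ff_mat u v" by blast
    have "(0, v, u / (2 * \<mu>)) \<in> vanishing_combs \<alpha> p" "F (0, v, u / (2 * \<mu>)) = X"
      using V \<mu>(1) by (simp_all add: F_def X)
    then show "X \<in> F ` vanishing_combs \<alpha> p" by blast
  qed (auto simp: F_def)
  have v: "(0, 0, - 1) \<in> vanishing_combs \<alpha> p" "snd (snd (0::real, 0::real, - 1 :: real)) = - 1" using V by simp_all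
  have cartan: "cartan_subalgebra 2 (F ` vanishing_combs \<alpha> p)"
    unfolding FV by (rule cartan_subalgebra_ff)
  have nd1: "nondegenerate \<alpha> p e"
    by (rule nondegenerateI(1)[OF p cor v frame e_tan _ _ cartan]) (use F in auto)
  have nd2: "has_spectrum \<alpha> p e c S \<longleftrightarrow> spectrum (map_mat complex_of_real (F c)) = S"
    if "c \<in> vanishing_combs \<alpha> p" for c S
    by (rule nondegenerateI(2)[OF p cor v frame e_tan _ _ cartan that]) (use F in auto)
  \<comment> \<open>A combination of \<open>J\<close> and \<open>G\<close> has a genuine complex
    quadruple exactly when neither coefficient is zero.\<close>
  define U where "U = vanishing_combs \<alpha> p \<inter> {c. fst (snd c) \<noteq> 0 \<and> snd (snd c) \<noteq> 0}"
  have "open {c::real \<times> real \<times> real. fst (snd c) \<noteq> 0 \<and> snd (snd c) \<noteq> 0}"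
    by (intro open_Collect_conj open_Collect_neq continuous_intros)
  then have "openin (top_of_set (vanishing_combs \<alpha> p)) U"
    unfolding U_def by (rule openin_open_Int)
  moreover have "vanishing_combs \<alpha> p \<subseteq> closure U"
  proof
    fix c assume c: "c \<in> vanishing_combs \<alpha> p"
    \<comment> \<open>A sign with the value 1 at zero, so that the added term moves each coefficient
      away from zero.\<close>
    define \<sigma> where "\<sigma> = (\<lambda>t::real. if t < 0 then - 1 else 1 :: real)"
    define f where "f = (\<lambda>n::nat. c + inverse (real (Suc n)) *\<^sub>R (0, \<sigma> (fst (snd c)), \<sigma> (snd (snd c))))"
    have "f n \<in> U" for n
    proof -
      have \<sigma>: "t + inverse (real (Suc n)) * \<sigma> t \<noteq> 0" for t
      proof (cases "t < 0")
        case True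
        then have "t + inverse (real (Suc n)) * \<sigma> t < 0" by (simp add: \<sigma>_def) (smt (verit) inverse_positive_iff_positive of_nat_0_le_iff)
        then show ?thesis by simp
      next
        case False
        then have "t + inverse (real (Suc n)) * \<sigma> t > 0" by (simp add: \<sigma>_def) (smt (verit) inverse_positive_iff_positive of_nat_0_le_iff)
        then show ?thesis by simp
      qed
      have "(0, \<sigma> (fst (snd c)), \<sigma> (snd (snd c))) \<in> vanishing_combs \<alpha> p" using V by simp
      then have "f n \<in> vanishing_combs \<alpha> p"
        unfolding f_def
        by (intro subspace_add[OF subspace_vanishing_combs c] subspace_scale[OF subspace_vanishing_combs])
      then show ?thesis using \<sigma> by (simp add: U_def f_def)
    qed
    moreover have "f \<longlonglongrightarrow> c + 0 *\<^sub>R (0, \<sigma> (fst (snd c)), \<sigma> (snd (snd c)))"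
      unfolding f_def by (intro tendsto_intros LIMSEQ_inverse_real_of_nat)
    then have "f \<longlonglongrightarrow> c" by (simp flip: zero_prod_def)
    ultimately show "c \<in> closure U" unfolding closure_sequential by blast
  qed
  moreover have "\<exists>a b. a \<noteq> 0 \<and> b \<noteq> 0 \<and> has_spectrum \<alpha> p e c {Complex a b, Complex a (- b), Complex (- a) b, Complex (- a) (- b)}"
    if "c \<in> U" for c
  proof (intro exI conjI)
    show "2 * snd (snd c) * \<mu> \<noteq> 0" "fst (snd c) \<noteq> 0" using that \<mu>(1) by (simp_all add: U_def)
    show "has_spectrum \<alpha> p e c {Complex (2 * snd (snd c) * \<mu>) (fst (snd c)), Complex (2 * snd (snd c) * \<mu>) (- fst (snd c)),
       Complex (- (2 * snd (snd c) * \<mu>)) (fst (snd c)), Complex (- (2 * snd (snd c) * \<mu>)) (- fst (snd c))}"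
      using nd2[of c] that by (simp add: U_def F_def spectrum_ff)
  qed
  ultimately show ?thesis
    unfolding focus_focus_def using cor nd1 by blast
qed

end

section \<open>The image of the energy momentum map\<close>

text \<open>The two sides differ by \<open>a * b / (b - a)\<close> times the relation
  \<open>rel\<close>. That multiple removes \<open>z0\<close>, \<open>s0\<close>, \<open>u\<close>
  and \<open>j2\<close>. Exchanging \<open>a\<close> with \<open>c\<close> and the indices 0 and 3
  gives the version for the other curve.\<close>

lemma sum_squares_normal_form:
  fixes a b c s0 s3 s03 j2 u z0 z3 :: real
  assumes ab: "a \<noteq> 0" "b \<noteq> 0" "c \<noteq> 0" "a \<noteq> b" "b \<noteq> c" "a \<noteq> c"
    and rel: "s0 / (a * b) + s3 / (b * c) + s03 / (a * c) + j2 / (b * b) = z0 / a + u / b + z3 / c"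
  shows "2 * b / (b - a) * ((z0 + u + z3) / 2) - a / (b * (b - a)) * j2 - (u + s0 / (b - a) + s3 / (b - c)) =
      b * (c - a) / (c * (b - a)) * (z3 + s3 / (c - b) + s03 / (c - a))"
proof -
  have *: "2 * b / (b - a) * ((z0 + u + z3) / 2) - a / (b * (b - a)) * j2 - (u + s0 / (b - a) + s3 / (b - c))
      - b * (c - a) / (c * (b - a)) * (z3 + s3 / (c - b) + s03 / (c - a)) =
    a * b / (b - a) * (z0 / a + u / b + z3 / c - (s0 / (a * b) + s3 / (b * c) + s03 / (a * c) + j2 / (b * b)))"
  proof -
    define d e where "d = b - a" and "e = c - b"
    have de: "d \<noteq> 0" "e \<noteq> 0" "d + e \<noteq> 0" using ab by (auto simp: d_def e_def)
    have e': "b - a = d" "c - b = e" "b - c = - e" "c - a = d + e" by (auto simp: d_def e_def)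
    have z: "2 * b / d * ((z0 + u + z3) / 2) - u - b * (d + e) / (c * d) * z3 = a * b / d * (z0 / a + u / b + z3 / c)"
    proof -
      have "b * (d + e) + a * b = b * c" by (simp add: d_def e_def algebra_simps)
      have "2 * b / d * ((z0 + u + z3) / 2) = b / d * z0 + b / d * u + b / d * z3" by (simp add: distrib_left add_divide_distrib)
      moreover have "a * b / d * (z0 / a + u / b + z3 / c) = b / d * z0 + a / d * u + a * b / (c * d) * z3"
        using ab by (simp add: distrib_left)
      moreover have "b / d * u - u = a / d * u" using de by (simp add: d_def field_simps)
      moreover have "b / d * z3 - b * (d + e) / (c * d) * z3 = a * b / (c * d) * z3"
      proof -
        have "b / d = b * c / (c * d)" using ab by simp
        also have "\<dots> = b * (d + e) / (c * d) + a * b / (c * d)"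
          unfolding add_divide_distrib[symmetric] \<open>b * (d + e) + a * b = b * c\<close> ..
        finally show ?thesis by (simp add: distrib_right)
      qed
      ultimately show ?thesis by linarith
    qed
    have j: "a / (b * d) * j2 = a * b / d * (j2 / (b * b))" using ab by simp
    have s0: "s0 / d = a * b / d * (s0 / (a * b))" using ab by simp
    have s3: "s3 / e - b * (d + e) / (c * d) * (s3 / e) = - (a * b / d * (s3 / (b * c)))"
    proof -
      have "c * d - b * (d + e) = - a * e" by (simp add: d_def e_def algebra_simps)
      moreover have "1 - b * (d + e) / (c * d) = (c * d - b * (d + e)) / (c * d)"
        using ab de by (simp add: diff_divide_distrib)
      ultimately have "1 - b * (d + e) / (c * d) = - a * e / (c * d)" by simp
      then have "s3 / e - b * (d + e) / (c * d) * (s3 / e) = (- a * e / (c * d)) * (s3 / e)"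
        by (metis left_diff_distrib mult_1)
      also have "\<dots> = - (a * b / d * (s3 / (b * c)))" using ab de by simp
      finally show ?thesis .
    qed
    have s03: "b * (d + e) / (c * d) * (s03 / (d + e)) = a * b / d * (s03 / (a * c))" using ab de by simp
    show ?thesis
      unfolding e' using z j s0 s3 s03 by (simp add: distrib_left right_diff_distrib)
  qed
  then show ?thesis using rel by simp
qed

context ellipsoid
begin

text \<open>Lagrange's identity for \<open>x\<close> and \<open>y\<close> in the metric with weights
  \<open>1 / \<alpha> $ i\<close>: the weighted squared minors add up to the Gram determinant, which
  the constraints reduce to the form of \<open>y\<close> alone.\<close>

lemma lagrange_relation:
  assumes p: "p = (x, y)" "p \<in> M \<alpha>"
  shows "((x $ 0 * y $ 1 - x $ 1 * y $ 0)\<^sup>2 + (x $ 0 * y $ 2 - x $ 2 * y $ 0)\<^sup>2) / (\<alpha> $ 0 * \<alpha> $ 1)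
    + ((x $ 1 * y $ 3 - x $ 3 * y $ 1)\<^sup>2 + (x $ 2 * y $ 3 - x $ 3 * y $ 2)\<^sup>2) / (\<alpha> $ 1 * \<alpha> $ 3)
    + (x $ 0 * y $ 3 - x $ 3 * y $ 0)\<^sup>2 / (\<alpha> $ 0 * \<alpha> $ 3) + (Jfun p)\<^sup>2 / (\<alpha> $ 1 * \<alpha> $ 1)
    = (y $ 0)\<^sup>2 / \<alpha> $ 0 + ((y $ 1)\<^sup>2 + (y $ 2)\<^sup>2) / \<alpha> $ 1 + (y $ 3)\<^sup>2 / \<alpha> $ 3"
proof -
  define A B C where "A = inverse (\<alpha> $ 0)" and "B = inverse (\<alpha> $ 1)" and "C = inverse (\<alpha> $ 3)"
  have inv: "u / \<alpha> $ 0 = A * u" "u / \<alpha> $ 1 = B * u" "u / \<alpha> $ 3 = C * u" "u / (\<alpha> $ 0 * \<alpha> $ 1) = A * B * u"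
    "u / (\<alpha> $ 1 * \<alpha> $ 3) = B * C * u" "u / (\<alpha> $ 0 * \<alpha> $ 3) = A * C * u" "u / (\<alpha> $ 1 * \<alpha> $ 1) = B * B * u" for u
    by (simp_all add: A_def B_def C_def divide_inverse)
  have m: "A * (x $ 0)\<^sup>2 + B * ((x $ 1)\<^sup>2 + (x $ 2)\<^sup>2) + C * (x $ 3)\<^sup>2 = 1"
    "A * (x $ 0 * y $ 0) + B * (x $ 1 * y $ 1 + x $ 2 * y $ 2) + C * (x $ 3 * y $ 3) = 0"
    using M_eqs[OF p(2)] unfolding p fst_conv snd_conv inv .
  have "A * B * ((x $ 0 * y $ 1 - x $ 1 * y $ 0)\<^sup>2 + (x $ 0 * y $ 2 - x $ 2 * y $ 0)\<^sup>2)
    + B * C * ((x $ 1 * y $ 3 - x $ 3 * y $ 1)\<^sup>2 + (x $ 2 * y $ 3 - x $ 3 * y $ 2)\<^sup>2)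
    + A * C * (x $ 0 * y $ 3 - x $ 3 * y $ 0)\<^sup>2 + B * B * (Jfun p)\<^sup>2
    = (A * (x $ 0)\<^sup>2 + B * ((x $ 1)\<^sup>2 + (x $ 2)\<^sup>2) + C * (x $ 3)\<^sup>2) *
      (A * (y $ 0)\<^sup>2 + B * ((y $ 1)\<^sup>2 + (y $ 2)\<^sup>2) + C * (y $ 3)\<^sup>2)
      - (A * (x $ 0 * y $ 0) + B * (x $ 1 * y $ 1 + x $ 2 * y $ 2) + C * (x $ 3 * y $ 3))\<^sup>2"
    by (simp add: p Jfun_def power2_eq_square algebra_simps)
  then show ?thesis unfolding m inv by simp
qed

lemma upper_curve_minus_Gfun:
  assumes p: "p = (x, y)" "p \<in> M \<alpha>"
  shows "upper_curve \<alpha> (Hfun p) (Jfun p) - Gfun \<alpha> p =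
    \<alpha> $ 1 * (\<alpha> $ 3 - \<alpha> $ 0) / (\<alpha> $ 3 * (\<alpha> $ 1 - \<alpha> $ 0)) * ((y $ 3)\<^sup>2
      + ((x $ 1 * y $ 3 - x $ 3 * y $ 1)\<^sup>2 + (x $ 2 * y $ 3 - x $ 3 * y $ 2)\<^sup>2) / (\<alpha> $ 3 - \<alpha> $ 1)
      + (x $ 0 * y $ 3 - x $ 3 * y $ 0)\<^sup>2 / (\<alpha> $ 3 - \<alpha> $ 0))"
proof -
  have H: "Hfun p = ((y $ 0)\<^sup>2 + ((y $ 1)\<^sup>2 + (y $ 2)\<^sup>2) + (y $ 3)\<^sup>2) / 2" by (simp add: p(1) Hfun_def)
  have G: "Gfun \<alpha> p = ((y $ 1)\<^sup>2 + (y $ 2)\<^sup>2)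
     + ((x $ 0 * y $ 1 - x $ 1 * y $ 0)\<^sup>2 + (x $ 0 * y $ 2 - x $ 2 * y $ 0)\<^sup>2) / (\<alpha> $ 1 - \<alpha> $ 0)
     + ((x $ 1 * y $ 3 - x $ 3 * y $ 1)\<^sup>2 + (x $ 2 * y $ 3 - x $ 3 * y $ 2)\<^sup>2) / (\<alpha> $ 1 - \<alpha> $ 3)"
    by (simp add: p(1) Gfun_def)
  show ?thesis
    unfolding upper_curve_def H G
    by (rule sum_squares_normal_form) (use \<alpha>0 \<alpha>01 \<alpha>12 \<alpha>23 lagrange_relation[OF p] in auto)
qed

lemma upper_curve_ge:
  assumes p: "p \<in> M \<alpha>"
  shows "Gfun \<alpha> p \<le> upper_curve \<alpha> (Hfun p) (Jfun p)"
    and "snd p \<noteq> 0 \<Longrightarrow> Gfun \<alpha> p = upper_curve \<alpha> (Hfun p) (Jfun p) \<longleftrightarrow> off_axis p 3"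
proof -
  obtain x y where pe: "p = (x, y)" by (cases p)
  define s3 where "s3 = ((x $ 1 * y $ 3 - x $ 3 * y $ 1)\<^sup>2 + (x $ 2 * y $ 3 - x $ 3 * y $ 2)\<^sup>2) / (\<alpha> $ 3 - \<alpha> $ 1)"
  define s03 where "s03 = (x $ 0 * y $ 3 - x $ 3 * y $ 0)\<^sup>2 / (\<alpha> $ 3 - \<alpha> $ 0)"
  define k where "k = \<alpha> $ 1 * (\<alpha> $ 3 - \<alpha> $ 0) / (\<alpha> $ 3 * (\<alpha> $ 1 - \<alpha> $ 0))"
  have a: "\<alpha> $ 3 - \<alpha> $ 1 > 0" "\<alpha> $ 3 - \<alpha> $ 0 > 0" "\<alpha> $ 1 - \<alpha> $ 0 > 0" using \<alpha>01 \<alpha>12 \<alpha>23 by auto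
  have k: "k > 0" using a \<alpha>_pos[of 1] \<alpha>_pos[of 3] by (simp add: k_def)
  have eq: "upper_curve \<alpha> (Hfun p) (Jfun p) - Gfun \<alpha> p = k * ((y $ 3)\<^sup>2 + s3 + s03)"
    using upper_curve_minus_Gfun[OF pe p] by (simp add: k_def s3_def s03_def)
  have s: "0 \<le> s3" "0 \<le> s03" using a by (simp_all add: s3_def s03_def)
  have "0 \<le> k * ((y $ 3)\<^sup>2 + s3 + s03)" using k s by simp
  then show "Gfun \<alpha> p \<le> upper_curve \<alpha> (Hfun p) (Jfun p)" using eq by linarith
  show "Gfun \<alpha> p = upper_curve \<alpha> (Hfun p) (Jfun p) \<longleftrightarrow> off_axis p 3" if y: "snd p \<noteq> 0"
  proof
    assume "off_axis p 3"
    then have "(y $ 3)\<^sup>2 + s3 + s03 = 0" by (simp add: off_axis_def pe s3_def s03_def)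
    then show "Gfun \<alpha> p = upper_curve \<alpha> (Hfun p) (Jfun p)" using eq by simp
  next
    assume "Gfun \<alpha> p = upper_curve \<alpha> (Hfun p) (Jfun p)"
    then have "(y $ 3)\<^sup>2 + s3 + s03 = 0" using eq k by simp
    then have 0: "(y $ 3)\<^sup>2 = 0" "s3 = 0" "s03 = 0" using s zero_le_power2[of "y $ 3"] by linarith+
    then have y3: "y $ 3 = 0" by simp
    have "x $ 3 * y $ 1 = 0" "x $ 3 * y $ 2 = 0" "x $ 3 * y $ 0 = 0"
      using 0(2,3) a y3 by (auto simp: s3_def s03_def sum_power2_eq_zero_iff)
    moreover have "y $ 0 \<noteq> 0 \<or> y $ 1 \<noteq> 0 \<or> y $ 2 \<noteq> 0"
      using y y3 by (auto simp: pe cart_eq_iff all_index_4)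
    ultimately have "x $ 3 = 0" by auto
    then show "off_axis p 3" using y3 by (simp add: off_axis_def pe)
  qed
qed

text \<open>The squares occur here only after \<open>y\<^sub>0\<^sup>2\<close> is eliminated with the help of \<open>C\<^sub>1 = C\<^sub>2 = 0\<close>.\<close>

lemma Gfun_minus_lower_curve:
  assumes p: "p = (x, y)" "p \<in> M \<alpha>"
  shows "Gfun \<alpha> p - lower_curve \<alpha> (Hfun p) (Jfun p) =
    \<alpha> $ 1 * (\<alpha> $ 3 - \<alpha> $ 0) / (\<alpha> $ 0 * (\<alpha> $ 3 - \<alpha> $ 1)) * ((x $ 0)\<^sup>2 * (y \<bullet> wt \<alpha> y)
      + ((x $ 0 * y $ 1 - x $ 1 * y $ 0)\<^sup>2 + (x $ 0 * y $ 2 - x $ 2 * y $ 0)\<^sup>2) * \<alpha> $ 0 / (\<alpha> $ 1 * (\<alpha> $ 1 - \<alpha> $ 0))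
      + (x $ 0 * y $ 3 - x $ 3 * y $ 0)\<^sup>2 * \<alpha> $ 0 / (\<alpha> $ 3 * (\<alpha> $ 3 - \<alpha> $ 0)))"
proof -
  define s0 s3 s03 where "s0 = (x $ 0 * y $ 1 - x $ 1 * y $ 0)\<^sup>2 + (x $ 0 * y $ 2 - x $ 2 * y $ 0)\<^sup>2"
    and "s3 = (x $ 1 * y $ 3 - x $ 3 * y $ 1)\<^sup>2 + (x $ 2 * y $ 3 - x $ 3 * y $ 2)\<^sup>2"
    and "s03 = (x $ 0 * y $ 3 - x $ 3 * y $ 0)\<^sup>2"
  define a b c where "a = \<alpha> $ 0" and "b = \<alpha> $ 1" and "c = \<alpha> $ 3"
  have ab: "0 < a" "a < b" "b < c" using \<alpha>0 \<alpha>01 \<alpha>12 \<alpha>23 by (auto simp: a_def b_def c_def)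
  have H: "Hfun p = ((y $ 3)\<^sup>2 + ((y $ 1)\<^sup>2 + (y $ 2)\<^sup>2) + (y $ 0)\<^sup>2) / 2" by (simp add: p(1) Hfun_def)
  have G: "Gfun \<alpha> p = ((y $ 1)\<^sup>2 + (y $ 2)\<^sup>2) + s3 / (b - c) + s0 / (b - a)"
    by (simp add: p(1) Gfun_def s0_def s3_def a_def b_def c_def)
  \<comment> \<open>Here the parameters \<open>a\<close> and \<open>c\<close> of the normal form are
    exchanged; the squared minors then carry negative denominators.\<close>
  have "lower_curve \<alpha> (Hfun p) (Jfun p) - Gfun \<alpha> p = b * (a - c) / (a * (b - c)) * ((y $ 0)\<^sup>2 + s0 / (a - b) + s03 / (a - c))"
    unfolding lower_curve_def H G a_def[symmetric] b_def[symmetric] c_def[symmetric]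
    by (rule sum_squares_normal_form)
      (use ab lagrange_relation[OF p] in \<open>auto simp: s0_def s3_def s03_def a_def b_def c_def ac_simps\<close>)
  moreover have "b * (a - c) / (a * (b - c)) = b * (c - a) / (a * (c - b))"
    by (metis minus_diff_eq minus_divide_divide mult_minus_right)
  moreover have "s0 / (a - b) = - (s0 / (b - a))" "s03 / (a - c) = - (s03 / (c - a))"
    by (metis minus_diff_eq minus_divide_right)+
  \<comment> \<open>The squared length of \<open>x $ 0 *\<^sub>R y - y $ 0 *\<^sub>R x\<close> in
    the metric with weights \<open>1 / \<alpha> $ i\<close>, computed from the minors and, by the
    constraints, from the two vectors.\<close>
  moreover have "(y $ 0)\<^sup>2 = s0 / b + s03 / c - (x $ 0)\<^sup>2 * (y \<bullet> wt \<alpha> y)"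
  proof -
    define A B C where "A = inverse a" and "B = inverse b" and "C = inverse c"
    have inv: "u / a = A * u" "u / b = B * u" "u / c = C * u" for u
      by (simp_all add: A_def B_def C_def divide_inverse)
    have w: "y \<bullet> wt \<alpha> y = A * (y $ 0)\<^sup>2 + B * ((y $ 1)\<^sup>2 + (y $ 2)\<^sup>2) + C * (y $ 3)\<^sup>2"
      by (simp add: inner_vec_def sum_UNIV_4 \<alpha>12[symmetric] A_def B_def C_def a_def b_def c_def power2_eq_square divide_inverse algebra_simps)
    have m: "A * (x $ 0)\<^sup>2 + B * ((x $ 1)\<^sup>2 + (x $ 2)\<^sup>2) + C * (x $ 3)\<^sup>2 = 1"
      "A * (x $ 0 * y $ 0) + B * (x $ 1 * y $ 1 + x $ 2 * y $ 2) + C * (x $ 3 * y $ 3) = 0"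
      using M_eqs[OF p(2)] unfolding p fst_conv snd_conv a_def[symmetric] b_def[symmetric] c_def[symmetric] inv .
    have "B * s0 + C * s03 - (x $ 0)\<^sup>2 * (y \<bullet> wt \<alpha> y)
      = (y $ 0)\<^sup>2 * (A * (x $ 0)\<^sup>2 + B * ((x $ 1)\<^sup>2 + (x $ 2)\<^sup>2) + C * (x $ 3)\<^sup>2)
        - 2 * x $ 0 * y $ 0 * (A * (x $ 0 * y $ 0) + B * (x $ 1 * y $ 1 + x $ 2 * y $ 2) + C * (x $ 3 * y $ 3))"
      unfolding w by (simp add: s0_def s03_def power2_eq_square algebra_simps)
    then show ?thesis unfolding m inv by simp
  qed
  moreover have "s0 / (b - a) - s0 / b = s0 * a / (b * (b - a))" "s03 / (c - a) - s03 / c = s03 * a / (c * (c - a))"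
    using ab by (simp_all add: field_simps)
  ultimately have "lower_curve \<alpha> (Hfun p) (Jfun p) - Gfun \<alpha> p = b * (c - a) / (a * (c - b)) *
    (- ((x $ 0)\<^sup>2 * (y \<bullet> wt \<alpha> y) + s0 * a / (b * (b - a)) + s03 * a / (c * (c - a))))"
    by (smt (verit))
  then have "Gfun \<alpha> p - lower_curve \<alpha> (Hfun p) (Jfun p) = b * (c - a) / (a * (c - b)) *
    ((x $ 0)\<^sup>2 * (y \<bullet> wt \<alpha> y) + s0 * a / (b * (b - a)) + s03 * a / (c * (c - a)))"
    by (metis minus_diff_eq mult_minus_right minus_minus)
  then show ?thesis unfolding a_def b_def c_def s0_def s03_def .
qed

lemma lower_curve_le:
  assumes p: "p \<in> M \<alpha>"
  shows "lower_curve \<alpha> (Hfun p) (Jfun p) \<le> Gfun \<alpha> p"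
    and "snd p \<noteq> 0 \<Longrightarrow> Gfun \<alpha> p = lower_curve \<alpha> (Hfun p) (Jfun p) \<longleftrightarrow> off_axis p 0"
proof -
  obtain x y where pe: "p = (x, y)" by (cases p)
  define s0 where "s0 = ((x $ 0 * y $ 1 - x $ 1 * y $ 0)\<^sup>2 + (x $ 0 * y $ 2 - x $ 2 * y $ 0)\<^sup>2) * \<alpha> $ 0 / (\<alpha> $ 1 * (\<alpha> $ 1 - \<alpha> $ 0))"
  define s03 where "s03 = (x $ 0 * y $ 3 - x $ 3 * y $ 0)\<^sup>2 * \<alpha> $ 0 / (\<alpha> $ 3 * (\<alpha> $ 3 - \<alpha> $ 0))"
  define k where "k = \<alpha> $ 1 * (\<alpha> $ 3 - \<alpha> $ 0) / (\<alpha> $ 0 * (\<alpha> $ 3 - \<alpha> $ 1))"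
  define s where "s = (x $ 0)\<^sup>2 * (y \<bullet> wt \<alpha> y)"
  have a: "\<alpha> $ 3 - \<alpha> $ 1 > 0" "\<alpha> $ 3 - \<alpha> $ 0 > 0" "\<alpha> $ 1 - \<alpha> $ 0 > 0" using \<alpha>01 \<alpha>12 \<alpha>23 by auto
  have k: "k > 0" using a \<alpha>_pos[of 1] \<alpha>0 by (simp add: k_def)
  have eq: "Gfun \<alpha> p - lower_curve \<alpha> (Hfun p) (Jfun p) = k * (s + s0 + s03)"
    using Gfun_minus_lower_curve[OF pe p] by (simp add: k_def s_def s0_def s03_def)
  have "0 \<le> y \<bullet> wt \<alpha> y" using inner_wt_pos[of y] by (cases "y = 0") auto
  then have sp: "0 \<le> s" "0 \<le> s0" "0 \<le> s03" using a \<alpha>_pos[of 1] \<alpha>_pos[of 3] \<alpha>0 by (simp_all add: s_def s0_def s03_def)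
  have "0 \<le> k * (s + s0 + s03)" using k sp by simp
  then show "lower_curve \<alpha> (Hfun p) (Jfun p) \<le> Gfun \<alpha> p" using eq by linarith
  show "Gfun \<alpha> p = lower_curve \<alpha> (Hfun p) (Jfun p) \<longleftrightarrow> off_axis p 0" if y: "snd p \<noteq> 0"
  proof
    assume "off_axis p 0"
    then have "s + s0 + s03 = 0" by (simp add: off_axis_def pe s_def s0_def s03_def)
    then show "Gfun \<alpha> p = lower_curve \<alpha> (Hfun p) (Jfun p)" using eq by simp
  next
    assume "Gfun \<alpha> p = lower_curve \<alpha> (Hfun p) (Jfun p)"
    then have "s + s0 + s03 = 0" using eq k by simp
    then have 0: "s = 0" "s0 = 0" "s03 = 0" using sp by linarith+
    have "y \<bullet> wt \<alpha> y > 0" using y inner_wt_pos by (simp add: pe)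
    then have x0: "x $ 0 = 0" using 0(1) by (auto simp: s_def)
    have "x $ 1 * y $ 0 = 0" "x $ 2 * y $ 0 = 0" "x $ 3 * y $ 0 = 0"
      using 0(2,3) a \<alpha>_pos[of 1] \<alpha>_pos[of 3] \<alpha>0 x0 by (auto simp: s0_def s03_def sum_power2_eq_zero_iff)
    moreover have "x $ 1 \<noteq> 0 \<or> x $ 2 \<noteq> 0 \<or> x $ 3 \<noteq> 0" using M_eqs(1)[OF p] x0 by (auto simp: pe)
    ultimately have "y $ 0 = 0" by auto
    then show "off_axis p 0" using x0 by (simp add: off_axis_def pe)
  qed
qed

lemma critical_iff_off_axis:
  assumes h: "0 < Hfun p"
  shows "critical \<alpha> p \<longleftrightarrow> p \<in> M \<alpha> \<and> (off_axis p 0 \<or> off_axis p 3 \<or> off_axis p 1 \<and> off_axis p 2)"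
proof
  assume "critical \<alpha> p"
  then show "p \<in> M \<alpha> \<and> (off_axis p 0 \<or> off_axis p 3 \<or> off_axis p 1 \<and> off_axis p 2)"
    using critical_cases[OF _ h] critical_iff by blast
next
  assume *: "p \<in> M \<alpha> \<and> (off_axis p 0 \<or> off_axis p 3 \<or> off_axis p 1 \<and> off_axis p 2)"
  then have p: "p \<in> M \<alpha>" by simp
  note y = nonzero_of_Hfun_pos[OF h]
  have "boundary_comb \<alpha> m p \<noteq> 0" for m by (simp add: boundary_comb_def zero_prod_def)
  moreover have "(0, 1, 0) \<in> vanishing_combs \<alpha> p" if "off_axis p 1" "off_axis p 2"
    using vanishing_combs_meridian[OF p h that] by simp
  moreover have "(0, 1, 0) \<noteq> (0 :: real \<times> real \<times> real)" by (simp add: zero_prod_def)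
  ultimately show "critical \<alpha> p"
    using * boundary_comb_vanishing[OF p y] unfolding critical_iff by blast
qed

lemma Jfun_Gfun_meridian: "off_axis p 1 \<Longrightarrow> off_axis p 2 \<Longrightarrow> Jfun p = 0 \<and> Gfun \<alpha> p = 0"
  by (cases p) (simp add: Jfun_def Gfun_def off_axis_def)

text \<open>Both parabolas are \<open>j\<^sup>2 / \<alpha> $ 1\<close> plus a multiple of
  \<open>2 * h - j\<^sup>2 / \<alpha> $ 1\<close>, negative for the lower and positive for the upper
  one. They meet where this excess of energy is zero.\<close>

lemma upper_minus_lower:
  "upper_curve \<alpha> h j - lower_curve \<alpha> h j =
    (2 * h - j\<^sup>2 / \<alpha> $ 1) * (\<alpha> $ 1 / (\<alpha> $ 1 - \<alpha> $ 0) + \<alpha> $ 1 / (\<alpha> $ 3 - \<alpha> $ 1))"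
  and lower_curve_equator:
  "lower_curve \<alpha> h j = j\<^sup>2 / \<alpha> $ 1 - \<alpha> $ 1 / (\<alpha> $ 3 - \<alpha> $ 1) * (2 * h - j\<^sup>2 / \<alpha> $ 1)"
proof -
  define a b c where "a = \<alpha> $ 0" and "b = \<alpha> $ 1" and "c = \<alpha> $ 3"
  have ab: "0 < a" "a < b" "b < c" using \<alpha>0 \<alpha>01 \<alpha>12 \<alpha>23 by (auto simp: a_def b_def c_def)
  have L: "lower_curve \<alpha> h j = - (b / (c - b)) * (2 * h) + c / (b * (c - b)) * j\<^sup>2"
  proof -
    have "b - c = - (c - b)" by simp
    then show ?thesis
      unfolding lower_curve_def a_def[symmetric] b_def[symmetric] c_def[symmetric] by (simp only: mult_minus_right divide_minus_right) simp
  qed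
  have "c / (b * (c - b)) = 1 / b + b / (c - b) / b" using ab by (simp add: field_simps)
  then have L': "lower_curve \<alpha> h j = j\<^sup>2 / b - b / (c - b) * (2 * h - j\<^sup>2 / b)"
    unfolding L by (simp add: distrib_right right_diff_distrib)
  have "a / (b * (b - a)) = b / (b - a) / b - 1 / b" using ab by (simp add: field_simps)
  then have U: "upper_curve \<alpha> h j = j\<^sup>2 / b + b / (b - a) * (2 * h - j\<^sup>2 / b)"
    unfolding upper_curve_def a_def[symmetric] b_def[symmetric] by (simp add: left_diff_distrib right_diff_distrib)
  show "upper_curve \<alpha> h j - lower_curve \<alpha> h j =
    (2 * h - j\<^sup>2 / \<alpha> $ 1) * (\<alpha> $ 1 / (\<alpha> $ 1 - \<alpha> $ 0) + \<alpha> $ 1 / (\<alpha> $ 3 - \<alpha> $ 1))"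
    unfolding L' U a_def[symmetric] b_def[symmetric] c_def[symmetric] by (simp add: algebra_simps)
  show "lower_curve \<alpha> h j = j\<^sup>2 / \<alpha> $ 1 - \<alpha> $ 1 / (\<alpha> $ 3 - \<alpha> $ 1) * (2 * h - j\<^sup>2 / \<alpha> $ 1)"
    using L' by (simp add: b_def c_def)
qed

text \<open>Every value is attained over a point of the equator, by splitting the energy that is left by \<open>J\<close>
  between \<open>y\<^sub>0\<close> and \<open>y\<^sub>3\<close>.\<close>

lemma region_attained:
  assumes "(j, g) \<in> region \<alpha> h"
  shows "\<exists>p\<in>M \<alpha>. EM \<alpha> p = (h, j, g)"
proof -
  define b k where "b = \<alpha> $ 1" and "k = \<alpha> $ 1 / (\<alpha> $ 1 - \<alpha> $ 0) + \<alpha> $ 1 / (\<alpha> $ 3 - \<alpha> $ 1)"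
  have b: "b > 0" using \<alpha>_pos[of 1] by (simp add: b_def)
  have d: "\<alpha> $ 1 - \<alpha> $ 0 > 0" "\<alpha> $ 3 - \<alpha> $ 1 > 0" using \<alpha>01 \<alpha>12 \<alpha>23 by auto
  then have k: "k > 0" using b by (simp add: k_def b_def add_pos_pos)
  define W where "W = 2 * h - j\<^sup>2 / b"
  \<comment> \<open>\<open>\<sigma>\<close> will be the square of \<open>y $ 0\<close> and
    \<open>W - \<sigma>\<close> that of \<open>y $ 3\<close>; \<open>G\<close> grows linearly in
    \<open>\<sigma>\<close>, from the lower curve at 0 to the upper curve at
    \<open>W\<close>.\<close>
  define \<sigma> where "\<sigma> = (g - lower_curve \<alpha> h j) / k"
  have r: "lower_curve \<alpha> h j \<le> g" "g \<le> upper_curve \<alpha> h j" using assms by (simp_all add: region_def)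
  have "g - lower_curve \<alpha> h j \<le> W * k"
    using r(2) upper_minus_lower[of h j] by (simp add: W_def k_def b_def)
  then have \<sigma>: "0 \<le> \<sigma>" "\<sigma> \<le> W" using r(1) k by (simp_all add: \<sigma>_def pos_divide_le_eq)
  define x :: "real^4" where "x = axis 1 (sqrt b)"
  define y :: "real^4" where "y = (\<chi> i. if i = 0 then sqrt \<sigma> else if i = 1 then 0 else if i = 2 then j / sqrt b else sqrt (W - \<sigma>))"
  have xn: "x $ 0 = 0" "x $ 1 = sqrt b" "x $ 2 = 0" "x $ 3 = 0" by (simp_all add: x_def axis_def)
  have yn: "y $ 0 = sqrt \<sigma>" "y $ 1 = 0" "y $ 2 = j / sqrt b" "y $ 3 = sqrt (W - \<sigma>)" by (simp_all add: y_def)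
  have sq: "(sqrt b)\<^sup>2 = b" "(sqrt \<sigma>)\<^sup>2 = \<sigma>" "(sqrt (W - \<sigma>))\<^sup>2 = W - \<sigma>" "(j / sqrt b)\<^sup>2 = j\<^sup>2 / b"
    using b \<sigma> by (simp_all add: power_divide)
  have M: "(x, y) \<in> M \<alpha>"
    using b by (simp add: M_def C1_def C2_def sum_UNIV_4 xn yn sq b_def[symmetric])
  have H: "Hfun (x, y) = h" by (simp add: Hfun_def yn sq) (simp add: W_def)
  have J: "Jfun (x, y) = j" using b by (simp add: Jfun_def xn yn)
  have "Gfun \<alpha> (x, y) = j\<^sup>2 / b + b * \<sigma> / (b - \<alpha> $ 0) + b * (W - \<sigma>) / (b - \<alpha> $ 3)"
    by (simp add: Gfun_def xn yn sq power_mult_distrib b_def[symmetric])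
  also have "\<dots> = j\<^sup>2 / b - b / (\<alpha> $ 3 - b) * W + \<sigma> * k"
  proof -
    have "b * (W - \<sigma>) / (b - \<alpha> $ 3) = - (b * (W - \<sigma>) / (\<alpha> $ 3 - b))" by (metis minus_diff_eq minus_divide_right)
    then show ?thesis by (simp add: k_def b_def[symmetric] algebra_simps diff_divide_distrib)
  qed
  also have "\<dots> = lower_curve \<alpha> h j + \<sigma> * k"
    using lower_curve_equator[of h j] by (simp add: W_def b_def)
  also have "\<dots> = g" using k by (simp add: \<sigma>_def)
  finally show ?thesis using M H J by (auto simp: EM_def)
qed

section \<open>The region as a compact set and its frontier\<close>

lemma EM_value_in_region:
  assumes p: "p \<in> M \<alpha>"
  shows "(Jfun p, Gfun \<alpha> p) \<in> region \<alpha> (Hfun p)"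
  using lower_curve_le(1)[OF p] upper_curve_ge(1)[OF p] by (simp add: region_def)

lemma EM_image_eq: "EM_image \<alpha> h = region \<alpha> h"
proof (intro Set.set_eqI iffI)
  fix v assume "v \<in> EM_image \<alpha> h"
  then show "v \<in> region \<alpha> h" using EM_value_in_region by (auto simp: EM_image_def)
next
  fix v assume "v \<in> region \<alpha> h"
  then obtain p where "p \<in> M \<alpha>" "EM \<alpha> p = (h, fst v, snd v)" using region_attained[of "fst v" "snd v" h] by auto
  then have "v = (Jfun p, Gfun \<alpha> p)" "p \<in> M \<alpha>" "Hfun p = h" by (simp_all add: EM_def prod_eq_iff)
  then show "v \<in> EM_image \<alpha> h" unfolding EM_image_def by blast
qed

lemma continuous_curves:
  "continuous_on UNIV (\<lambda>v::real \<times> real. lower_curve \<alpha> h (fst v))"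
  "continuous_on UNIV (\<lambda>v::real \<times> real. upper_curve \<alpha> h (fst v))"
proof -
  have d: "\<alpha> $ 1 * (\<alpha> $ 1 - \<alpha> $ 3) \<noteq> 0" "\<alpha> $ 1 * (\<alpha> $ 1 - \<alpha> $ 0) \<noteq> 0" "\<alpha> $ 1 - \<alpha> $ 3 \<noteq> 0" "\<alpha> $ 1 - \<alpha> $ 0 \<noteq> 0"
    using \<alpha>0 \<alpha>01 \<alpha>12 \<alpha>23 by auto
  show "continuous_on UNIV (\<lambda>v::real \<times> real. lower_curve \<alpha> h (fst v))"
    "continuous_on UNIV (\<lambda>v::real \<times> real. upper_curve \<alpha> h (fst v))"
    unfolding lower_curve_def upper_curve_def by (intro continuous_intros)+
qed

lemma region_eq: "region \<alpha> h = {v. lower_curve \<alpha> h (fst v) \<le> snd v \<and> snd v \<le> upper_curve \<alpha> h (fst v)}"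
  by (auto simp: region_def)

lemma closed_region: "closed (region \<alpha> h)"
  unfolding region_eq by (intro closed_Collect_conj closed_Collect_le continuous_curves continuous_intros)

lemma compact_region: "compact (region \<alpha> h)"
proof -
  have d: "\<alpha> $ 1 - \<alpha> $ 0 > 0" "\<alpha> $ 3 - \<alpha> $ 1 > 0" "\<alpha> $ 1 > 0" using \<alpha>01 \<alpha>12 \<alpha>23 \<alpha>_pos by auto
  have "region \<alpha> h \<subseteq> cbox (- sqrt (2 * h * \<alpha> $ 1), - (\<alpha> $ 1 / (\<alpha> $ 3 - \<alpha> $ 1) * (2 * h)))
    (sqrt (2 * h * \<alpha> $ 1), 2 * \<alpha> $ 1 / (\<alpha> $ 1 - \<alpha> $ 0) * h)"
  proof
    fix v assume v: "v \<in> region \<alpha> h"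
    define j g where "j = fst v" and "g = snd v"
    have jg: "lower_curve \<alpha> h j \<le> g" "g \<le> upper_curve \<alpha> h j" using v by (simp_all add: region_eq j_def g_def)
    have k: "\<alpha> $ 1 / (\<alpha> $ 1 - \<alpha> $ 0) + \<alpha> $ 1 / (\<alpha> $ 3 - \<alpha> $ 1) > 0" using d by (simp add: add_pos_pos)
    \<comment> \<open>A point between the curves has upper value at least the lower one, which
      bounds \<open>j\<close>; the bounds for \<open>g\<close> then follow from the two
      curves.\<close>
    have "0 \<le> (2 * h - j\<^sup>2 / \<alpha> $ 1) * (\<alpha> $ 1 / (\<alpha> $ 1 - \<alpha> $ 0) + \<alpha> $ 1 / (\<alpha> $ 3 - \<alpha> $ 1))"
      using jg upper_minus_lower[of h j] by linarith
    then have "0 \<le> 2 * h - j\<^sup>2 / \<alpha> $ 1" using k by (simp add: zero_le_mult_iff)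
    then have "j\<^sup>2 \<le> 2 * h * \<alpha> $ 1" using d by (simp add: pos_divide_le_eq)
    then have "\<bar>j\<bar> \<le> sqrt (2 * h * \<alpha> $ 1)" by (rule real_le_rsqrt[of "\<bar>j\<bar>", simplified])
    moreover have "g \<le> 2 * \<alpha> $ 1 / (\<alpha> $ 1 - \<alpha> $ 0) * h"
    proof -
      have "0 \<le> \<alpha> $ 0 / (\<alpha> $ 1 * (\<alpha> $ 1 - \<alpha> $ 0)) * j\<^sup>2" using d \<alpha>0 by simp
      then show ?thesis using jg(2) unfolding upper_curve_def by linarith
    qed
    moreover have "- (\<alpha> $ 1 / (\<alpha> $ 3 - \<alpha> $ 1) * (2 * h)) \<le> g"
    proof -
      have "0 \<le> j\<^sup>2 / \<alpha> $ 1" "0 \<le> \<alpha> $ 1 / (\<alpha> $ 3 - \<alpha> $ 1) * (j\<^sup>2 / \<alpha> $ 1)" using d by simp_all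
      then show ?thesis using jg(1) unfolding lower_curve_equator right_diff_distrib by linarith
    qed
    ultimately show "v \<in> cbox (- sqrt (2 * h * \<alpha> $ 1), - (\<alpha> $ 1 / (\<alpha> $ 3 - \<alpha> $ 1) * (2 * h)))
      (sqrt (2 * h * \<alpha> $ 1), 2 * \<alpha> $ 1 / (\<alpha> $ 1 - \<alpha> $ 0) * h)"
      by (cases v) (auto simp: j_def g_def cbox_Pair_iff)
  qed
  then have "bounded (region \<alpha> h)" using bounded_cbox bounded_subset by blast
  then show ?thesis using closed_region compact_eq_bounded_closed by blast
qed

lemma open_strict_region: "open {v. lower_curve \<alpha> h (fst v) < snd v \<and> snd v < upper_curve \<alpha> h (fst v)}"
  by (intro open_Collect_conj open_Collect_less continuous_curves continuous_intros)

lemma interior_region: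
  "interior (region \<alpha> h) = {v. lower_curve \<alpha> h (fst v) < snd v \<and> snd v < upper_curve \<alpha> h (fst v)}"
proof
  show "{v. lower_curve \<alpha> h (fst v) < snd v \<and> snd v < upper_curve \<alpha> h (fst v)} \<subseteq> interior (region \<alpha> h)"
    by (rule interior_maximal[OF _ open_strict_region]) (auto simp: region_eq)
  show "interior (region \<alpha> h) \<subseteq> {v. lower_curve \<alpha> h (fst v) < snd v \<and> snd v < upper_curve \<alpha> h (fst v)}"
  proof
    fix v assume "v \<in> interior (region \<alpha> h)"
    then obtain e where e: "e > 0" "cball v e \<subseteq> region \<alpha> h" using mem_interior_cball by blast
    \<comment> \<open>Vertical shifts in both directions stay in the region, so both inequalities
      are strict at \<open>v\<close>.\<close>
    have "v + (0, t) \<in> region \<alpha> h" if "\<bar>t\<bar> \<le> e" for t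
    proof -
      have "v + (0, t) \<in> cball v e" using that by (simp add: dist_norm norm_Pair)
      then show ?thesis using e by blast
    qed
    from this[of e] this[of "- e"] show "v \<in> {v. lower_curve \<alpha> h (fst v) < snd v \<and> snd v < upper_curve \<alpha> h (fst v)}"
      using e(1) by (simp add: region_eq)
  qed
qed

lemma frontier_region: "frontier (region \<alpha> h) = boundary_curves \<alpha> h"
  unfolding frontier_def interior_region closure_closed[OF closed_region]
  by (auto simp: boundary_curves_def region_eq)

lemma curves_at_0:
  assumes "0 < h"
  shows "lower_curve \<alpha> h 0 < 0" "0 < upper_curve \<alpha> h 0"
  using assms \<alpha>0 \<alpha>01 \<alpha>12 \<alpha>23 by (simp_all add: lower_curve_def upper_curve_def divide_neg_pos mult_neg_pos divide_pos_neg)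

section \<open>Fibres over the singular values and their types\<close>

lemma singular_value_on_curves:
  assumes p: "p \<in> M \<alpha>" and h: "0 < h" and v: "EM \<alpha> p = (h, j, g)"
  shows "g = lower_curve \<alpha> h j \<longleftrightarrow> off_axis p 0" "g = upper_curve \<alpha> h j \<longleftrightarrow> off_axis p 3"
proof -
  have e: "Hfun p = h" "Jfun p = j" "Gfun \<alpha> p = g" using v by (simp_all add: EM_def)
  have y: "snd p \<noteq> 0" using nonzero_of_Hfun_pos[of p] e h by simp
  show "g = lower_curve \<alpha> h j \<longleftrightarrow> off_axis p 0" "g = upper_curve \<alpha> h j \<longleftrightarrow> off_axis p 3"
    using lower_curve_le(2)[OF p y] upper_curve_ge(2)[OF p y] unfolding e by simp_all
qed

lemma meridian_point:
  assumes "0 < h"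
  shows "\<exists>p\<in>M \<alpha>. Hfun p = h \<and> off_axis p 1 \<and> off_axis p 2"
proof
  let ?p = "(axis 0 (sqrt (\<alpha> $ 0)), axis 3 (sqrt (2 * h))) :: phase"
  show "?p \<in> M \<alpha>"
    using \<alpha>0 by (simp add: M_def C1_def C2_def sum_UNIV_4 axis_def)
  show "Hfun ?p = h \<and> off_axis ?p 1 \<and> off_axis ?p 2"
    using assms by (simp add: Hfun_def off_axis_def axis_def)
qed

lemma singular_values_eq:
  assumes h: "0 < h"
  shows "singular_values \<alpha> h = boundary_curves \<alpha> h \<union> {(0, 0)}"
proof (intro Set.set_eqI iffI)
  fix v assume "v \<in> singular_values \<alpha> h"
  then obtain p j g where p: "critical \<alpha> p" and v: "v = (j, g)" "EM \<alpha> p = (h, j, g)"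
    unfolding singular_values_def by blast
  have e: "Hfun p = h" "Jfun p = j" "Gfun \<alpha> p = g" using v by (simp_all add: EM_def)
  have pM: "p \<in> M \<alpha>" "off_axis p 0 \<or> off_axis p 3 \<or> off_axis p 1 \<and> off_axis p 2"
    using p critical_iff_off_axis[of p] h e by auto
  have "(j, g) \<in> region \<alpha> h" using EM_value_in_region[OF pM(1)] e by simp
  then show "v \<in> boundary_curves \<alpha> h \<union> {(0, 0)}"
    using pM(2) singular_value_on_curves[OF pM(1) h v(2)] Jfun_Gfun_meridian[of p] e v(1)
    by (auto simp: boundary_curves_def)
next
  fix v assume v: "v \<in> boundary_curves \<alpha> h \<union> {(0, 0)}"
  show "v \<in> singular_values \<alpha> h"
  proof (cases "v = (0, 0)")
    case True
    obtain p where p: "p \<in> M \<alpha>" "Hfun p = h" "off_axis p 1" "off_axis p 2" using meridian_point[OF h] by blast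
    then have "critical \<alpha> p" "EM \<alpha> p = (h, 0, 0)"
      using critical_iff_off_axis[of p] h Jfun_Gfun_meridian[of p] by (auto simp: EM_def)
    then show ?thesis using True unfolding singular_values_def by blast
  next
    case False
    obtain j g where jg: "v = (j, g)" by (cases v)
    then have b: "(j, g) \<in> region \<alpha> h" "g = lower_curve \<alpha> h j \<or> g = upper_curve \<alpha> h j"
      using v False by (auto simp: boundary_curves_def)
    obtain p where p: "p \<in> M \<alpha>" "EM \<alpha> p = (h, j, g)" using region_attained[OF b(1)] by blast
    then have "0 < Hfun p" using h by (simp add: EM_def)
    then have "critical \<alpha> p"
      using b(2) singular_value_on_curves[OF p(1) h p(2)] p(1) critical_iff_off_axis by blast
    then show ?thesis using p jg unfolding singular_values_def by blast
  qed
qed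

lemma origin_not_boundary:
  assumes "0 < h"
  shows "lower_curve \<alpha> h (fst v) < snd v \<and> snd v < upper_curve \<alpha> h (fst v) \<and> v \<in> singular_values \<alpha> h \<longleftrightarrow> v = (0, 0)"
  using curves_at_0[OF assms] unfolding singular_values_eq[OF assms] by (auto simp: boundary_curves_def)

lemma origin_isolated:
  assumes "0 < h"
  shows "(0, 0) isolated_in singular_values \<alpha> h"
  unfolding isolated_in_def
proof (intro conjI exI)
  show "(0, 0) \<in> singular_values \<alpha> h" by (simp add: singular_values_eq[OF assms])
  \<comment> \<open>The open region strictly between the curves isolates the origin, since the
    remaining singular values lie on the curves.\<close>
  show "open {v. lower_curve \<alpha> h (fst v) < snd v \<and> snd v < upper_curve \<alpha> h (fst v)}" by (rule open_strict_region)
  show "{v. lower_curve \<alpha> h (fst v) < snd v \<and> snd v < upper_curve \<alpha> h (fst v)} \<inter> singular_values \<alpha> h = {(0, 0)}"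
    using origin_not_boundary[OF assms] by auto
qed

lemma singular_value_of_typeI:
  assumes "0 < h" "v \<in> boundary_curves \<alpha> h \<union> {(0, 0)}"
    and "\<And>p. p \<in> M \<alpha> \<Longrightarrow> Hfun p = h \<Longrightarrow> EM \<alpha> p = (h, v) \<Longrightarrow>
      off_axis p 0 \<or> off_axis p 3 \<or> off_axis p 1 \<and> off_axis p 2 \<Longrightarrow> typ \<alpha> p"
  shows "singular_value_of_type \<alpha> h typ v"
  unfolding singular_value_of_type_def
proof (intro conjI allI impI)
  show "v \<in> singular_values \<alpha> h" using assms(1,2) singular_values_eq by blast
  fix p assume p: "critical \<alpha> p \<and> EM \<alpha> p = (h, v)"
  then have "Hfun p = h" by (simp add: EM_def)
  then show "typ \<alpha> p" using p assms(1,3) critical_iff_off_axis[of p] by simp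
qed

lemma boundary_elliptic:
  assumes h: "0 < h" and v: "v \<in> boundary_curves \<alpha> h - intersections \<alpha> h"
  shows "singular_value_of_type \<alpha> h elliptic v"
proof (rule singular_value_of_typeI[OF h])
  show "v \<in> boundary_curves \<alpha> h \<union> {(0, 0)}" using v by blast
  fix p assume p: "p \<in> M \<alpha>" "Hfun p = h" "EM \<alpha> p = (h, v)"
  obtain j g where jg: "v = (j, g)" by (cases v)
  note c = singular_value_on_curves[OF p(1) h p(3)[unfolded jg]]
  have "off_axis p 0 \<or> off_axis p 3" "\<not> (off_axis p 0 \<and> off_axis p 3)"
    using v c by (auto simp: jg boundary_curves_def intersections_def)
  moreover have "0 < Hfun p" using p h by simp
  ultimately show "elliptic \<alpha> p"
    using elliptic_boundary[OF p(1), of 0 3] elliptic_boundary[OF p(1), of 3 0] by blast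
qed

lemma intersections_elliptic_elliptic:
  assumes h: "0 < h" and v: "v \<in> intersections \<alpha> h"
  shows "singular_value_of_type \<alpha> h elliptic_elliptic v"
proof (rule singular_value_of_typeI[OF h])
  show "v \<in> boundary_curves \<alpha> h \<union> {(0, 0)}"
    using v by (auto simp: intersections_def boundary_curves_def region_def)
  fix p assume p: "p \<in> M \<alpha>" "Hfun p = h" "EM \<alpha> p = (h, v)"
  obtain j g where jg: "v = (j, g)" by (cases v)
  note c = singular_value_on_curves[OF p(1) h p(3)[unfolded jg]]
  have "off_axis p 0" "off_axis p 3" using v c by (auto simp: jg intersections_def)
  then show "elliptic_elliptic \<alpha> p" using elliptic_elliptic_equator[OF p(1)] p(2) h by simp
qed

lemma origin_focus_focus:
  assumes h: "0 < h"
  shows "singular_value_of_type \<alpha> h focus_focus (0, 0)"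
proof (rule singular_value_of_typeI[OF h])
  fix p assume p: "p \<in> M \<alpha>" "Hfun p = h" "EM \<alpha> p = (h, 0, 0)"
    and "off_axis p 0 \<or> off_axis p 3 \<or> off_axis p 1 \<and> off_axis p 2"
  then have "off_axis p 1 \<and> off_axis p 2"
    using singular_value_on_curves[OF p(1) h p(3)] curves_at_0[OF h] by auto
  then show "focus_focus \<alpha> p" using focus_focus_meridian[OF p(1)] p(2) h by simp
qed simp

end

theorem theorem5p1:
  fixes \<alpha> :: "real^4" and h :: real
  assumes "0 < \<alpha> $ 0" and "\<alpha> $ 0 < \<alpha> $ 1" and "\<alpha> $ 1 = \<alpha> $ 2" and "\<alpha> $ 2 < \<alpha> $ 3"
    and "h > 0"
  shows "EM_image \<alpha> h = region \<alpha> h \<and> compact (region \<alpha> h) \<and>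
      frontier (region \<alpha> h) = boundary_curves \<alpha> h \<and>
      singular_values \<alpha> h = boundary_curves \<alpha> h \<union> {(0, 0)} \<and>
      (\<forall>v \<in> boundary_curves \<alpha> h - intersections \<alpha> h. singular_value_of_type \<alpha> h elliptic v) \<and>
      (\<forall>v \<in> intersections \<alpha> h. singular_value_of_type \<alpha> h elliptic_elliptic v) \<and>
      (0, 0) isolated_in singular_values \<alpha> h \<and>
      singular_value_of_type \<alpha> h focus_focus (0, 0)"
proof -
  interpret ellipsoid \<alpha> by unfold_locales (use assms in auto)
  note h = assms(5)
  show ?thesis
    using EM_image_eq compact_region frontier_region singular_values_eq[OF h] boundary_elliptic[OF h]
      intersections_elliptic_elliptic[OF h] origin_isolated[OF h] origin_focus_focus[OF h]
    by blast
qed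

end
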